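(* Let $k$ be an infinite field, let $\Theta$ be the variety of all linear algebras over $k$, and let $\Theta^0$ be the category of its finitely generated free algebras. Let $\mathfrak{A}$ be the group of all automorphisms of the category $\Theta^0$ and let $\mathfrak{Y}\trianglelefteq\mathfrak{A}$ be the normal subgroup of all inner automorphisms of $\Theta^0$. Let $G$ be the group of all invertible $2\times 2$ matrices over $k$ of the form $\begin{pmatrix} a & b\\ b & a\end{pmatrix}$, let $k^{*}I_2\le G$ be the subgroup of invertible scalar matrices, and let $\mathrm{Aut}\,k$ be the group of field automorphisms of $k$. Then $$\mathfrak{A}/\mathfrak{Y}\;\cong\;\left(G/k^{*}I_2\right)\rtimes \mathrm{Aut}\,k ,$$ where $\varphi\in\mathrm{Aut}\,k$ acts on $G/k^{*}I_2$ via the entrywise action $\varphi\begin{pmatrix} a & b\\ b & a\end{pmatrix}=\begin{pmatrix} \varphi(a) & \varphi(b)\\ \varphi(b) & \varphi(a)\end{pmatrix}$ on $G$ (which preserves $k^{*}I_2$).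
   Context: A linear algebra over $k$ is a $k$-vector space $H$ with a $k$-bilinear multiplication $H\times H\to H$ (no associativity, commutativity or unit is assumed); homomorphisms are $k$-linear multiplicative maps. $\Theta$ is the variety of all linear algebras over $k$. Let $X_0=\{x_1,x_2,\ldots\}$ be a countable set of symbols. The category $\Theta^0$ has as objects the free algebras $F(X)$ of $\Theta$ freely generated by the finite subsets $X\subset X_0$, and as morphisms all homomorphisms between them. An automorphism $\Upsilon$ of a category $\mathfrak{K}$ (an invertible functor $\mathfrak K\to\mathfrak K$) is inner if it is isomorphic as a functor to the identity functor: for every object $A$ there is an isomorphism $s_A:A\to\Upsilon(A)$ such that $\Upsilon(\alpha)s_A=s_B\alpha$ for every morphism $\alpha:A\to B$. *)

theory Defs
  imports
    "HOL-Algebra.Module" "HOL-Algebra.Coset" "HOL-Algebra.Bij"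
    "HOL-Library.Poly_Mapping" "HOL-Analysis.Cartesian_Space"
begin

section \<open>Categories and their automorphisms\<close>

record ('o, 'm) category =
  Ob :: "'o set"
  Mor :: "'m set"
  Dom :: "'m \<Rightarrow> 'o"
  Cod :: "'m \<Rightarrow> 'o"
  Ident :: "'o \<Rightarrow> 'm"
  Comp :: "'m \<Rightarrow> 'm \<Rightarrow> 'm"

definition Hom :: "('o, 'm) category \<Rightarrow> 'o \<Rightarrow> 'o \<Rightarrow> 'm set" where
  "Hom C A B = {f \<in> Mor C. Dom C f = A \<and> Cod C f = B}"

locale category =
  fixes C :: "('o, 'm) category"
  assumes Dom_Ob: "f \<in> Mor C \<Longrightarrow> Dom C f \<in> Ob C"
    and Cod_Ob: "f \<in> Mor C \<Longrightarrow> Cod C f \<in> Ob C"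
    and Ident_Hom: "A \<in> Ob C \<Longrightarrow> Ident C A \<in> Hom C A A"
    and Comp_Hom: "f \<in> Hom C A B \<Longrightarrow> g \<in> Hom C B D \<Longrightarrow> Comp C g f \<in> Hom C A D"
    and Ident_left: "f \<in> Hom C A B \<Longrightarrow> Comp C (Ident C B) f = f"
    and Ident_right: "f \<in> Hom C A B \<Longrightarrow> Comp C f (Ident C A) = f"
    and Comp_assoc: "f \<in> Hom C A B \<Longrightarrow> g \<in> Hom C B D \<Longrightarrow> h \<in> Hom C D E \<Longrightarrow>
          Comp C h (Comp C g f) = Comp C (Comp C h g) f"

definition cat_iso :: "('o, 'm) category \<Rightarrow> 'o \<Rightarrow> 'o \<Rightarrow> 'm set" where
  "cat_iso C A B = {f \<in> Hom C A B. \<exists>g \<in> Hom C B A.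
     Comp C g f = Ident C A \<and> Comp C f g = Ident C B}"

text \<open>
  A functor is the pair of its object map and its arrow map.  Both are extensional, so that
  equality of functors is equality on the objects and arrows of the category only.
\<close>

definition endofunctors :: "('o, 'm) category \<Rightarrow> (('o \<Rightarrow> 'o) \<times> ('m \<Rightarrow> 'm)) set" where
  "endofunctors C = {(Fo, Fm).
     Fo \<in> extensional (Ob C) \<and> Fm \<in> extensional (Mor C) \<and>
     (\<forall>A \<in> Ob C. Fo A \<in> Ob C) \<and>
     (\<forall>A \<in> Ob C. \<forall>B \<in> Ob C. \<forall>f \<in> Hom C A B. Fm f \<in> Hom C (Fo A) (Fo B)) \<and>
     (\<forall>A \<in> Ob C. Fm (Ident C A) = Ident C (Fo A)) \<and>
     (\<forall>A \<in> Ob C. \<forall>B \<in> Ob C. \<forall>D \<in> Ob C. \<forall>f \<in> Hom C A B. \<forall>g \<in> Hom C B D.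
        Fm (Comp C g f) = Comp C (Fm g) (Fm f))}"

definition End_monoid :: "('o, 'm) category \<Rightarrow> (('o \<Rightarrow> 'o) \<times> ('m \<Rightarrow> 'm)) monoid" where
  "End_monoid C =
     \<lparr>carrier = endofunctors C,
      mult = (\<lambda>F G. (compose (Ob C) (fst F) (fst G), compose (Mor C) (snd F) (snd G))),
      one = (\<lambda>A \<in> Ob C. A, \<lambda>f \<in> Mor C. f)\<rparr>"

definition Aut_group :: "('o, 'm) category \<Rightarrow> (('o \<Rightarrow> 'o) \<times> ('m \<Rightarrow> 'm)) monoid" where
  "Aut_group C = units_of (End_monoid C)"

definition inner_automorphisms :: "('o, 'm) category \<Rightarrow> (('o \<Rightarrow> 'o) \<times> ('m \<Rightarrow> 'm)) set" where
  "inner_automorphisms C = {(Fo, Fm) \<in> carrier (Aut_group C).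
     \<exists>s. (\<forall>A \<in> Ob C. s A \<in> cat_iso C A (Fo A)) \<and>
         (\<forall>A \<in> Ob C. \<forall>B \<in> Ob C. \<forall>f \<in> Hom C A B. Comp C (Fm f) (s A) = Comp C (s B) f)}"

context category
begin

lemma Hom_Ob:
  assumes "f \<in> Hom C A B" shows "A \<in> Ob C" "B \<in> Ob C" "f \<in> Mor C"
  using assms Dom_Ob Cod_Ob by (auto simp: Hom_def)

lemma Mor_Hom: "f \<in> Mor C \<Longrightarrow> f \<in> Hom C (Dom C f) (Cod C f)"
  by (simp add: Hom_def)

lemma endofunctorD:
  assumes "F \<in> endofunctors C"
  shows "fst F \<in> extensional (Ob C)" "snd F \<in> extensional (Mor C)"
    "A \<in> Ob C \<Longrightarrow> fst F A \<in> Ob C"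
    "f \<in> Hom C A B \<Longrightarrow> snd F f \<in> Hom C (fst F A) (fst F B)"
    "A \<in> Ob C \<Longrightarrow> snd F (Ident C A) = Ident C (fst F A)"
    "f \<in> Hom C A B \<Longrightarrow> g \<in> Hom C B D \<Longrightarrow> snd F (Comp C g f) = Comp C (snd F g) (snd F f)"
    "f \<in> Mor C \<Longrightarrow> snd F f \<in> Mor C"
proof -
  note F = assms[unfolded endofunctors_def case_prod_beta mem_Collect_eq]
  show "fst F \<in> extensional (Ob C)" "snd F \<in> extensional (Mor C)"
    using F by blast+
  show "fst F A \<in> Ob C" "snd F (Ident C A) = Ident C (fst F A)" if "A \<in> Ob C"
    using F that by blast+
  show *: "snd F f \<in> Hom C (fst F A) (fst F B)" if f: "f \<in> Hom C A B" for A B f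
    using F f Hom_Ob(1,2)[OF f] by blast
  show "snd F (Comp C g f) = Comp C (snd F g) (snd F f)"
    if f: "f \<in> Hom C A B" and g: "g \<in> Hom C B D"
    using F f g Hom_Ob(1,2)[OF f] Hom_Ob(2)[OF g] by blast
  show "snd F f \<in> Mor C" if "f \<in> Mor C"
    using *[OF Mor_Hom[OF that]] by (rule Hom_Ob(3))
qed

lemma endofunctorI:
  assumes "Fo \<in> extensional (Ob C)" "Fm \<in> extensional (Mor C)"
    and "\<And>A. A \<in> Ob C \<Longrightarrow> Fo A \<in> Ob C"
    and "\<And>A B f. f \<in> Hom C A B \<Longrightarrow> Fm f \<in> Hom C (Fo A) (Fo B)"
    and "\<And>A. A \<in> Ob C \<Longrightarrow> Fm (Ident C A) = Ident C (Fo A)"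
    and "\<And>A B D f g. f \<in> Hom C A B \<Longrightarrow> g \<in> Hom C B D \<Longrightarrow>
      Fm (Comp C g f) = Comp C (Fm g) (Fm f)"
  shows "(Fo, Fm) \<in> endofunctors C"
  using assms by (simp add: endofunctors_def)

lemma monoid_End: "monoid (End_monoid C)"
proof (rule monoidI)
  fix F G assume FG: "F \<in> carrier (End_monoid C)" "G \<in> carrier (End_monoid C)"
  then have F: "F \<in> endofunctors C" and G: "G \<in> endofunctors C"
    by (simp_all add: End_monoid_def)
  have "(compose (Ob C) (fst F) (fst G), compose (Mor C) (snd F) (snd G)) \<in> endofunctors C"
  proof (rule endofunctorI)
    fix A B f assume f: "f \<in> Hom C A B"
    show "compose (Mor C) (snd F) (snd G) f
        \<in> Hom C (compose (Ob C) (fst F) (fst G) A) (compose (Ob C) (fst F) (fst G) B)"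
      using Hom_Ob[OF f] endofunctorD(4)[OF F endofunctorD(4)[OF G f]] by (simp add: compose_eq)
  next
    fix A assume A: "A \<in> Ob C"
    show "compose (Ob C) (fst F) (fst G) A \<in> Ob C"
      using A endofunctorD(3)[OF F endofunctorD(3)[OF G A]] by (simp add: compose_eq)
    show "compose (Mor C) (snd F) (snd G) (Ident C A) =
        Ident C (compose (Ob C) (fst F) (fst G) A)"
      using A Hom_Ob(3)[OF Ident_Hom[OF A]] endofunctorD(5)[OF G A]
        endofunctorD(5)[OF F endofunctorD(3)[OF G A]] by (simp add: compose_eq)
  next
    fix A B D f g assume f: "f \<in> Hom C A B" and g: "g \<in> Hom C B D"
    show "compose (Mor C) (snd F) (snd G) (Comp C g f) =
        Comp C (compose (Mor C) (snd F) (snd G) g) (compose (Mor C) (snd F) (snd G) f)"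
      using Hom_Ob(3)[OF f] Hom_Ob(3)[OF g] Hom_Ob(3)[OF Comp_Hom[OF f g]]
        endofunctorD(6)[OF G f g]
        endofunctorD(6)[OF F endofunctorD(4)[OF G f] endofunctorD(4)[OF G g]]
      by (simp add: compose_eq)
  qed (rule compose_extensional)+
  then show "F \<otimes>\<^bsub>End_monoid C\<^esub> G \<in> carrier (End_monoid C)"
    by (simp add: End_monoid_def)
next
  have "(\<lambda>A \<in> Ob C. A, \<lambda>f \<in> Mor C. f) \<in> endofunctors C"
  proof (rule endofunctorI)
    fix A B D f g assume f: "f \<in> Hom C A B" and g: "g \<in> Hom C B D"
    show "(\<lambda>f \<in> Mor C. f) (Comp C g f) =
        Comp C ((\<lambda>f \<in> Mor C. f) g) ((\<lambda>f \<in> Mor C. f) f)"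
      using Hom_Ob(3)[OF f] Hom_Ob(3)[OF g] Hom_Ob(3)[OF Comp_Hom[OF f g]] by simp
  next
    fix A assume A: "A \<in> Ob C"
    then show "(\<lambda>f \<in> Mor C. f) (Ident C A) = Ident C ((\<lambda>A \<in> Ob C. A) A)"
      using Hom_Ob(3)[OF Ident_Hom[OF A]] by simp
  next
    fix A B f assume f: "f \<in> Hom C A B"
    then show "(\<lambda>f \<in> Mor C. f) f \<in> Hom C ((\<lambda>A \<in> Ob C. A) A) ((\<lambda>A \<in> Ob C. A) B)"
      using Hom_Ob[OF f] by simp
  qed simp_all
  then show "\<one>\<^bsub>End_monoid C\<^esub> \<in> carrier (End_monoid C)"
    by (simp add: End_monoid_def)
next
  fix F G H
  assume "F \<in> carrier (End_monoid C)" "G \<in> carrier (End_monoid C)" "H \<in> carrier (End_monoid C)"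
  then have H: "H \<in> endofunctors C"
    by (simp add: End_monoid_def)
  show "F \<otimes>\<^bsub>End_monoid C\<^esub> G \<otimes>\<^bsub>End_monoid C\<^esub> H = F \<otimes>\<^bsub>End_monoid C\<^esub> (G \<otimes>\<^bsub>End_monoid C\<^esub> H)"
    using endofunctorD(3,7)[OF H] by (auto simp: End_monoid_def compose_def fun_eq_iff)
next
  fix F assume "F \<in> carrier (End_monoid C)"
  then have F: "F \<in> endofunctors C"
    by (simp add: End_monoid_def)
  show "\<one>\<^bsub>End_monoid C\<^esub> \<otimes>\<^bsub>End_monoid C\<^esub> F = F"
    using endofunctorD(1,2,3,7)[OF F]
    by (auto simp: End_monoid_def compose_def fun_eq_iff extensional_def prod_eq_iff)
  show "F \<otimes>\<^bsub>End_monoid C\<^esub> \<one>\<^bsub>End_monoid C\<^esub> = F"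
    using endofunctorD(1,2,3,7)[OF F]
    by (auto simp: End_monoid_def compose_def fun_eq_iff extensional_def prod_eq_iff)
qed

lemma group_Aut: "group (Aut_group C)"
  unfolding Aut_group_def by (rule monoid.units_group[OF monoid_End])

lemma Aut_endofunctor: "F \<in> carrier (Aut_group C) \<Longrightarrow> F \<in> endofunctors C"
  by (simp add: Aut_group_def units_of_def Units_def End_monoid_def)

lemma Aut_mult:
  "F \<otimes>\<^bsub>Aut_group C\<^esub> G =
     (compose (Ob C) (fst F) (fst G), compose (Mor C) (snd F) (snd G))"
  by (simp add: Aut_group_def units_of_def End_monoid_def)

lemma Aut_one: "\<one>\<^bsub>Aut_group C\<^esub> = (\<lambda>A \<in> Ob C. A, \<lambda>f \<in> Mor C. f)"
  by (simp add: Aut_group_def units_of_def End_monoid_def)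

lemma Aut_inv:
  assumes F: "F \<in> carrier (Aut_group C)"
  defines "G \<equiv> inv\<^bsub>Aut_group C\<^esub> F"
  shows "A \<in> Ob C \<Longrightarrow> fst F (fst G A) = A" "f \<in> Mor C \<Longrightarrow> snd F (snd G f) = f"
proof -
  interpret group "Aut_group C" by (rule group_Aut)
  have eq: "(compose (Ob C) (fst F) (fst G), compose (Mor C) (snd F) (snd G)) =
      (\<lambda>A \<in> Ob C. A, \<lambda>f \<in> Mor C. f)"
    unfolding G_def using r_inv[OF F] by (simp only: Aut_mult Aut_one)
  show "fst F (fst G A) = A" if "A \<in> Ob C" for A
    using fun_cong[OF arg_cong[OF eq, of fst], of A] that by (simp add: compose_eq)
  show "snd F (snd G f) = f" if "f \<in> Mor C" for f
    using fun_cong[OF arg_cong[OF eq, of snd], of f] that by (simp add: compose_eq)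
qed

lemma inner_automorphismsD:
  assumes "F \<in> inner_automorphisms C"
  obtains s t where "F \<in> carrier (Aut_group C)"
    "\<And>A. A \<in> Ob C \<Longrightarrow> s A \<in> Hom C A (fst F A)"
    "\<And>A. A \<in> Ob C \<Longrightarrow> t A \<in> Hom C (fst F A) A"
    "\<And>A. A \<in> Ob C \<Longrightarrow> Comp C (t A) (s A) = Ident C A"
    "\<And>A. A \<in> Ob C \<Longrightarrow> Comp C (s A) (t A) = Ident C (fst F A)"
    "\<And>A B f. f \<in> Hom C A B \<Longrightarrow> Comp C (snd F f) (s A) = Comp C (s B) f"
proof -
  from assms obtain s where F: "F \<in> carrier (Aut_group C)"
    and s: "\<forall>A \<in> Ob C. s A \<in> cat_iso C A (fst F A)"
    and nat: "\<forall>A \<in> Ob C. \<forall>B \<in> Ob C. \<forall>f \<in> Hom C A B.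
      Comp C (snd F f) (s A) = Comp C (s B) f"
    unfolding inner_automorphisms_def case_prod_beta mem_Collect_eq prod.collapse by blast
  from s have "\<forall>A \<in> Ob C. \<exists>g. g \<in> Hom C (fst F A) A \<and>
      Comp C g (s A) = Ident C A \<and> Comp C (s A) g = Ident C (fst F A)"
    unfolding cat_iso_def by blast
  then obtain t where t: "\<forall>A \<in> Ob C. t A \<in> Hom C (fst F A) A \<and>
      Comp C (t A) (s A) = Ident C A \<and> Comp C (s A) (t A) = Ident C (fst F A)"
    by metis
  show thesis
  proof (rule that[of s t])
    show "Comp C (snd F f) (s A) = Comp C (s B) f" if "f \<in> Hom C A B" for A B f
      using nat Hom_Ob[OF that] that by blast
  qed (use F s t in \<open>simp_all add: cat_iso_def\<close>)
qed

lemma inner_automorphismsI: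
  assumes "F \<in> carrier (Aut_group C)"
    "\<And>A. A \<in> Ob C \<Longrightarrow> s A \<in> Hom C A (fst F A)"
    "\<And>A. A \<in> Ob C \<Longrightarrow> t A \<in> Hom C (fst F A) A"
    "\<And>A. A \<in> Ob C \<Longrightarrow> Comp C (t A) (s A) = Ident C A"
    "\<And>A. A \<in> Ob C \<Longrightarrow> Comp C (s A) (t A) = Ident C (fst F A)"
    "\<And>A B f. f \<in> Hom C A B \<Longrightarrow> Comp C (snd F f) (s A) = Comp C (s B) f"
  shows "F \<in> inner_automorphisms C"
proof -
  have "\<forall>A \<in> Ob C. s A \<in> cat_iso C A (fst F A)"
    using assms(2-5) unfolding cat_iso_def by blast
  moreover have "(\<forall>A \<in> Ob C. \<forall>B \<in> Ob C. \<forall>f \<in> Hom C A B. Comp C (snd F f) (s A) = Comp C (s B) f)"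
    using assms(6) by blast
  ultimately show ?thesis
    using assms(1) unfolding inner_automorphisms_def case_prod_beta mem_Collect_eq prod.collapse by blast
qed

lemma inner_automorphisms_mult:
  assumes F: "F \<in> inner_automorphisms C" and G: "G \<in> inner_automorphisms C"
  shows "F \<otimes>\<^bsub>Aut_group C\<^esub> G \<in> inner_automorphisms C"
proof -
  interpret group "Aut_group C" by (rule group_Aut)
  from F obtain s s' where FA: "F \<in> carrier (Aut_group C)"
    and s: "\<And>A. A \<in> Ob C \<Longrightarrow> s A \<in> Hom C A (fst F A)"
    and s': "\<And>A. A \<in> Ob C \<Longrightarrow> s' A \<in> Hom C (fst F A) A"
    and ss: "\<And>A. A \<in> Ob C \<Longrightarrow> Comp C (s' A) (s A) = Ident C A"
      "\<And>A. A \<in> Ob C \<Longrightarrow> Comp C (s A) (s' A) = Ident C (fst F A)"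
    and ns: "\<And>A B f. f \<in> Hom C A B \<Longrightarrow> Comp C (snd F f) (s A) = Comp C (s B) f"
    by (rule inner_automorphismsD) (rule that)
  from G obtain t t' where GA: "G \<in> carrier (Aut_group C)"
    and t: "\<And>A. A \<in> Ob C \<Longrightarrow> t A \<in> Hom C A (fst G A)"
    and t': "\<And>A. A \<in> Ob C \<Longrightarrow> t' A \<in> Hom C (fst G A) A"
    and tt: "\<And>A. A \<in> Ob C \<Longrightarrow> Comp C (t' A) (t A) = Ident C A"
      "\<And>A. A \<in> Ob C \<Longrightarrow> Comp C (t A) (t' A) = Ident C (fst G A)"
    and nt: "\<And>A B f. f \<in> Hom C A B \<Longrightarrow> Comp C (snd G f) (t A) = Comp C (t B) f"
    by (rule inner_automorphismsD) (rule that)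
  note G_end = endofunctorD[OF Aut_endofunctor[OF GA]]
  note F_end = endofunctorD[OF Aut_endofunctor[OF FA]]
  have fst_eq: "fst (F \<otimes>\<^bsub>Aut_group C\<^esub> G) A = fst F (fst G A)" if "A \<in> Ob C" for A
    using that by (simp add: Aut_mult compose_eq)
  have snd_eq: "snd (F \<otimes>\<^bsub>Aut_group C\<^esub> G) f = snd F (snd G f)" if "f \<in> Mor C" for f
    using that by (simp add: Aut_mult compose_eq)
  show ?thesis
  proof (rule inner_automorphismsI[where s = "\<lambda>A. Comp C (s (fst G A)) (t A)"
        and t = "\<lambda>A. Comp C (t' A) (s' (fst G A))"])
    show "F \<otimes>\<^bsub>Aut_group C\<^esub> G \<in> carrier (Aut_group C)"
      using FA GA by (rule m_closed)
  next
    fix A assume A: "A \<in> Ob C"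
    note GAo = G_end(3)[OF A]
    show "Comp C (s (fst G A)) (t A) \<in> Hom C A (fst (F \<otimes>\<^bsub>Aut_group C\<^esub> G) A)"
      unfolding fst_eq[OF A] by (rule Comp_Hom[OF t[OF A] s[OF GAo]])
    show "Comp C (t' A) (s' (fst G A)) \<in> Hom C (fst (F \<otimes>\<^bsub>Aut_group C\<^esub> G) A) A"
      unfolding fst_eq[OF A] by (rule Comp_Hom[OF s'[OF GAo] t'[OF A]])
    show "Comp C (Comp C (t' A) (s' (fst G A))) (Comp C (s (fst G A)) (t A)) = Ident C A"
      by (simp only: Comp_assoc[OF Comp_Hom[OF t[OF A] s[OF GAo]] s'[OF GAo] t'[OF A], symmetric]
          Comp_assoc[OF t[OF A] s[OF GAo] s'[OF GAo]] ss(1)[OF GAo] Ident_left[OF t[OF A]] tt(1)[OF A])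
    show "Comp C (Comp C (s (fst G A)) (t A)) (Comp C (t' A) (s' (fst G A))) =
        Ident C (fst (F \<otimes>\<^bsub>Aut_group C\<^esub> G) A)"
      by (simp only: fst_eq[OF A] tt(2)[OF A] Ident_left[OF s'[OF GAo]] ss(2)[OF GAo]
          Comp_assoc[OF Comp_Hom[OF s'[OF GAo] t'[OF A]] t[OF A] s[OF GAo], symmetric]
          Comp_assoc[OF s'[OF GAo] t'[OF A] t[OF A]])
  next
    fix A B f assume f: "f \<in> Hom C A B"
    note ob = Hom_Ob[OF f] and Gf = G_end(4)[OF f]
    note FGf = F_end(4)[OF Gf]
    have "Comp C (snd F (snd G f)) (Comp C (s (fst G A)) (t A)) =
        Comp C (Comp C (snd F (snd G f)) (s (fst G A))) (t A)"
      by (rule Comp_assoc[OF t[OF ob(1)] s[OF G_end(3)[OF ob(1)]] FGf])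
    also have "\<dots> = Comp C (Comp C (s (fst G B)) (snd G f)) (t A)"
      by (simp only: ns[OF Gf])
    also have "\<dots> = Comp C (s (fst G B)) (Comp C (snd G f) (t A))"
      by (rule Comp_assoc[OF t[OF ob(1)] Gf s[OF G_end(3)[OF ob(2)]], symmetric])
    also have "\<dots> = Comp C (s (fst G B)) (Comp C (t B) f)"
      by (simp only: nt[OF f])
    also have "\<dots> = Comp C (Comp C (s (fst G B)) (t B)) f"
      by (rule Comp_assoc[OF f t[OF ob(2)] s[OF G_end(3)[OF ob(2)]]])
    finally show "Comp C (snd (F \<otimes>\<^bsub>Aut_group C\<^esub> G) f) (Comp C (s (fst G A)) (t A)) =
        Comp C (Comp C (s (fst G B)) (t B)) f"
      by (simp only: snd_eq[OF ob(3)])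
  qed
qed

lemma inner_automorphisms_inv:
  assumes F: "F \<in> inner_automorphisms C"
  shows "inv\<^bsub>Aut_group C\<^esub> F \<in> inner_automorphisms C"
proof -
  interpret group "Aut_group C" by (rule group_Aut)
  from F obtain s t where FA: "F \<in> carrier (Aut_group C)"
    and s: "\<And>A. A \<in> Ob C \<Longrightarrow> s A \<in> Hom C A (fst F A)"
    and t: "\<And>A. A \<in> Ob C \<Longrightarrow> t A \<in> Hom C (fst F A) A"
    and st: "\<And>A. A \<in> Ob C \<Longrightarrow> Comp C (t A) (s A) = Ident C A"
      "\<And>A. A \<in> Ob C \<Longrightarrow> Comp C (s A) (t A) = Ident C (fst F A)"
    and ns: "\<And>A B f. f \<in> Hom C A B \<Longrightarrow> Comp C (snd F f) (s A) = Comp C (s B) f"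
    by (rule inner_automorphismsD) (rule that)
  define G where "G = inv\<^bsub>Aut_group C\<^esub> F"
  have GA: "G \<in> carrier (Aut_group C)"
    unfolding G_def using FA by (rule inv_closed)
  note G_end = endofunctorD[OF Aut_endofunctor[OF GA]]
  note F_end = endofunctorD[OF Aut_endofunctor[OF FA]]
  note FG = Aut_inv[OF FA, folded G_def]
  have "G \<in> inner_automorphisms C"
  proof (rule inner_automorphismsI[where s = "\<lambda>A. t (fst G A)" and t = "\<lambda>A. s (fst G A)"])
    fix A assume A: "A \<in> Ob C"
    note GAo = G_end(3)[OF A]
    show "t (fst G A) \<in> Hom C A (fst G A)" using t[OF GAo] FG(1)[OF A] by simp
    show "s (fst G A) \<in> Hom C (fst G A) A" using s[OF GAo] FG(1)[OF A] by simp
    show "Comp C (s (fst G A)) (t (fst G A)) = Ident C A" using st(2)[OF GAo] FG(1)[OF A] by simp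
    show "Comp C (t (fst G A)) (s (fst G A)) = Ident C (fst G A)" using st(1)[OF GAo] .
  next
    fix A B f assume f: "f \<in> Hom C A B"
    note ob = Hom_Ob[OF f] and Gf = G_end(4)[OF f]
    note A = G_end(3)[OF ob(1)] and B = G_end(3)[OF ob(2)]
    have sA: "s (fst G A) \<in> Hom C (fst G A) A" and tA: "t (fst G A) \<in> Hom C A (fst G A)"
      using s[OF A] t[OF A] FG(1)[OF ob(1)] by simp_all
    have sB: "s (fst G B) \<in> Hom C (fst G B) B" and tB: "t (fst G B) \<in> Hom C B (fst G B)"
      using s[OF B] t[OF B] FG(1)[OF ob(2)] by simp_all
    have nf: "Comp C f (s (fst G A)) = Comp C (s (fst G B)) (snd G f)"
      using ns[OF Gf] FG(2)[OF ob(3)] by simp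
    have "Comp C (snd G f) (t (fst G A)) =
        Comp C (Comp C (Comp C (t (fst G B)) (s (fst G B))) (snd G f)) (t (fst G A))"
      by (simp only: st(1)[OF B] Ident_left[OF Gf])
    also have "\<dots> = Comp C (Comp C (t (fst G B)) (Comp C f (s (fst G A)))) (t (fst G A))"
      by (simp only: Comp_assoc[OF Gf sB tB] nf)
    also have "\<dots> = Comp C (t (fst G B)) (Comp C (Comp C f (s (fst G A))) (t (fst G A)))"
      by (simp only: Comp_assoc[OF tA Comp_Hom[OF sA f] tB])
    also have "\<dots> = Comp C (t (fst G B)) f"
      by (simp only: Comp_assoc[OF tA sA f, symmetric] st(2)[OF A] FG(1)[OF ob(1)] Ident_right[OF f])
    finally show "Comp C (snd G f) (t (fst G A)) = Comp C (t (fst G B)) f" .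
  qed (rule GA)
  then show ?thesis by (simp only: G_def)
qed

lemma inner_automorphisms_conj:
  assumes F: "F \<in> inner_automorphisms C" and HA: "H \<in> carrier (Aut_group C)"
  shows "H \<otimes>\<^bsub>Aut_group C\<^esub> F \<otimes>\<^bsub>Aut_group C\<^esub> inv\<^bsub>Aut_group C\<^esub> H \<in> inner_automorphisms C"
proof -
  interpret group "Aut_group C" by (rule group_Aut)
  from F obtain s t where FA: "F \<in> carrier (Aut_group C)"
    and s: "\<And>A. A \<in> Ob C \<Longrightarrow> s A \<in> Hom C A (fst F A)"
    and t: "\<And>A. A \<in> Ob C \<Longrightarrow> t A \<in> Hom C (fst F A) A"
    and st: "\<And>A. A \<in> Ob C \<Longrightarrow> Comp C (t A) (s A) = Ident C A"
      "\<And>A. A \<in> Ob C \<Longrightarrow> Comp C (s A) (t A) = Ident C (fst F A)"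
    and ns: "\<And>A B f. f \<in> Hom C A B \<Longrightarrow> Comp C (snd F f) (s A) = Comp C (s B) f"
    by (rule inner_automorphismsD) (rule that)
  define G where "G = inv\<^bsub>Aut_group C\<^esub> H"
  have GA: "G \<in> carrier (Aut_group C)"
    unfolding G_def using HA by (rule inv_closed)
  define K where "K = H \<otimes>\<^bsub>Aut_group C\<^esub> F \<otimes>\<^bsub>Aut_group C\<^esub> G"
  note G_end = endofunctorD[OF Aut_endofunctor[OF GA]]
  note F_end = endofunctorD[OF Aut_endofunctor[OF FA]]
  note H_end = endofunctorD[OF Aut_endofunctor[OF HA]]
  note HG = Aut_inv[OF HA, folded G_def]
  have fst_eq: "fst K A = fst H (fst F (fst G A))" if "A \<in> Ob C" for A
    using that G_end(3)[OF that] by (simp add: K_def Aut_mult compose_eq)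
  have snd_eq: "snd K f = snd H (snd F (snd G f))" if "f \<in> Mor C" for f
    using that G_end(7)[OF that] by (simp add: K_def Aut_mult compose_eq)
  have "K \<in> inner_automorphisms C"
  proof (rule inner_automorphismsI[where s = "\<lambda>A. snd H (s (fst G A))"
        and t = "\<lambda>A. snd H (t (fst G A))"])
    show "K \<in> carrier (Aut_group C)"
      unfolding K_def using FA GA HA by (intro m_closed)
  next
    fix A assume A: "A \<in> Ob C"
    note GAo = G_end(3)[OF A]
    show "snd H (s (fst G A)) \<in> Hom C A (fst K A)"
      using H_end(4)[OF s[OF GAo]] by (simp only: fst_eq[OF A] HG(1)[OF A])
    show "snd H (t (fst G A)) \<in> Hom C (fst K A) A"
      using H_end(4)[OF t[OF GAo]] by (simp only: fst_eq[OF A] HG(1)[OF A])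
    show "Comp C (snd H (t (fst G A))) (snd H (s (fst G A))) = Ident C A"
      by (simp only: H_end(6)[OF s[OF GAo] t[OF GAo], symmetric] st(1)[OF GAo]
          H_end(5)[OF GAo] HG(1)[OF A])
    show "Comp C (snd H (s (fst G A))) (snd H (t (fst G A))) = Ident C (fst K A)"
      by (simp only: H_end(6)[OF t[OF GAo] s[OF GAo], symmetric] st(2)[OF GAo]
          H_end(5)[OF F_end(3)[OF GAo]] fst_eq[OF A])
  next
    fix A B f assume f: "f \<in> Hom C A B"
    note ob = Hom_Ob[OF f] and Gf = G_end(4)[OF f]
    note A = G_end(3)[OF ob(1)] and B = G_end(3)[OF ob(2)]
    have "Comp C (snd K f) (snd H (s (fst G A))) = snd H (Comp C (snd F (snd G f)) (s (fst G A)))"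
      by (simp only: snd_eq[OF ob(3)] H_end(6)[OF s[OF A] F_end(4)[OF Gf]])
    also have "\<dots> = Comp C (snd H (s (fst G B))) f"
      by (simp only: ns[OF Gf] H_end(6)[OF Gf s[OF B]] HG(2)[OF ob(3)])
    finally show "Comp C (snd K f) (snd H (s (fst G A))) = Comp C (snd H (s (fst G B))) f" .
  qed
  then show ?thesis by (simp only: K_def G_def)
qed

lemma inner_automorphisms_one: "\<one>\<^bsub>Aut_group C\<^esub> \<in> inner_automorphisms C"
proof -
  interpret group "Aut_group C" by (rule group_Aut)
  show ?thesis
  proof (rule inner_automorphismsI[where s = "Ident C" and t = "Ident C"])
    fix A B f assume f: "f \<in> Hom C A B"
    show "Comp C (snd \<one>\<^bsub>Aut_group C\<^esub> f) (Ident C A) = Comp C (Ident C B) f"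
      using Hom_Ob(3)[OF f] Ident_left[OF f] Ident_right[OF f] by (simp add: Aut_one)
  qed (simp_all add: Aut_one Ident_Hom Ident_left[OF Ident_Hom] one_closed[unfolded Aut_one])
qed

lemma normal_inner_automorphisms: "inner_automorphisms C \<lhd> Aut_group C"
proof -
  interpret group "Aut_group C" by (rule group_Aut)
  have "subgroup (inner_automorphisms C) (Aut_group C)"
  proof (rule subgroupI)
    show "inner_automorphisms C \<subseteq> carrier (Aut_group C)"
      by (auto simp: inner_automorphisms_def)
    show "inner_automorphisms C \<noteq> {}"
      using inner_automorphisms_one by blast
  qed (simp_all add: inner_automorphisms_inv inner_automorphisms_mult)
  then show ?thesis
    by (rule normal_invI) (rule inner_automorphisms_conj)
qed

end


section \<open>Linear algebras\<close>

text \<open>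
  The signature of a linear algebra is that of the record \<^type>\<open>module\<close>; its
  \<^const>\<open>one\<close> field is not part of the structure and is never used.
\<close>

locale linear_algebra = abelian_group H for H :: "('k::field, 'a, 'm) module_scheme" (structure) +
  assumes smult_closed [simp]: "x \<in> carrier H \<Longrightarrow> c \<odot> x \<in> carrier H"
    and smult_l_distr: "x \<in> carrier H \<Longrightarrow> (c + d) \<odot> x = c \<odot> x \<oplus> d \<odot> x"
    and smult_r_distr: "x \<in> carrier H \<Longrightarrow> y \<in> carrier H \<Longrightarrow> c \<odot> (x \<oplus> y) = c \<odot> x \<oplus> c \<odot> y"
    and smult_assoc: "x \<in> carrier H \<Longrightarrow> (c * d) \<odot> x = c \<odot> (d \<odot> x)"
    and smult_one [simp]: "x \<in> carrier H \<Longrightarrow> 1 \<odot> x = x"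
    and mult_closed [simp]: "x \<in> carrier H \<Longrightarrow> y \<in> carrier H \<Longrightarrow> x \<otimes> y \<in> carrier H"
    and mult_l_distr: "x \<in> carrier H \<Longrightarrow> y \<in> carrier H \<Longrightarrow> z \<in> carrier H \<Longrightarrow>
          (x \<oplus> y) \<otimes> z = x \<otimes> z \<oplus> y \<otimes> z"
    and mult_r_distr: "x \<in> carrier H \<Longrightarrow> y \<in> carrier H \<Longrightarrow> z \<in> carrier H \<Longrightarrow>
          z \<otimes> (x \<oplus> y) = z \<otimes> x \<oplus> z \<otimes> y"
    and mult_smult_left: "x \<in> carrier H \<Longrightarrow> y \<in> carrier H \<Longrightarrow> (c \<odot> x) \<otimes> y = c \<odot> (x \<otimes> y)"
    and mult_smult_right: "x \<in> carrier H \<Longrightarrow> y \<in> carrier H \<Longrightarrow> x \<otimes> (c \<odot> y) = c \<odot> (x \<otimes> y)"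

definition linear_algebra_hom ::
  "('k, 'a, 'm) module_scheme \<Rightarrow> ('k, 'b, 'n) module_scheme \<Rightarrow> ('a \<Rightarrow> 'b) set" where
  "linear_algebra_hom H H' = {f \<in> carrier H \<rightarrow>\<^sub>E carrier H'.
     (\<forall>x \<in> carrier H. \<forall>y \<in> carrier H. f (x \<oplus>\<^bsub>H\<^esub> y) = f x \<oplus>\<^bsub>H'\<^esub> f y) \<and>
     (\<forall>c. \<forall>x \<in> carrier H. f (c \<odot>\<^bsub>H\<^esub> x) = c \<odot>\<^bsub>H'\<^esub> f x) \<and>
     (\<forall>x \<in> carrier H. \<forall>y \<in> carrier H. f (x \<otimes>\<^bsub>H\<^esub> y) = f x \<otimes>\<^bsub>H'\<^esub> f y)}"

text \<open>
  The full subcategory of the variety of linear algebras on a given set of algebras.  An arrow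
  carries its domain and codomain.
\<close>

definition linear_algebra_category ::
  "('k, 'a) module set \<Rightarrow> (('k, 'a) module, ('k, 'a) module \<times> ('a \<Rightarrow> 'a) \<times> ('k, 'a) module) category" where
  "linear_algebra_category S =
     \<lparr>Ob = S,
      Mor = {(H, f, H'). H \<in> S \<and> H' \<in> S \<and> f \<in> linear_algebra_hom H H'},
      Dom = (\<lambda>(H, f, H'). H),
      Cod = (\<lambda>(H, f, H'). H'),
      Ident = (\<lambda>H. (H, \<lambda>x \<in> carrier H. x, H)),
      Comp = (\<lambda>(_, g, H'') (H, f, _). (H, compose (carrier H) g f, H''))\<rparr>"

lemma linear_algebra_homD:
  assumes "f \<in> linear_algebra_hom H H'"
  shows "x \<notin> carrier H \<Longrightarrow> f x = undefined" "x \<in> carrier H \<Longrightarrow> f x \<in> carrier H'"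
  using assms by (auto simp: linear_algebra_hom_def PiE_iff extensional_def)

lemma linear_algebra_hom_compose:
  assumes "f \<in> linear_algebra_hom H H'" "g \<in> linear_algebra_hom H' H''" "linear_algebra H"
  shows "compose (carrier H) g f \<in> linear_algebra_hom H H''"
proof -
  interpret H: linear_algebra H by fact
  show ?thesis
    using assms(1,2) unfolding linear_algebra_hom_def mem_Collect_eq PiE_iff
    by (simp add: compose_eq)
qed

lemma linear_algebra_hom_id:
  assumes "linear_algebra H"
  shows "(\<lambda>x \<in> carrier H. x) \<in> linear_algebra_hom H H"
proof -
  interpret H: linear_algebra H by fact
  show ?thesis unfolding linear_algebra_hom_def by simp
qed

lemma category_linear_algebra_category:
  assumes S: "\<And>H. H \<in> S \<Longrightarrow> linear_algebra H"
  shows "category (linear_algebra_category S)"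
proof
  let ?C = "linear_algebra_category S"
  have Hom: "Hom ?C H H' = (if H \<in> S \<and> H' \<in> S then (\<lambda>f. (H, f, H')) ` linear_algebra_hom H H' else {})"
    for H H' by (auto simp: Hom_def linear_algebra_category_def)
  show "Dom ?C f \<in> Ob ?C" "Cod ?C f \<in> Ob ?C" if "f \<in> Mor ?C" for f
    using that by (auto simp: linear_algebra_category_def)
  show "Ident ?C A \<in> Hom ?C A A" if "A \<in> Ob ?C" for A
    using that linear_algebra_hom_id[OF S] unfolding Hom
    by (auto simp: linear_algebra_category_def)
  show "Comp ?C g f \<in> Hom ?C A D" if "f \<in> Hom ?C A B" "g \<in> Hom ?C B D" for f g A B D
    using that linear_algebra_hom_compose S unfolding Hom
    by (fastforce simp: linear_algebra_category_def split: if_splits)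
  show "Comp ?C (Ident ?C B) f = f" "Comp ?C f (Ident ?C A) = f" if "f \<in> Hom ?C A B" for f A B
  proof -
    from that obtain h where f: "f = (A, h, B)" and h: "h \<in> linear_algebra_hom A B"
      unfolding Hom by (auto split: if_splits)
    have "compose (carrier A) (\<lambda>x \<in> carrier B. x) h = h"
      "compose (carrier A) h (\<lambda>x \<in> carrier A. x) = h"
      using linear_algebra_homD[OF h] by (simp_all add: compose_def fun_eq_iff)
    then show "Comp ?C (Ident ?C B) f = f" "Comp ?C f (Ident ?C A) = f"
      unfolding f by (simp_all add: linear_algebra_category_def)
  qed
  show "Comp ?C h (Comp ?C g f) = Comp ?C (Comp ?C h g) f"
    if "f \<in> Hom ?C A B" "g \<in> Hom ?C B D" "h \<in> Hom ?C D E" for f g h A B D E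
  proof -
    from that obtain f' g' h' where fgh: "f = (A, f', B)" "g = (B, g', D)" "h = (D, h', E)"
      and f': "f' \<in> linear_algebra_hom A B"
      unfolding Hom by (auto split: if_splits)
    have "compose (carrier A) h' (compose (carrier A) g' f') =
        compose (carrier A) (compose (carrier B) h' g') f'"
      using linear_algebra_homD(2)[OF f'] by (auto simp: compose_def fun_eq_iff)
    then show ?thesis
      unfolding fgh by (simp add: linear_algebra_category_def)
  qed
qed


section \<open>Free linear algebras\<close>

datatype (letters: 'x) nonassoc_word =
  Letter 'x
| Juxt "'x nonassoc_word" "'x nonassoc_word"

definition free_mult :: "('x nonassoc_word \<Rightarrow>\<^sub>0 'k::field) \<Rightarrow> ('x nonassoc_word \<Rightarrow>\<^sub>0 'k) \<Rightarrow>
    ('x nonassoc_word \<Rightarrow>\<^sub>0 'k)" where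
  "free_mult p q = (\<Sum>u \<in> Poly_Mapping.keys p. \<Sum>v \<in> Poly_Mapping.keys q.
     Poly_Mapping.single (Juxt u v) (Poly_Mapping.lookup p u * Poly_Mapping.lookup q v))"

definition free_linear_algebra :: "'x set \<Rightarrow> ('k::field, 'x nonassoc_word \<Rightarrow>\<^sub>0 'k) module" where
  "free_linear_algebra X =
     \<lparr>carrier = {p. \<forall>u \<in> Poly_Mapping.keys p. letters u \<subseteq> X},
      mult = free_mult,
      one = undefined,
      zero = 0,
      add = (+),
      smult = (\<lambda>c. Poly_Mapping.map ((*) c))\<rparr>"

abbreviation free_gen :: "'x \<Rightarrow> 'x nonassoc_word \<Rightarrow>\<^sub>0 'k::field" where
  "free_gen i \<equiv> Poly_Mapping.single (Letter i) 1"

lemma lookup_smult: "Poly_Mapping.lookup (Poly_Mapping.map ((*) c) p) w = c * Poly_Mapping.lookup p w" for c :: "'k::field"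
  by (cases "Poly_Mapping.lookup p w = 0") (simp_all add: map.rep_eq when_def)

lemma lookup_free_mult:
  "Poly_Mapping.lookup (free_mult p q) w = (case w of Letter i \<Rightarrow> 0 | Juxt u v \<Rightarrow> Poly_Mapping.lookup p u * Poly_Mapping.lookup q v)"
proof (cases w)
  case (Letter i)
  then show ?thesis by (simp add: free_mult_def lookup_sum lookup_single when_def)
next
  case (Juxt a b)
  have "Poly_Mapping.lookup (free_mult p q) w = (\<Sum>u \<in> Poly_Mapping.keys p. \<Sum>v \<in> Poly_Mapping.keys q.
      if u = a then if v = b then Poly_Mapping.lookup p u * Poly_Mapping.lookup q v else 0 else 0)"
    unfolding free_mult_def lookup_sum lookup_single when_def Juxt
    by (intro sum.cong) auto
  also have "\<dots> = (\<Sum>u \<in> Poly_Mapping.keys p. if u = a then \<Sum>v \<in> Poly_Mapping.keys q. if v = b then Poly_Mapping.lookup p u * Poly_Mapping.lookup q v else 0 else 0)"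
    by (intro sum.cong) auto
  also have "\<dots> = Poly_Mapping.lookup p a * Poly_Mapping.lookup q b"
    by (auto simp: sum.delta in_keys_iff)
  finally show ?thesis using Juxt by simp
qed

lemma free_carrier_iff:
  "p \<in> carrier (free_linear_algebra X) \<longleftrightarrow> (\<forall>u. Poly_Mapping.lookup p u \<noteq> 0 \<longrightarrow> letters u \<subseteq> X)"
  by (auto simp: free_linear_algebra_def in_keys_iff)

lemma free_simps [simp]:
  "x \<oplus>\<^bsub>free_linear_algebra X\<^esub> y = x + y"
  "x \<otimes>\<^bsub>free_linear_algebra X\<^esub> y = free_mult x y"
  "c \<odot>\<^bsub>free_linear_algebra X\<^esub> x = Poly_Mapping.map ((*) c) x"
  "\<zero>\<^bsub>free_linear_algebra X\<^esub> = 0"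
  by (simp_all add: free_linear_algebra_def)

lemma free_single_carrier [simp]:
  "letters u \<subseteq> X \<Longrightarrow> Poly_Mapping.single u c \<in> carrier (free_linear_algebra X)"
  by (simp add: free_carrier_iff lookup_single when_def)

lemma linear_algebra_free:
  "linear_algebra (free_linear_algebra X :: ('k::field, 'x nonassoc_word \<Rightarrow>\<^sub>0 'k) module)"
proof -
  let ?F = "free_linear_algebra X :: ('k, 'x nonassoc_word \<Rightarrow>\<^sub>0 'k) module"
  have "abelian_group ?F"
  proof (rule abelian_groupI)
    show "x \<oplus>\<^bsub>?F\<^esub> y \<in> carrier ?F" if "x \<in> carrier ?F" "y \<in> carrier ?F" for x y
    proof -
      have "letters u \<subseteq> X" if "Poly_Mapping.lookup x u + Poly_Mapping.lookup y u \<noteq> 0" for u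
        using that \<open>x \<in> carrier ?F\<close> \<open>y \<in> carrier ?F\<close> unfolding free_carrier_iff
        by (metis add_0)
      then show ?thesis by (simp add: free_carrier_iff lookup_add)
    qed
    show "\<exists>y \<in> carrier ?F. y \<oplus>\<^bsub>?F\<^esub> x = \<zero>\<^bsub>?F\<^esub>" if "x \<in> carrier ?F" for x
      using that by (intro bexI[of _ "- x"]) (simp_all add: free_carrier_iff)
  qed (simp_all add: free_carrier_iff add_ac)
  moreover have "linear_algebra_axioms ?F"
    by unfold_locales
      (auto simp: free_carrier_iff lookup_smult lookup_free_mult lookup_add poly_mapping_eq_iff
        fun_eq_iff algebra_simps split: nonassoc_word.splits)
  ultimately show ?thesis by (rule linear_algebra.intro)
qed


lemma free_induct [consumes 1, case_names zero single add]:
  assumes p: "p \<in> carrier (free_linear_algebra X)"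
    and 0: "P 0" and single: "\<And>u c. letters u \<subseteq> X \<Longrightarrow> P (Poly_Mapping.single u c)"
    and add: "\<And>p q. p \<in> carrier (free_linear_algebra X) \<Longrightarrow> q \<in> carrier (free_linear_algebra X) \<Longrightarrow>
      P p \<Longrightarrow> P q \<Longrightarrow> P (p + q)"
  shows "P p"
proof -
  interpret F: linear_algebra "free_linear_algebra X"
    by (rule linear_algebra_free)
  let ?m = "\<lambda>u. Poly_Mapping.single u (Poly_Mapping.lookup p u)"
  have "sum ?m A \<in> carrier (free_linear_algebra X) \<and> P (sum ?m A)"
    if "finite A" "A \<subseteq> Poly_Mapping.keys p" for A
    using that
  proof (induction A rule: finite_induct)
    case empty
    then show ?case using 0 F.zero_closed by simp
  next
    case (insert u A)
    then have u: "letters u \<subseteq> X"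
      using p by (auto simp: free_carrier_iff in_keys_iff)
    have "?m u \<in> carrier (free_linear_algebra X)" "P (?m u)"
      using u single by simp_all
    with insert show ?case
      using add[of "?m u" "sum ?m A"] F.add.m_closed[of "?m u" "sum ?m A"] by simp
  qed
  moreover have "sum ?m (Poly_Mapping.keys p) = p"
    by (rule poly_mapping_eqI) (auto simp: lookup_sum lookup_single when_def sum.delta in_keys_iff)
  ultimately show ?thesis by (metis finite_keys order_refl)
qed

primrec word_eval :: "('a, 'm) monoid_scheme \<Rightarrow> ('x \<Rightarrow> 'a) \<Rightarrow> 'x nonassoc_word \<Rightarrow> 'a" where
  "word_eval H f (Letter i) = f i"
| "word_eval H f (Juxt u v) = word_eval H f u \<otimes>\<^bsub>H\<^esub> word_eval H f v"

context linear_algebra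
begin

lemma smult_zero_left: "x \<in> carrier H \<Longrightarrow> 0 \<odot> x = \<zero>"
  using smult_l_distr[of x 0 0] by (simp add: add.l_cancel_one')

lemma smult_zero_right: "c \<odot> \<zero> = \<zero>"
  using smult_r_distr[of \<zero> \<zero> c] by (simp add: add.l_cancel_one')

lemma mult_zero_left: "x \<in> carrier H \<Longrightarrow> \<zero> \<otimes> x = \<zero>"
  using mult_l_distr[of \<zero> \<zero> x] by (simp add: add.l_cancel_one')

lemma mult_zero_right: "x \<in> carrier H \<Longrightarrow> x \<otimes> \<zero> = \<zero>"
  using mult_r_distr[of \<zero> \<zero> x] by (simp add: add.l_cancel_one')

lemma word_eval_closed:
  assumes "f \<in> X \<rightarrow> carrier H" "letters u \<subseteq> X"
  shows "word_eval H f u \<in> carrier H"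
  using assms(2) by (induction u) (use assms(1) in auto)

definition free_extend :: "('x \<Rightarrow> 'a) \<Rightarrow> ('x nonassoc_word \<Rightarrow>\<^sub>0 'k) \<Rightarrow> 'a" where
  "free_extend f p = (\<Oplus>u \<in> Poly_Mapping.keys p. Poly_Mapping.lookup p u \<odot> word_eval H f u)"

context
  fixes f :: "'x \<Rightarrow> 'a" and X :: "'x set"
  assumes f: "f \<in> X \<rightarrow> carrier H"
begin

interpretation F: linear_algebra "free_linear_algebra X :: ('k, 'x nonassoc_word \<Rightarrow>\<^sub>0 'k) module"
  by (rule linear_algebra_free)

lemma free_extend_superset:
  assumes "finite A" "Poly_Mapping.keys p \<subseteq> A" "\<And>u. u \<in> A \<Longrightarrow> letters u \<subseteq> X"
  shows "free_extend f p = (\<Oplus>u \<in> A. Poly_Mapping.lookup p u \<odot> word_eval H f u)"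
  unfolding free_extend_def
  using assms word_eval_closed[OF f] smult_zero_left
  by (intro add.finprod_mono_neutral_cong_left) (auto simp: in_keys_iff)

lemma free_extend_closed:
  "p \<in> carrier (free_linear_algebra X) \<Longrightarrow> free_extend f p \<in> carrier H"
  unfolding free_extend_def using word_eval_closed[OF f]
  by (intro finsum_closed) (auto simp: free_carrier_iff in_keys_iff)

lemma free_extend_zero: "free_extend f 0 = \<zero>"
  by (simp add: free_extend_def)

lemma free_extend_single:
  assumes "letters u \<subseteq> X"
  shows "free_extend f (Poly_Mapping.single u c) = c \<odot> word_eval H f u"
  using free_extend_superset[of "{u}" "Poly_Mapping.single u c"] word_eval_closed[OF f assms] assms
  by simp

lemma free_extend_add:
  assumes "p \<in> carrier (free_linear_algebra X)" "q \<in> carrier (free_linear_algebra X)"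
  shows "free_extend f (p + q) = free_extend f p \<oplus> free_extend f q"
proof -
  let ?A = "Poly_Mapping.keys p \<union> Poly_Mapping.keys q"
  have A: "letters u \<subseteq> X" if "u \<in> ?A" for u
    using that assms by (auto simp: free_carrier_iff in_keys_iff)
  have "free_extend f (p + q) = (\<Oplus>u \<in> ?A. Poly_Mapping.lookup (p + q) u \<odot> word_eval H f u)"
    using A keys_add[of p q] by (intro free_extend_superset) auto
  also have "\<dots> = (\<Oplus>u \<in> ?A. Poly_Mapping.lookup p u \<odot> word_eval H f u \<oplus> Poly_Mapping.lookup q u \<odot> word_eval H f u)"
    using A word_eval_closed[OF f] by (intro finsum_cong') (auto simp: lookup_add smult_l_distr)
  also have "\<dots> = (\<Oplus>u \<in> ?A. Poly_Mapping.lookup p u \<odot> word_eval H f u) \<oplus>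
      (\<Oplus>u \<in> ?A. Poly_Mapping.lookup q u \<odot> word_eval H f u)"
    using A word_eval_closed[OF f] by (intro finsum_addf) auto
  also have "\<dots> = free_extend f p \<oplus> free_extend f q"
    using free_extend_superset[of ?A p] free_extend_superset[of ?A q] A by simp
  finally show ?thesis .
qed

lemma free_extend_smult:
  assumes "p \<in> carrier (free_linear_algebra X)"
  shows "free_extend f (Poly_Mapping.map ((*) c) p) = c \<odot> free_extend f p"
  using assms
proof (induction p rule: free_induct)
  case zero
  then show ?case using F.smult_zero_right by (simp add: free_extend_zero smult_zero_right)
next
  case (single u d)
  have "Poly_Mapping.map ((*) c) (Poly_Mapping.single u d) = Poly_Mapping.single u (c * d)"
    by (rule poly_mapping_eqI) (simp add: lookup_smult lookup_single when_def)
  then show ?case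
    using single word_eval_closed[OF f single] by (simp add: free_extend_single smult_assoc)
next
  case (add p q)
  then show ?case
    using F.smult_r_distr[of p q c] F.smult_closed[of p c] F.smult_closed[of q c]
    by (simp add: free_extend_add free_extend_closed smult_r_distr)
qed

lemma free_extend_mult:
  assumes p: "p \<in> carrier (free_linear_algebra X)" and q: "q \<in> carrier (free_linear_algebra X)"
  shows "free_extend f (free_mult p q) = free_extend f p \<otimes> free_extend f q"
  using p
proof (induction p rule: free_induct)
  case zero
  then show ?case
    using F.mult_zero_left[OF q] by (simp add: free_extend_zero mult_zero_left free_extend_closed q)
next
  case (single u c)
  have u: "free_extend f (Poly_Mapping.single u c) \<in> carrier H"
    using single by (intro free_extend_closed) simp
  from q show ?case
  proof (induction q rule: free_induct)
    case zero
    then show ?case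
      using F.mult_zero_right[of "Poly_Mapping.single u c"] single u
      by (simp add: free_extend_zero mult_zero_right)
  next
    case (single v d)
    have *: "free_mult (Poly_Mapping.single u c) (Poly_Mapping.single v d) =
        Poly_Mapping.single (Juxt u v) (c * d)"
      by (rule poly_mapping_eqI)
        (auto simp: lookup_free_mult lookup_single when_def split: nonassoc_word.split)
    have uv: "word_eval H f u \<in> carrier H" "word_eval H f v \<in> carrier H"
      using word_eval_closed[OF f] single \<open>letters u \<subseteq> X\<close> by blast+
    show ?case
      unfolding * using uv single \<open>letters u \<subseteq> X\<close>
      by (simp add: free_extend_single mult_smult_left mult_smult_right mult.commute
          flip: smult_assoc)
  next
    case (add p q)
    then show ?case
      using F.mult_r_distr[of p q "Poly_Mapping.single u c"] single u
        F.mult_closed[of "Poly_Mapping.single u c"]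
      by (simp add: free_extend_add free_extend_closed mult_r_distr)
  qed
next
  case (add p p')
  then show ?case
    using F.mult_l_distr[of p p' q] F.mult_closed q
    by (simp add: free_extend_add free_extend_closed mult_l_distr)
qed

lemma free_linear_algebra_universal:
  "\<exists>!h. h \<in> linear_algebra_hom (free_linear_algebra X) H \<and> (\<forall>i \<in> X. h (free_gen i) = f i)"
proof (rule ex_ex1I)
  let ?h = "restrict (free_extend f) (carrier (free_linear_algebra X))"
  have "?h \<in> linear_algebra_hom (free_linear_algebra X) H"
    using F.add.m_closed F.mult_closed F.smult_closed
    by (auto simp: linear_algebra_hom_def free_extend_closed free_extend_add free_extend_smult
        free_extend_mult)
  moreover have "\<forall>i \<in> X. ?h (free_gen i) = f i"
    using f by (auto simp: free_extend_single Pi_iff)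
  ultimately show "\<exists>h. h \<in> linear_algebra_hom (free_linear_algebra X) H \<and>
      (\<forall>i \<in> X. h (free_gen i) = f i)"
    by blast
next
  fix g h
  assume g: "g \<in> linear_algebra_hom (free_linear_algebra X) H \<and> (\<forall>i \<in> X. g (free_gen i) = f i)"
    and h: "h \<in> linear_algebra_hom (free_linear_algebra X) H \<and> (\<forall>i \<in> X. h (free_gen i) = f i)"
  let ?F = "free_linear_algebra X :: ('k, 'x nonassoc_word \<Rightarrow>\<^sub>0 'k) module"
  have hom: "k (p + q) = k p \<oplus> k q" "k (free_mult p q) = k p \<otimes> k q"
    "k (Poly_Mapping.map ((*) c) p) = c \<odot> k p" "k p \<in> carrier H"
    if "k \<in> linear_algebra_hom ?F H" "p \<in> carrier ?F" "q \<in> carrier ?F" for k p q c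
    using that by (auto simp: linear_algebra_hom_def)
  have word: "g (Poly_Mapping.single u 1) = h (Poly_Mapping.single u 1)" if "letters u \<subseteq> X" for u
    using that
  proof (induction u)
    case (Letter i)
    then show ?case using g h by simp
  next
    case (Juxt u v)
    have "Poly_Mapping.single (Juxt u v) (1::'k) =
        free_mult (Poly_Mapping.single u 1) (Poly_Mapping.single v 1)"
      by (rule poly_mapping_eqI)
        (auto simp: lookup_free_mult lookup_single when_def split: nonassoc_word.split)
    then show ?case
      using Juxt hom(2)[OF conjunct1[OF g]] hom(2)[OF conjunct1[OF h]] by simp
  qed
  have "g p = h p" if "p \<in> carrier ?F" for p
    using that
  proof (induction p rule: free_induct)
    case zero
    have "Poly_Mapping.map ((*) 0) (0 :: 'x nonassoc_word \<Rightarrow>\<^sub>0 'k) = 0"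
      by (rule poly_mapping_eqI) (simp add: lookup_smult)
    then show ?case
      using g h F.zero_closed hom(3)[of g 0 0 0] hom(4)[of g 0 0] hom(3)[of h 0 0 0] hom(4)[of h 0 0]
      by (simp add: smult_zero_left)
  next
    case (single u c)
    have "Poly_Mapping.single u c = Poly_Mapping.map ((*) c) (Poly_Mapping.single u 1)"
      by (rule poly_mapping_eqI) (simp add: lookup_smult lookup_single when_def)
    then show ?case
      using g h hom(3)[of g "Poly_Mapping.single u 1" "Poly_Mapping.single u 1" c]
        hom(3)[of h "Poly_Mapping.single u 1" "Poly_Mapping.single u 1" c] word[OF single] single
      by simp
  next
    case (add p q)
    then show ?case
      using hom(1)[OF conjunct1[OF g]] hom(1)[OF conjunct1[OF h]] by simp
  qed
  moreover have "g \<in> extensional (carrier ?F)" "h \<in> extensional (carrier ?F)"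
    using g h by (auto simp: linear_algebra_hom_def PiE_iff)
  ultimately show "g = h" by (intro extensionalityI)
qed

end

end


lemma inj_free_linear_algebra: "inj (free_linear_algebra :: 'x set \<Rightarrow> ('k::field, _) module)"
proof (rule injI)
  fix X Y :: "'x set"
  assume eq: "(free_linear_algebra X :: ('k, _) module) = free_linear_algebra Y"
  have gen: "(free_gen i :: 'x nonassoc_word \<Rightarrow>\<^sub>0 'k) \<in> carrier (free_linear_algebra Z) \<longleftrightarrow> i \<in> Z"
    for i and Z :: "'x set"
    by (simp add: free_carrier_iff lookup_single when_def)
  show "X = Y"
    using gen[of _ X] gen[of _ Y] unfolding eq by blast
qed

text \<open>The countable set of symbols is represented by the natural numbers.\<close>

definition free_algebra_category ::
  "(('k::field, nat nonassoc_word \<Rightarrow>\<^sub>0 'k) module,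
    ('k, nat nonassoc_word \<Rightarrow>\<^sub>0 'k) module \<times>
    ((nat nonassoc_word \<Rightarrow>\<^sub>0 'k) \<Rightarrow> (nat nonassoc_word \<Rightarrow>\<^sub>0 'k)) \<times>
    ('k, nat nonassoc_word \<Rightarrow>\<^sub>0 'k) module) category" where
  "free_algebra_category = linear_algebra_category (free_linear_algebra ` {X. finite X})"

lemma category_free_algebra_category: "category free_algebra_category"
  unfolding free_algebra_category_def
  by (rule category_linear_algebra_category) (auto intro: linear_algebra_free)


section \<open>The semidirect product\<close>

definition semidirect_product ::
  "('a, 'm) monoid_scheme \<Rightarrow> ('b, 'n) monoid_scheme \<Rightarrow> ('b \<Rightarrow> 'a \<Rightarrow> 'a) \<Rightarrow> ('a \<times> 'b) monoid" where
  "semidirect_product N H \<theta> =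
     \<lparr>carrier = carrier N \<times> carrier H,
      mult = (\<lambda>(n, h) (n', h'). (n \<otimes>\<^bsub>N\<^esub> \<theta> h n', h \<otimes>\<^bsub>H\<^esub> h')),
      one = (\<one>\<^bsub>N\<^esub>, \<one>\<^bsub>H\<^esub>)\<rparr>"

lemma group_semidirect_product:
  assumes "group N" "group H" "\<theta> \<in> hom H (AutoGroup N)"
  shows "group (semidirect_product N H \<theta>)"
proof -
  interpret N: group N by fact
  interpret H: group H by fact
  interpret A: group "AutoGroup N" by (rule N.AutoGroup)
  interpret th: group_hom H "AutoGroup N" \<theta>
    by unfold_locales (rule assms(3))
  have auto: "\<theta> h \<in> auto N" if "h \<in> carrier H" for h
    using th.hom_closed[OF that] by (simp add: AutoGroup_def)
  have closed: "\<theta> h n \<in> carrier N" if "h \<in> carrier H" "n \<in> carrier N" for h n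
    using auto[OF that(1)] that(2) by (auto simp: auto_def hom_def)
  have hom: "\<theta> h (n \<otimes>\<^bsub>N\<^esub> n') = \<theta> h n \<otimes>\<^bsub>N\<^esub> \<theta> h n'"
    if "h \<in> carrier H" "n \<in> carrier N" "n' \<in> carrier N" for h n n'
    using auto[OF that(1)] that(2,3) by (auto simp: auto_def hom_def)
  have mult: "\<theta> (h \<otimes>\<^bsub>H\<^esub> h') n = \<theta> h (\<theta> h' n)"
    if "h \<in> carrier H" "h' \<in> carrier H" "n \<in> carrier N" for h h' n
  proof -
    have "\<theta> h \<in> Bij (carrier N)" "\<theta> h' \<in> Bij (carrier N)"
      using auto that(1,2) by (auto simp: auto_def)
    then show ?thesis
      using th.hom_mult[OF that(1,2)] that(3) by (simp add: AutoGroup_def BijGroup_def compose_eq)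
  qed
  have one: "\<theta> \<one>\<^bsub>H\<^esub> n = n" if "n \<in> carrier N" for n
    using th.hom_one that by (simp add: AutoGroup_def BijGroup_def)
  have mem: "x \<in> carrier N \<times> carrier H \<longleftrightarrow> fst x \<in> carrier N \<and> snd x \<in> carrier H" for x
    by (cases x) simp
  show ?thesis
  proof (rule groupI)
    fix x assume x: "x \<in> carrier (semidirect_product N H \<theta>)"
    then obtain n h where nh: "x = (n, h)" "n \<in> carrier N" "h \<in> carrier H"
      by (auto simp: semidirect_product_def)
    have "\<theta> (inv\<^bsub>H\<^esub> h) (inv\<^bsub>N\<^esub> n) \<otimes>\<^bsub>N\<^esub> \<theta> (inv\<^bsub>H\<^esub> h) n = \<one>\<^bsub>N\<^esub>"
    proof -
      have "\<theta> (inv\<^bsub>H\<^esub> h) \<one>\<^bsub>N\<^esub> = \<theta> (inv\<^bsub>H\<^esub> h) \<one>\<^bsub>N\<^esub> \<otimes>\<^bsub>N\<^esub> \<theta> (inv\<^bsub>H\<^esub> h) \<one>\<^bsub>N\<^esub>"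
        using hom[of "inv\<^bsub>H\<^esub> h" "\<one>\<^bsub>N\<^esub>" "\<one>\<^bsub>N\<^esub>"] nh by (simp del: th.hom_inv)
      then have "\<theta> (inv\<^bsub>H\<^esub> h) \<one>\<^bsub>N\<^esub> = \<one>\<^bsub>N\<^esub>"
        using N.l_cancel_one'[of "\<theta> (inv\<^bsub>H\<^esub> h) \<one>\<^bsub>N\<^esub>" "\<theta> (inv\<^bsub>H\<^esub> h) \<one>\<^bsub>N\<^esub>"]
          closed[of "inv\<^bsub>H\<^esub> h" "\<one>\<^bsub>N\<^esub>"] nh by (simp del: th.hom_inv)
      then show ?thesis
        using hom[of "inv\<^bsub>H\<^esub> h" "inv\<^bsub>N\<^esub> n" n] nh by (simp del: th.hom_inv)
    qed
    then show "\<exists>y \<in> carrier (semidirect_product N H \<theta>).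
        y \<otimes>\<^bsub>semidirect_product N H \<theta>\<^esub> x = \<one>\<^bsub>semidirect_product N H \<theta>\<^esub>"
      using nh closed
      by (intro bexI[of _ "(\<theta> (inv\<^bsub>H\<^esub> h) (inv\<^bsub>N\<^esub> n), inv\<^bsub>H\<^esub> h)"])
        (simp_all add: semidirect_product_def del: th.hom_inv)
  qed (auto simp: semidirect_product_def closed one hom mult N.m_assoc H.m_assoc
      simp del: th.hom_mult th.hom_one)
qed


section \<open>Field automorphisms and circulant matrices\<close>

definition field_automorphism_group :: "('k::field \<Rightarrow> 'k) monoid" where
  "field_automorphism_group =
     \<lparr>carrier = {\<phi>. bij \<phi> \<and> \<phi> 1 = 1 \<and>
        (\<forall>x y. \<phi> (x + y) = \<phi> x + \<phi> y) \<and> (\<forall>x y. \<phi> (x * y) = \<phi> x * \<phi> y)},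
      mult = (\<circ>),
      one = id\<rparr>"

definition circulant :: "'k \<Rightarrow> 'k \<Rightarrow> 'k::field ^ 2 ^ 2" where
  "circulant a b = vector [vector [a, b], vector [b, a]]"

definition circulant_group :: "('k::field ^ 2 ^ 2) monoid" where
  "circulant_group =
     \<lparr>carrier = {A. invertible A \<and> (\<exists>a b. A = circulant a b)},
      mult = (**),
      one = mat 1\<rparr>"

definition scalar_matrices :: "('k::field ^ 2 ^ 2) set" where
  "scalar_matrices = {mat c | c. c \<noteq> 0}"

definition circulant_quotient :: "('k::field ^ 2 ^ 2) set monoid" where
  "circulant_quotient = circulant_group Mod scalar_matrices"

definition entrywise_action :: "('k::field \<Rightarrow> 'k) \<Rightarrow> ('k ^ 2 ^ 2) set \<Rightarrow> ('k ^ 2 ^ 2) set" where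
  "entrywise_action \<phi> = (\<lambda>C \<in> carrier circulant_quotient. map_matrix \<phi> ` C)"

lemma group_field_automorphism_group: "group field_automorphism_group"
proof (rule groupI)
  fix \<phi> :: "'a::field \<Rightarrow> 'a"
  assume "\<phi> \<in> carrier field_automorphism_group"
  then have \<phi>: "bij \<phi>" "\<phi> 1 = 1" "\<And>x y. \<phi> (x + y) = \<phi> x + \<phi> y" "\<And>x y. \<phi> (x * y) = \<phi> x * \<phi> y"
    by (auto simp: field_automorphism_group_def)
  note inj = injD[OF bij_is_inj[OF \<phi>(1)]]
  let ?\<psi> = "inv_into UNIV \<phi>"
  have \<phi>\<psi>: "\<phi> (?\<psi> x) = x" for x
    by (rule surj_f_inv_f[OF bij_is_surj[OF \<phi>(1)]])
  have "?\<psi> 1 = 1"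
    by (rule inj) (simp only: \<phi>\<psi> \<phi>(2))
  moreover have "?\<psi> (x + y) = ?\<psi> x + ?\<psi> y" for x y
    by (rule inj) (simp only: \<phi>\<psi> \<phi>(3))
  moreover have "?\<psi> (x * y) = ?\<psi> x * ?\<psi> y" for x y
    by (rule inj) (simp only: \<phi>\<psi> \<phi>(4))
  ultimately have "?\<psi> \<in> carrier field_automorphism_group"
    using bij_imp_bij_inv[OF \<phi>(1)] by (simp add: field_automorphism_group_def)
  then show "\<exists>\<psi> \<in> carrier field_automorphism_group.
      \<psi> \<otimes>\<^bsub>field_automorphism_group\<^esub> \<phi> = \<one>\<^bsub>field_automorphism_group\<^esub>"
    by (rule bexI[rotated]) (simp add: field_automorphism_group_def inv_o_cancel[OF bij_is_inj[OF \<phi>(1)]])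
qed (auto simp: field_automorphism_group_def bij_comp)

lemma circulant_mult:
  "circulant a b ** circulant c d = circulant (a * c + b * d) (a * d + b * c)"
  by (simp add: circulant_def vec_eq_iff matrix_matrix_mult_def sum_2 forall_2 algebra_simps)

lemma mat_circulant: "mat c = circulant c 0"
  by (simp add: circulant_def vec_eq_iff mat_def forall_2)

lemma circulant_inj: "circulant a b = circulant c d \<longleftrightarrow> a = c \<and> b = d"
  by (auto simp: circulant_def vec_eq_iff forall_2)

lemma map_circulant: "map_matrix \<phi> (circulant a b) = circulant (\<phi> a) (\<phi> b)"
  by (simp add: circulant_def vec_eq_iff forall_2)

lemma circulant_inverse:
  fixes a b :: "'k::field"
  assumes "a * a \<noteq> b * b"
  defines "d \<equiv> a * a - b * b"
  shows "circulant a b ** circulant (a / d) (- b / d) = mat 1"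
    and "circulant (a / d) (- b / d) ** circulant a b = mat 1"
proof -
  have "a * (a / d) + b * (- b / d) = (a * a - b * b) / d"
    by (simp add: diff_divide_distrib)
  also have "\<dots> = 1"
    using assms by simp
  finally show "circulant a b ** circulant (a / d) (- b / d) = mat 1"
    "circulant (a / d) (- b / d) ** circulant a b = mat 1"
    by (simp_all add: circulant_mult mat_circulant circulant_inj algebra_simps)
qed

lemma invertible_circulant: "invertible (circulant a b) \<longleftrightarrow> a * a \<noteq> b * b"
proof
  assume "invertible (circulant a b)"
  then obtain B where B: "B ** circulant a b = mat 1"
    unfolding invertible_def by blast
  show "a * a \<noteq> b * b"
  proof
    assume eq: "a * a = b * b"
    have "circulant a b ** circulant a (- b) = circulant 0 0"
      by (simp add: circulant_mult eq algebra_simps)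
    also have "\<dots> = mat 0" by (simp add: mat_circulant)
    finally have "(B ** circulant a b) ** circulant a (- b) = B ** mat 0"
      by (simp only: matrix_mul_assoc[symmetric])
    then have "circulant a (- b) = B ** mat 0"
      by (simp add: B)
    also have "\<dots> = mat 0"
      by (simp add: vec_eq_iff matrix_matrix_mult_def mat_def)
    finally have "a = 0" "b = 0"
      by (auto simp: mat_circulant circulant_inj)
    then have "B ** mat 0 = mat 1"
      using B by (simp add: mat_circulant)
    moreover have "B ** mat 0 = mat 0"
      by (simp add: vec_eq_iff matrix_matrix_mult_def mat_def)
    ultimately show False
      by (simp add: mat_circulant circulant_inj)
  qed
next
  assume ne: "a * a \<noteq> b * b"
  then show "invertible (circulant a b)"
    unfolding invertible_def using circulant_inverse by blast
qed

lemma comm_group_circulant: "comm_group circulant_group"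
proof (rule comm_groupI)
  show "x \<otimes>\<^bsub>circulant_group\<^esub> y \<in> carrier circulant_group"
    if "x \<in> carrier circulant_group" "y \<in> carrier circulant_group" for x y :: "'a ^ 2 ^ 2"
    using that by (auto simp: circulant_group_def invertible_mult) (metis circulant_mult)
  show "\<one>\<^bsub>circulant_group\<^esub> \<in> carrier (circulant_group :: ('a ^ 2 ^ 2) monoid)"
    by (auto simp: circulant_group_def mat_circulant invertible_circulant)
  show "x \<otimes>\<^bsub>circulant_group\<^esub> y = y \<otimes>\<^bsub>circulant_group\<^esub> x"
    if "x \<in> carrier circulant_group" "y \<in> carrier circulant_group" for x y :: "'a ^ 2 ^ 2"
    using that by (auto simp: circulant_group_def circulant_mult circulant_inj algebra_simps)
  show "\<exists>y \<in> carrier circulant_group. y \<otimes>\<^bsub>circulant_group\<^esub> x = \<one>\<^bsub>circulant_group\<^esub>"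
    if "x \<in> carrier circulant_group" for x :: "'a ^ 2 ^ 2"
  proof -
    from that obtain a b where x: "x = circulant a b" and ne: "a * a \<noteq> b * b"
      by (auto simp: circulant_group_def invertible_circulant)
    let ?d = "a * a - b * b"
    let ?y = "circulant (a / ?d) (- b / ?d)"
    have y: "?y ** x = mat 1"
      unfolding x by (rule circulant_inverse(2)[OF ne])
    moreover have "x ** ?y = mat 1"
      unfolding x by (rule circulant_inverse(1)[OF ne])
    ultimately have "invertible ?y"
      unfolding invertible_def by blast
    with y show ?thesis
      by (intro bexI[of _ ?y]) (auto simp: circulant_group_def)
  qed
qed (simp_all add: circulant_group_def matrix_mul_assoc)

lemma normal_scalar_matrices: "(scalar_matrices :: ('k::field ^ 2 ^ 2) set) \<lhd> circulant_group"
proof -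
  interpret comm_group "circulant_group :: ('k ^ 2 ^ 2) monoid" by (rule comm_group_circulant)
  have sub: "(scalar_matrices :: ('k ^ 2 ^ 2) set) \<subseteq> carrier circulant_group"
    by (auto simp: scalar_matrices_def circulant_group_def mat_circulant invertible_circulant)
  have "subgroup (scalar_matrices :: ('k ^ 2 ^ 2) set) circulant_group"
  proof (rule subgroupI)
    show "scalar_matrices \<noteq> ({} :: ('k ^ 2 ^ 2) set)"
      unfolding scalar_matrices_def by (metis (mono_tags, lifting) empty_Collect_eq zero_neq_one)
    show "inv\<^bsub>circulant_group\<^esub> x \<in> scalar_matrices" if "x \<in> scalar_matrices" for x :: "'k ^ 2 ^ 2"
    proof -
      from that obtain c where c: "x = mat c" "c \<noteq> 0" by (auto simp: scalar_matrices_def)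
      have "mat (1 / c) \<in> scalar_matrices"
        unfolding scalar_matrices_def using c by (intro CollectI exI[of _ "1 / c"]) simp
      with sub have "mat (1 / c) \<in> carrier circulant_group"
        by blast
      moreover have "mat (1 / c) \<otimes>\<^bsub>circulant_group\<^esub> x = \<one>\<^bsub>circulant_group\<^esub>"
        using c by (simp add: circulant_group_def mat_circulant circulant_mult)
      ultimately have "inv\<^bsub>circulant_group\<^esub> x = mat (1 / c)"
        using that sub by (intro inv_equality) auto
      then show ?thesis
        using \<open>mat (1 / c) \<in> scalar_matrices\<close> by simp
    qed
    show "x \<otimes>\<^bsub>circulant_group\<^esub> y \<in> scalar_matrices"
      if "x \<in> scalar_matrices" "y \<in> scalar_matrices" for x y :: "'k ^ 2 ^ 2"
    proof -
      from that obtain c d where "x = mat c" "c \<noteq> 0" "y = mat d" "d \<noteq> 0"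
        by (auto simp: scalar_matrices_def)
      moreover have "mat c ** mat d = (mat (c * d) :: 'k ^ 2 ^ 2)"
        by (simp add: mat_circulant circulant_mult)
      ultimately show ?thesis
        by (auto simp: scalar_matrices_def circulant_group_def)
    qed
  qed (rule sub)
  then show ?thesis by (rule subgroup_imp_normal)
qed

lemma group_circulant_quotient: "group circulant_quotient"
  unfolding circulant_quotient_def by (rule normal.factorgroup_is_group[OF normal_scalar_matrices])

context
  fixes \<phi> :: "'k::field \<Rightarrow> 'k"
  assumes \<phi>: "\<phi> \<in> carrier field_automorphism_group"
begin

lemma field_automorphismD:
  "bij \<phi>" "\<phi> 1 = 1" "\<phi> (x + y) = \<phi> x + \<phi> y" "\<phi> (x * y) = \<phi> x * \<phi> y" "\<phi> 0 = 0"
  "\<phi> x = \<phi> y \<longleftrightarrow> x = y"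
proof -
  show *: "bij \<phi>" "\<phi> 1 = 1" "\<phi> (x + y) = \<phi> x + \<phi> y" "\<phi> (x * y) = \<phi> x * \<phi> y" for x y
    using \<phi> by (auto simp: field_automorphism_group_def)
  show "\<phi> 0 = 0" using *(3)[of 0 0] by (metis add.right_neutral add_left_cancel)
  show "\<phi> x = \<phi> y \<longleftrightarrow> x = y" using *(1) by (metis bij_is_inj injD)
qed

lemma map_matrix_scalar: "map_matrix \<phi> ` scalar_matrices = scalar_matrices"
proof
  show "map_matrix \<phi> ` scalar_matrices \<subseteq> scalar_matrices"
    using field_automorphismD(5,6)
    by (auto simp: scalar_matrices_def mat_circulant map_circulant) metis
  show "scalar_matrices \<subseteq> map_matrix \<phi> ` scalar_matrices"
  proof
    fix x :: "'k ^ 2 ^ 2" assume "x \<in> scalar_matrices"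
    then obtain c where c: "x = mat c" "c \<noteq> 0" by (auto simp: scalar_matrices_def)
    obtain d where d: "c = \<phi> d" using field_automorphismD(1) by (metis bij_pointE)
    have "x = map_matrix \<phi> (mat d)" "d \<noteq> 0"
      using c d field_automorphismD(5) by (auto simp: mat_circulant map_circulant)
    then show "x \<in> map_matrix \<phi> ` scalar_matrices" by (auto simp: scalar_matrices_def)
  qed
qed

lemma map_matrix_carrier:
  assumes "A \<in> carrier circulant_group"
  shows "map_matrix \<phi> A \<in> carrier circulant_group"
proof -
  from assms obtain a b where ab: "A = circulant a b" "a * a \<noteq> b * b"
    by (auto simp: circulant_group_def invertible_circulant)
  have "\<phi> a * \<phi> a \<noteq> \<phi> b * \<phi> b"
    unfolding field_automorphismD(4)[symmetric] field_automorphismD(6) by (rule ab(2))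
  with ab show ?thesis
    by (auto simp: circulant_group_def invertible_circulant map_circulant)
qed

lemma map_matrix_mult:
  "A \<in> carrier circulant_group \<Longrightarrow> B \<in> carrier circulant_group \<Longrightarrow>
     map_matrix \<phi> (A ** B) = map_matrix \<phi> A ** map_matrix \<phi> B"
  using field_automorphismD(3,4)
  by (auto simp: circulant_group_def map_circulant circulant_mult)

lemma map_matrix_coset:
  assumes "A \<in> carrier circulant_group"
  shows "map_matrix \<phi> ` (scalar_matrices #>\<^bsub>circulant_group\<^esub> A) =
    scalar_matrices #>\<^bsub>circulant_group\<^esub> map_matrix \<phi> A"
proof -
  have sub: "scalar_matrices \<subseteq> carrier circulant_group"
    using normal_scalar_matrices by (rule normal_imp_subgroup[THEN subgroup.subset])
  have "map_matrix \<phi> ` (scalar_matrices #>\<^bsub>circulant_group\<^esub> A) = (\<Union>x \<in> scalar_matrices. {map_matrix \<phi> (x ** A)})"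
    by (auto simp: r_coset_def circulant_group_def)
  also have "\<dots> = (\<Union>x \<in> scalar_matrices. {map_matrix \<phi> x ** map_matrix \<phi> A})"
    using map_matrix_mult[OF subsetD[OF sub] assms] by (intro SUP_cong) simp_all
  also have "\<dots> = (\<Union>x \<in> map_matrix \<phi> ` scalar_matrices. {x ** map_matrix \<phi> A})"
    by blast
  also have "\<dots> = scalar_matrices #>\<^bsub>circulant_group\<^esub> map_matrix \<phi> A"
    by (simp only: map_matrix_scalar) (simp add: r_coset_def circulant_group_def)
  finally show ?thesis .
qed

lemma entrywise_action_hom: "entrywise_action \<phi> \<in> hom circulant_quotient circulant_quotient"
proof (rule homI)
  interpret N: normal scalar_matrices circulant_group by (rule normal_scalar_matrices)
  fix x y :: "('k ^ 2 ^ 2) set"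
  assume x: "x \<in> carrier circulant_quotient"
  then obtain A where A: "A \<in> carrier circulant_group" "x = scalar_matrices #>\<^bsub>circulant_group\<^esub> A"
    by (auto simp: circulant_quotient_def carrier_FactGroup)
  show "entrywise_action \<phi> x \<in> carrier circulant_quotient"
    using x A map_matrix_coset[OF A(1)] map_matrix_carrier[OF A(1)]
    by (auto simp: entrywise_action_def circulant_quotient_def carrier_FactGroup)
  assume y: "y \<in> carrier circulant_quotient"
  then obtain B where B: "B \<in> carrier circulant_group" "y = scalar_matrices #>\<^bsub>circulant_group\<^esub> B"
    by (auto simp: circulant_quotient_def carrier_FactGroup)
  have AB: "A \<otimes>\<^bsub>circulant_group\<^esub> B \<in> carrier circulant_group" "A \<otimes>\<^bsub>circulant_group\<^esub> B = A ** B"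
    using A B N.m_closed by (simp_all add: circulant_group_def)
  have xy: "x \<otimes>\<^bsub>circulant_quotient\<^esub> y = scalar_matrices #>\<^bsub>circulant_group\<^esub> (A ** B)"
    using A B AB by (simp add: circulant_quotient_def N.rcos_sum)
  have xyc: "x \<otimes>\<^bsub>circulant_quotient\<^esub> y \<in> carrier circulant_quotient"
    unfolding xy using AB by (auto simp: circulant_quotient_def carrier_FactGroup)
  have "entrywise_action \<phi> (x \<otimes>\<^bsub>circulant_quotient\<^esub> y) =
      scalar_matrices #>\<^bsub>circulant_group\<^esub> (map_matrix \<phi> A ** map_matrix \<phi> B)"
    using xyc map_matrix_coset[OF AB(1)] A(1) B(1) AB(2) unfolding xy
    by (simp add: entrywise_action_def map_matrix_mult)
  also have "\<dots> = (scalar_matrices #>\<^bsub>circulant_group\<^esub> map_matrix \<phi> A)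
      \<otimes>\<^bsub>circulant_quotient\<^esub> (scalar_matrices #>\<^bsub>circulant_group\<^esub> map_matrix \<phi> B)"
    using N.rcos_sum[OF map_matrix_carrier[OF A(1)] map_matrix_carrier[OF B(1)]]
    by (simp add: circulant_quotient_def) (simp add: circulant_group_def)
  also have "\<dots> = entrywise_action \<phi> x \<otimes>\<^bsub>circulant_quotient\<^esub> entrywise_action \<phi> y"
    using x y A B by (simp add: entrywise_action_def map_matrix_coset)
  finally show "entrywise_action \<phi> (x \<otimes>\<^bsub>circulant_quotient\<^esub> y) =
      entrywise_action \<phi> x \<otimes>\<^bsub>circulant_quotient\<^esub> entrywise_action \<phi> y" .
qed

end

lemma entrywise_action_compose:
  fixes \<phi> \<psi> :: "'k::field \<Rightarrow> 'k"
  assumes "\<phi> \<in> carrier field_automorphism_group" "\<psi> \<in> carrier field_automorphism_group"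
  shows "entrywise_action (\<phi> \<circ> \<psi>) =
    compose (carrier circulant_quotient) (entrywise_action \<phi>) (entrywise_action \<psi>)"
proof
  fix C :: "('k ^ 2 ^ 2) set"
  have "map_matrix (\<phi> \<circ> \<psi>) A = map_matrix \<phi> (map_matrix \<psi> A)" for A :: "'k ^ 2 ^ 2"
    by (simp add: vec_eq_iff)
  then show "entrywise_action (\<phi> \<circ> \<psi>) C =
      compose (carrier circulant_quotient) (entrywise_action \<phi>) (entrywise_action \<psi>) C"
    using hom_in_carrier[OF entrywise_action_hom[OF assms(2)], of C]
    by (auto simp: entrywise_action_def compose_def image_image)
qed

lemma entrywise_action_id: "entrywise_action id = (\<lambda>C \<in> carrier circulant_quotient. C)"
proof -
  have "map_matrix id = (id :: 'a ^ 2 ^ 2 \<Rightarrow> 'a ^ 2 ^ 2)"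
    by (simp add: fun_eq_iff vec_eq_iff)
  then show ?thesis by (simp add: entrywise_action_def)
qed

lemma entrywise_action_auto:
  fixes \<phi> :: "'a::field \<Rightarrow> 'a"
  assumes "\<phi> \<in> carrier field_automorphism_group"
  shows "entrywise_action \<phi> \<in> auto circulant_quotient"
proof -
  interpret group field_automorphism_group by (rule group_field_automorphism_group)
  let ?Q = "carrier (circulant_quotient :: ('a ^ 2 ^ 2) set monoid)"
  let ?\<psi> = "inv\<^bsub>field_automorphism_group\<^esub> \<phi>"
  have \<psi>: "?\<psi> \<in> carrier field_automorphism_group" "?\<psi> \<circ> \<phi> = id" "\<phi> \<circ> ?\<psi> = id"
    using assms l_inv[OF assms] r_inv[OF assms] inv_closed by (auto simp: field_automorphism_group_def)
  have 1: "compose ?Q (entrywise_action ?\<psi>) (entrywise_action \<phi>) C = C"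
      "compose ?Q (entrywise_action \<phi>) (entrywise_action ?\<psi>) C = C" if "C \<in> ?Q" for C
    unfolding entrywise_action_compose[OF \<psi>(1) assms, symmetric]
      entrywise_action_compose[OF assms \<psi>(1), symmetric] \<psi>(2,3) entrywise_action_id
    using that by simp_all
  have "bij_betw (entrywise_action \<phi>) ?Q ?Q"
    using 1 hom_in_carrier[OF entrywise_action_hom[OF assms]]
      hom_in_carrier[OF entrywise_action_hom[OF \<psi>(1)]]
    by (intro bij_betwI[where g = "entrywise_action ?\<psi>"]) (auto simp: compose_eq)
  then show ?thesis
    using entrywise_action_hom[OF assms] by (simp add: auto_def Bij_def entrywise_action_def)
qed

lemma entrywise_action_action:
  "entrywise_action \<in> hom field_automorphism_group (AutoGroup circulant_quotient)"
proof (rule homI)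
  fix \<phi> \<psi> :: "'k::field \<Rightarrow> 'k"
  assume \<phi>: "\<phi> \<in> carrier field_automorphism_group"
  show "entrywise_action \<phi> \<in> carrier (AutoGroup circulant_quotient)"
    using entrywise_action_auto[OF \<phi>] by (simp add: AutoGroup_def)
  assume \<psi>: "\<psi> \<in> carrier field_automorphism_group"
  have "entrywise_action \<phi> \<in> Bij (carrier circulant_quotient)"
    "entrywise_action \<psi> \<in> Bij (carrier circulant_quotient)"
    using entrywise_action_auto \<phi> \<psi> by (auto simp: auto_def)
  then show "entrywise_action (\<phi> \<otimes>\<^bsub>field_automorphism_group\<^esub> \<psi>) =
      entrywise_action \<phi> \<otimes>\<^bsub>AutoGroup circulant_quotient\<^esub> entrywise_action \<psi>"
    using entrywise_action_compose[OF \<phi> \<psi>]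
    by (simp add: AutoGroup_def BijGroup_def field_automorphism_group_def)
qed

end

(*
  A functor automorphism is turned into a natural family of bijections between the carriers of free
  algebras by transporting the arrows out of the free algebra on one generator, which is preserved
  because it is the only free algebra with exactly two idempotent endomorphisms. Under these
  bijections every operation becomes a word in the operations. Scalars act through invertible words
  in one letter, and those are linear for degree reasons, so they give a bijection phi of k; over an
  infinite field, homogeneity then forces the sum to be transported to the sum and the product x y
  to a x y + b y x, with a^2 different from b^2 by bijectivity. The triple (phi, a, b) is determined
  by the functor up to scaling (a, b), it is (id, c, 0) exactly for inner automorphisms, composition
  of functors multiplies circulant matrices twisted by phi, and every triple arises by conjugating
  with the corresponding twisted endomorphism of the free algebras.
*)

theory Submission
  imports Defs "HOL-Computational_Algebra.Polynomial"
begin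


section \<open>Substitution in free linear algebras\<close>

text \<open>The obstacle is that the object map is controlled only on algebras with one generator;
  ranks are never compared in general, so transported generators are not known to form a basis. That
  elements still transport to words in them comes from surjectivity on arrows
  (\<open>word_of_transport\<close>), and coefficients become readable because suitable elements
  transport to prescribed free generators. Bijections natural in the algebra replace isomorphisms,
  since a nontrivial twist is not a homomorphism. Two such families for one functor differ by a word
  in one letter that is invertible under composition, hence by a scalar: this produces the quotient
  by scalar matrices. Nesting one product rule in another multiplies circulant matrices, the inner
  entries being moved by \<open>\<phi>\<close>: this produces the semidirect action. The condition
  on \<open>a\<close> and \<open>b\<close> says that the determinant \<open>a * a - b * b\<close> is
  nonzero.\<close>

type_synonym ('k, 'x) free_element = "'x nonassoc_word \<Rightarrow>\<^sub>0 'k"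

abbreviation free_smult :: "'k::field \<Rightarrow> ('k, 'x) free_element \<Rightarrow> ('k, 'x) free_element" where
  "free_smult c \<equiv> Poly_Mapping.map ((*) c)"

abbreviation free_carrier :: "'x set \<Rightarrow> ('k::field, 'x) free_element set" where
  "free_carrier X \<equiv> carrier (free_linear_algebra X)"

abbreviation free_hom :: "'x set \<Rightarrow> 'x set \<Rightarrow>
    (('k::field, 'x) free_element \<Rightarrow> ('k, 'x) free_element) set" where
  "free_hom X Y \<equiv> linear_algebra_hom (free_linear_algebra X) (free_linear_algebra Y)"

abbreviation free_word :: "('x \<Rightarrow> ('k::field, 'x) free_element) \<Rightarrow> 'x nonassoc_word \<Rightarrow>
    ('k, 'x) free_element" where
  "free_word \<equiv> word_eval (free_linear_algebra UNIV)"

text \<open>Evaluation takes place in the algebra on all letters, so a single total function serves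
  every \<open>free_carrier X\<close>; values of \<open>f\<close> off \<open>X\<close> are
  irrelevant there by \<open>subst_cong\<close>.\<close>

definition subst :: "('x \<Rightarrow> ('k::field, 'x) free_element) \<Rightarrow> ('k, 'x) free_element \<Rightarrow>
    ('k, 'x) free_element" where
  "subst f p = (\<Sum>u \<in> Poly_Mapping.keys p. free_smult (Poly_Mapping.lookup p u) (free_word f u))"

lemma free_carrier_UNIV [simp]: "p \<in> free_carrier UNIV"
  by (simp add: free_carrier_iff)

lemma free_carrier_zero [simp]: "0 \<in> free_carrier X"
  by (simp add: free_carrier_iff)

lemma free_carrier_add [simp]: "p \<in> free_carrier X \<Longrightarrow> q \<in> free_carrier X \<Longrightarrow> p + q \<in> free_carrier X"
proof -
  interpret linear_algebra "free_linear_algebra X" by (rule linear_algebra_free)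
  show "p \<in> free_carrier X \<Longrightarrow> q \<in> free_carrier X \<Longrightarrow> p + q \<in> free_carrier X"
    using add.m_closed[of p q] by simp
qed

lemma free_carrier_smult [simp]: "p \<in> free_carrier X \<Longrightarrow> free_smult c p \<in> free_carrier X"
  by (simp add: free_carrier_iff lookup_smult)

lemma free_carrier_mult [simp]:
  "p \<in> free_carrier X \<Longrightarrow> q \<in> free_carrier X \<Longrightarrow> free_mult p q \<in> free_carrier X"
  by (auto simp: free_carrier_iff lookup_free_mult split: nonassoc_word.splits)

lemma single_eq_zero_iff [simp]: "Poly_Mapping.single u c = 0 \<longleftrightarrow> c = 0"
  by (metis lookup_single_eq lookup_zero single_zero)

lemma smult_single [simp]: "free_smult c (Poly_Mapping.single u d) = Poly_Mapping.single u (c * d)"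
  by (rule poly_mapping_eqI) (simp add: lookup_smult lookup_single when_def)

lemma mult_single [simp]: "free_mult (Poly_Mapping.single u c) (Poly_Mapping.single v d) =
    Poly_Mapping.single (Juxt u v) (c * d)"
  by (rule poly_mapping_eqI)
    (auto simp: lookup_free_mult lookup_single when_def split: nonassoc_word.split)

lemma free_smult_simps [simp]:
  "free_smult 1 p = p" "free_smult 0 p = 0" "free_smult c 0 = 0"
  "free_smult c (free_smult d p) = free_smult (c * d) p"
  by (rule poly_mapping_eqI; simp add: lookup_smult mult.assoc)+

lemma free_smult_add: "free_smult c (p + q) = free_smult c p + free_smult c q"
  by (rule poly_mapping_eqI) (simp add: lookup_smult lookup_add algebra_simps)

lemma free_smult_add_left: "free_smult (c + d) p = free_smult c p + free_smult d p"
  by (rule poly_mapping_eqI) (simp add: lookup_smult lookup_add algebra_simps)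

lemma free_mult_smult [simp]:
  "free_mult (free_smult c p) q = free_smult c (free_mult p q)"
  "free_mult p (free_smult c q) = free_smult c (free_mult p q)"
  by (rule poly_mapping_eqI; simp add: lookup_smult lookup_free_mult split: nonassoc_word.split)+

lemma free_mult_add:
  "free_mult (p + p') q = free_mult p q + free_mult p' q"
  "free_mult p (q + q') = free_mult p q + free_mult p q'"
  by (rule poly_mapping_eqI;
      simp add: lookup_add lookup_free_mult algebra_simps split: nonassoc_word.split)+

lemma free_mult_zero [simp]: "free_mult 0 q = 0" "free_mult p 0 = 0"
  by (rule poly_mapping_eqI; simp add: lookup_free_mult split: nonassoc_word.split)+

lemma finsum_free:
  assumes "g \<in> A \<rightarrow> free_carrier X"
  shows "finsum (free_linear_algebra X) g A = sum g A"
proof -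
  interpret linear_algebra "free_linear_algebra X" by (rule linear_algebra_free)
  show ?thesis
  proof (cases "finite A")
    case True
    then show ?thesis using assms
      by (induction A rule: finite_induct) simp_all
  qed (simp add: finsum_infinite)
qed

lemma subst_eq_free_extend: "subst f = linear_algebra.free_extend (free_linear_algebra UNIV) f"
proof -
  interpret linear_algebra "free_linear_algebra UNIV" by (rule linear_algebra_free)
  show ?thesis
    by (simp add: fun_eq_iff subst_def free_extend_def finsum_free)
qed

lemma subst_simps [simp]:
  "subst f 0 = 0"
  "subst f (Poly_Mapping.single u c) = free_smult c (free_word f u)"
  "subst f (p + q) = subst f p + subst f q"
  "subst f (free_smult c p) = free_smult c (subst f p)"
  "subst f (free_mult p q) = free_mult (subst f p) (subst f q)"
proof -
  interpret linear_algebra "free_linear_algebra UNIV" by (rule linear_algebra_free)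
  have f: "f \<in> UNIV \<rightarrow> free_carrier UNIV" by simp
  show "subst f 0 = 0"
    "subst f (Poly_Mapping.single u c) = free_smult c (free_word f u)"
    "subst f (p + q) = subst f p + subst f q"
    "subst f (free_smult c p) = free_smult c (subst f p)"
    "subst f (free_mult p q) = free_mult (subst f p) (subst f q)"
    unfolding subst_eq_free_extend
    using free_extend_zero[OF f] free_extend_single[OF f, of u c] free_extend_add[OF f, of p q]
      free_extend_smult[OF f, of p c] free_extend_mult[OF f, of p q] by simp_all
qed

lemma lookup_subst: "Poly_Mapping.lookup (subst f p) v =
    (\<Sum>u \<in> Poly_Mapping.keys p. Poly_Mapping.lookup p u * Poly_Mapping.lookup (free_word f u) v)"
  by (simp add: subst_def lookup_sum lookup_smult)

lemma free_word_closed: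
  "f \<in> X \<rightarrow> free_carrier Y \<Longrightarrow> letters u \<subseteq> X \<Longrightarrow> free_word f u \<in> free_carrier Y"
  by (induction u) auto

lemma free_word_cong: "(\<And>i. i \<in> letters u \<Longrightarrow> f i = g i) \<Longrightarrow> free_word f u = free_word g u"
  by (induction u) auto

lemma subst_closed:
  assumes "p \<in> free_carrier X" "f \<in> X \<rightarrow> free_carrier Y"
  shows "subst f p \<in> free_carrier Y"
  using assms(1) by (induction p rule: free_induct) (simp_all add: free_word_closed[OF assms(2)])

lemma subst_cong:
  assumes "p \<in> free_carrier X" "\<And>i. i \<in> X \<Longrightarrow> f i = g i"
  shows "subst f p = subst g p"
proof -
  have "free_word f u = free_word g u" if "letters u \<subseteq> X" for u
    using that assms(2) by (intro free_word_cong) auto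
  with assms(1) show ?thesis
    by (induction p rule: free_induct) simp_all
qed

lemma subst_hom:
  assumes "f \<in> X \<rightarrow> free_carrier Y"
  shows "restrict (subst f) (free_carrier X) \<in> free_hom X Y"
  using assms by (auto simp: linear_algebra_hom_def subst_closed)

lemma free_homD:
  assumes "h \<in> free_hom X Y" "p \<in> free_carrier X"
  shows "h p \<in> free_carrier Y" "h (free_smult c p) = free_smult c (h p)"
    "q \<in> free_carrier X \<Longrightarrow> h (p + q) = h p + h q"
    "q \<in> free_carrier X \<Longrightarrow> h (free_mult p q) = free_mult (h p) (h q)"
  using assms by (auto simp: linear_algebra_hom_def)

text \<open>Uniqueness in the universal property. Abstract arrows can thereby be computed with as
  substitutions.\<close>

lemma hom_subst:
  assumes "h \<in> free_hom X Y" "p \<in> free_carrier X"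
  shows "h p = subst (\<lambda>i. h (free_gen i)) p"
proof -
  interpret linear_algebra "free_linear_algebra Y" by (rule linear_algebra_free)
  have f: "(\<lambda>i. h (free_gen i)) \<in> X \<rightarrow> free_carrier Y"
    using free_homD(1)[OF assms(1)] by auto
  let ?P = "\<lambda>g. g \<in> free_hom X Y \<and> (\<forall>i \<in> X. g (free_gen i) = h (free_gen i))"
  let ?s = "restrict (subst (\<lambda>i. h (free_gen i))) (free_carrier X)"
  have P: "?P h" "?P ?s" using assms(1) subst_hom[OF f] by simp_all
  note unique = the1_equality[OF free_linear_algebra_universal[OF f]]
  have "h = ?s" by (rule trans[OF sym[OF unique[OF P(1)]] unique[OF P(2)]])
  then have "h p = ?s p" by (rule fun_cong)
  with assms(2) show ?thesis by simp
qed

lemma hom_eqI: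
  assumes "h \<in> free_hom X Y" "h' \<in> free_hom X Y" "\<And>i. i \<in> X \<Longrightarrow> h (free_gen i) = h' (free_gen i)"
  shows "h = h'"
proof
  fix p
  show "h p = h' p"
  proof (cases "p \<in> free_carrier X")
    case True
    then show ?thesis
      unfolding hom_subst[OF assms(1) True] hom_subst[OF assms(2) True]
      using assms(3) by (intro subst_cong)
  next
    case False
    then show ?thesis
      using linear_algebra_homD(1)[OF assms(1)] linear_algebra_homD(1)[OF assms(2)] by simp
  qed
qed

lemma free_hom_compose:
  "h \<in> free_hom X Y \<Longrightarrow> g \<in> free_hom Y Z \<Longrightarrow> compose (free_carrier X) g h \<in> free_hom X Z"
  by (rule linear_algebra_hom_compose[OF _ _ linear_algebra_free])

lemma free_hom_id: "(\<lambda>p \<in> free_carrier X. p) \<in> free_hom X X"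
  by (rule linear_algebra_hom_id[OF linear_algebra_free])

lemma hom_apply_subst:
  assumes h: "h \<in> free_hom Y Z" and z: "z \<in> X \<rightarrow> free_carrier Y" and p: "p \<in> free_carrier X"
  shows "h (subst z p) = subst (\<lambda>i. h (z i)) p"
proof -
  have hom: "compose (free_carrier X) h (restrict (subst z) (free_carrier X)) \<in> free_hom X Z"
    by (rule free_hom_compose[OF subst_hom[OF z] h])
  have "h (subst z p) = compose (free_carrier X) h (restrict (subst z) (free_carrier X)) p"
    using p by (simp add: compose_eq)
  also have "\<dots> = subst (\<lambda>i. h (z i)) p"
    unfolding hom_subst[OF hom p] by (rule subst_cong[OF p]) (simp add: compose_eq)
  finally show ?thesis .
qed

lemma free_word_gen: "free_word free_gen u = Poly_Mapping.single u 1"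
  by (induction u) simp_all

lemma subst_gen: "subst free_gen p = p"
proof -
  have "p \<in> free_carrier UNIV" by simp
  then show ?thesis
    by (induction p rule: free_induct) (simp_all add: free_word_gen)
qed

lemma single_Letter_eq_iff:
  "Poly_Mapping.single (Letter i) c = Poly_Mapping.single (Letter i) d \<longleftrightarrow> c = d"
  by (metis lookup_single_eq)

section \<open>Degrees in one generator\<close>

text \<open>Two choices of \<open>f\<close> matter: constant 1 gives the length, and the indicator
  of a letter gives the degree in that letter.\<close>

primrec weight :: "('x \<Rightarrow> nat) \<Rightarrow> 'x nonassoc_word \<Rightarrow> nat" where
  "weight f (Letter i) = f i"
| "weight f (Juxt u v) = weight f u + weight f v"

abbreviation len :: "'x nonassoc_word \<Rightarrow> nat" where
  "len \<equiv> weight (\<lambda>_. 1)"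

lemma len_pos: "0 < len u"
  by (induction u) auto

text \<open>This is the word that composition in one letter makes out of two leading words. The
  letter is discarded because only words in a single letter are grafted into.\<close>

primrec graft :: "'x nonassoc_word \<Rightarrow> 'x nonassoc_word \<Rightarrow> 'x nonassoc_word" where
  "graft t (Letter i) = t"
| "graft t (Juxt u v) = Juxt (graft t u) (graft t v)"

lemma len_graft: "len (graft t u) = len t * len u"
  by (induction u) (auto simp: algebra_simps)

text \<open>Without associativity a word splits in exactly one way, so a coefficient of a product is
  a single product of coefficients and the induction follows the splitting. If \<open>u'\<close> is
  no longer than \<open>u\<close>, either both halves satisfy the same bound or one half is strictly
  shorter, hence different, and contributes the factor 0.\<close>

lemma lookup_graft:
  assumes v: "\<And>z. Poly_Mapping.lookup v z \<noteq> 0 \<Longrightarrow> len z \<le> len t"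
  shows "letters u \<subseteq> {i} \<Longrightarrow> letters u' \<subseteq> {i} \<Longrightarrow> len u' \<le> len u \<Longrightarrow>
    Poly_Mapping.lookup (free_word (\<lambda>_. v) u') (graft t u) =
      (if u' = u then Poly_Mapping.lookup v t ^ len u else 0)"
proof (induction u arbitrary: u')
  case (Letter j)
  \<comment> \<open>A \<open>Juxt\<close> has length at least 2, which the bound by
    \<open>len (Letter j)\<close> excludes; the \<open>case\<close> terms name its halves before the
    split on \<open>u'\<close>.\<close>
  then show ?case using len_pos[of "case u' of Juxt a b \<Rightarrow> a"] len_pos[of "case u' of Juxt a b \<Rightarrow> b"]
    by (cases u') auto
next
  case (Juxt a b)
  show ?case
  proof (cases u')
    case (Letter j)
    have "len t < len (graft t (Juxt a b))"
      using len_pos[of t] len_pos[of a] len_pos[of b] unfolding len_graft by simp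
    with v have "Poly_Mapping.lookup v (graft t (Juxt a b)) = 0"
      by (metis leD)
    with Letter show ?thesis by simp
  next
    case (Juxt a' b')
    have sub: "letters a \<subseteq> {i}" "letters b \<subseteq> {i}" "letters a' \<subseteq> {i}" "letters b' \<subseteq> {i}"
      and le: "len a' + len b' \<le> len a + len b"
      using Juxt.prems Juxt by auto
    consider "len a' \<le> len a" "len b' \<le> len b" | "len a' < len a" | "len b' < len b"
      using le by linarith
    then show ?thesis
    proof cases
      case 1
      then show ?thesis
        using Juxt.IH(1)[of a'] Juxt.IH(2)[of b'] sub \<open>u' = Juxt a' b'\<close>
        by (auto simp: lookup_free_mult power_add)
    next
      case 2
      then show ?thesis
        using Juxt.IH(1)[of a'] sub \<open>u' = Juxt a' b'\<close> by (auto simp: lookup_free_mult)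
    next
      case 3
      then show ?thesis
        using Juxt.IH(2)[of b'] sub \<open>u' = Juxt a' b'\<close> by (auto simp: lookup_free_mult)
    qed
  qed
qed

lemma top_word_exists:
  assumes "p \<noteq> 0"
  obtains u where "Poly_Mapping.lookup p u \<noteq> 0"
    "\<And>z. Poly_Mapping.lookup p z \<noteq> 0 \<Longrightarrow> len z \<le> len u"
proof -
  have "Poly_Mapping.keys p \<noteq> {}" using assms by simp
  then obtain u where "u \<in> Poly_Mapping.keys p" "len u = Max (len ` Poly_Mapping.keys p)"
    using Max_in[of "len ` Poly_Mapping.keys p"] by (auto simp: image_iff)
  moreover have "len z \<le> Max (len ` Poly_Mapping.keys p)" if "z \<in> Poly_Mapping.keys p" for z
    using that by simp
  ultimately show thesis
    using that[of u] by (auto simp: in_keys_iff)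
qed

text \<open>The top-degree word of a composition is a graft of top-degree words, so no cancellation occurs.\<close>

lemma lookup_subst_top:
  assumes w: "w \<in> free_carrier {i}" "Poly_Mapping.lookup w u \<noteq> 0"
      "\<And>z. Poly_Mapping.lookup w z \<noteq> 0 \<Longrightarrow> len z \<le> len u"
    and v: "Poly_Mapping.lookup v t \<noteq> 0"
      "\<And>z. Poly_Mapping.lookup v z \<noteq> 0 \<Longrightarrow> len z \<le> len t"
  shows "Poly_Mapping.lookup (subst (\<lambda>_. v) w) (graft t u) \<noteq> 0"
proof -
  have *: "Poly_Mapping.lookup (free_word (\<lambda>_. v) z) (graft t u) =
      (if z = u then Poly_Mapping.lookup v t ^ len u else 0)" if "z \<in> Poly_Mapping.keys w" for z
    using that w by (intro lookup_graft[OF v(2), where i = i]) (auto simp: free_carrier_iff in_keys_iff)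
  have "Poly_Mapping.lookup (subst (\<lambda>_. v) w) (graft t u) =
      (\<Sum>z \<in> Poly_Mapping.keys w. if z = u then Poly_Mapping.lookup w u * Poly_Mapping.lookup v t ^ len u else 0)"
    unfolding lookup_subst by (intro sum.cong) (auto simp: *)
  also have "\<dots> = Poly_Mapping.lookup w u * Poly_Mapping.lookup v t ^ len u"
    using w(2) by (simp add: sum.delta in_keys_iff)
  finally show ?thesis using w(2) v(1) by simp
qed

lemma weight_le_1_single:
  assumes w: "w \<in> free_carrier {i}" and "\<And>z. Poly_Mapping.lookup w z \<noteq> 0 \<Longrightarrow> len z \<le> 1"
  shows "w = Poly_Mapping.single (Letter i) (Poly_Mapping.lookup w (Letter i))"
proof (rule poly_mapping_eqI)
  fix z
  have "z = Letter i" if "Poly_Mapping.lookup w z \<noteq> 0"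
  proof (cases z)
    case (Letter j)
    then show ?thesis using w that by (auto simp: free_carrier_iff)
  next
    case (Juxt a b)
    then show ?thesis using assms(2)[OF that] len_pos[of a] len_pos[of b] by simp
  qed
  then show "Poly_Mapping.lookup w z =
      Poly_Mapping.lookup (Poly_Mapping.single (Letter i) (Poly_Mapping.lookup w (Letter i))) z"
    by (auto simp: lookup_single when_def)
qed

lemma free_word_zero: "free_word (\<lambda>_. 0) u = 0"
  by (induction u) simp_all

lemma subst_const_zero: "subst (\<lambda>_. 0) p = 0"
  by (simp add: subst_def free_word_zero)

text \<open>Lengths of leading words multiply under composition, so a composite of length 1 has
  factors with leading words of length 1.\<close>

lemma linear_if_left_invertible:
  assumes w: "w \<in> free_carrier {i}" and "c \<noteq> 0"
    and eq: "subst (\<lambda>_. v) w = Poly_Mapping.single (Letter i) c"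
  obtains d where "w = Poly_Mapping.single (Letter i) d"
proof -
  have ne: "Poly_Mapping.single (Letter i) c \<noteq> 0"
    using \<open>c \<noteq> 0\<close> by (metis lookup_single_eq lookup_zero)
  have "w \<noteq> 0" "v \<noteq> 0" using ne eq by (auto simp: subst_const_zero)
  obtain u where u: "Poly_Mapping.lookup w u \<noteq> 0"
    "\<And>z. Poly_Mapping.lookup w z \<noteq> 0 \<Longrightarrow> len z \<le> len u"
    using top_word_exists[OF \<open>w \<noteq> 0\<close>] by blast
  obtain t where t: "Poly_Mapping.lookup v t \<noteq> 0"
    "\<And>z. Poly_Mapping.lookup v z \<noteq> 0 \<Longrightarrow> len z \<le> len t"
    using top_word_exists[OF \<open>v \<noteq> 0\<close>] by blast
  have "graft t u = Letter i"
    using lookup_subst_top[OF w u t] unfolding eq by (auto simp: lookup_single when_def split: if_splits)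
  then have "len t * len u = 1" by (metis len_graft weight.simps(1))
  then have "len u = 1" by simp
  with u show thesis using weight_le_1_single[OF w] that by metis
qed

text \<open>Composing \<open>p\<close> with itself squares the length of its leading word, so that
  length is 1; the remaining coefficient is an idempotent of a field.\<close>

lemma idempotent_one_generator:
  assumes p: "p \<in> free_carrier {i}" and eq: "subst (\<lambda>_. p) p = p"
  shows "p = 0 \<or> p = free_gen i"
proof (cases "p = 0")
  case False
  obtain u where u: "Poly_Mapping.lookup p u \<noteq> 0"
    "\<And>z. Poly_Mapping.lookup p z \<noteq> 0 \<Longrightarrow> len z \<le> len u"
    using top_word_exists[OF False] by blast
  have "len (graft u u) \<le> len u"
    using lookup_subst_top[OF p u u] unfolding eq by (rule u(2))
  then have "len u \<le> 1" using len_pos[of u] unfolding len_graft by simp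
  then obtain c where c: "p = Poly_Mapping.single (Letter i) c"
    using weight_le_1_single[OF p] u(2) by (metis order_trans)
  then have "c * c = c" using eq by (simp add: single_Letter_eq_iff)
  then show ?thesis using c by auto
qed simp

section \<open>Homogeneity over an infinite field\<close>

lemma free_word_scale: "free_word (\<lambda>i. Poly_Mapping.single (Letter i) (\<nu> ^ f i)) u =
    Poly_Mapping.single u (\<nu> ^ weight f u)"
  by (induction u) (simp_all add: power_add)

text \<open>Words are the common eigenvectors of the diagonal substitutions, with eigenvalue
  \<open>\<nu>\<close> to the power of the weight.\<close>

lemma lookup_subst_scale:
  "Poly_Mapping.lookup (subst (\<lambda>i. Poly_Mapping.single (Letter i) (\<nu> ^ f i)) w) u =
    \<nu> ^ weight f u * Poly_Mapping.lookup w u"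
proof -
  have "w \<in> free_carrier UNIV" by simp
  then show ?thesis
    by (induction w rule: free_induct)
      (simp_all add: free_word_scale lookup_add lookup_single when_def algebra_simps)
qed

text \<open>Otherwise the nonzero polynomial \<open>monom 1 n - monom 1 1\<close> would have
  infinitely many roots. Every use of the infinitude of the field reduces to this one; over a field
  with q elements the exponent q would also qualify.\<close>

lemma power_eq_self_infinite:
  assumes "infinite (UNIV :: 'k::field set)" "\<And>\<nu> :: 'k. \<nu> ^ n = \<nu>"
  shows "n = 1"
proof (rule ccontr)
  assume "n \<noteq> 1"
  let ?p = "monom 1 n - monom 1 1 :: 'k poly"
  have "coeff ?p n \<noteq> 0" using \<open>n \<noteq> 1\<close> by simp
  then have "?p \<noteq> 0" by (metis coeff_0)
  then have "finite {x. poly ?p x = 0}" by (rule poly_roots_finite)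
  moreover have "{x. poly ?p x = 0} = UNIV" using assms(2) by (simp add: poly_monom)
  ultimately show False using assms(1) by simp
qed

lemma weight_1_if_homogeneous:
  assumes "infinite (UNIV :: 'k::field set)"
    and "\<And>\<nu> :: 'k. subst (\<lambda>i. Poly_Mapping.single (Letter i) (\<nu> ^ f i)) w = free_smult \<nu> w"
    and "Poly_Mapping.lookup w u \<noteq> 0"
  shows "weight f u = 1"
proof (rule power_eq_self_infinite[OF assms(1)])
  fix \<nu> :: 'k
  have "\<nu> ^ weight f u * Poly_Mapping.lookup w u = \<nu> * Poly_Mapping.lookup w u"
    unfolding lookup_subst_scale[symmetric] assms(2) by (simp add: lookup_smult)
  with assms(3) show "\<nu> ^ weight f u = \<nu>" by simp
qed


section \<open>Automorphisms of the category of free algebras\<close>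

definition idempotents :: "'x set \<Rightarrow> (('k::field, 'x) free_element \<Rightarrow> ('k, 'x) free_element) set" where
  "idempotents X = {e \<in> free_hom X X. compose (free_carrier X) e e = e}"

lemma restrict_subst_idempotent:
  assumes "\<And>i. i \<in> X \<Longrightarrow> f i = 0 \<or> f i = free_gen i"
  shows "restrict (subst f) (free_carrier X) \<in> idempotents X"
proof -
  have f: "f \<in> X \<rightarrow> free_carrier X" using assms by fastforce
  note hom = subst_hom[OF f]
  have "compose (free_carrier X) (restrict (subst f) (free_carrier X)) (restrict (subst f) (free_carrier X))
      = restrict (subst f) (free_carrier X)"
  proof (rule hom_eqI[OF free_hom_compose[OF hom hom] hom])
    fix i assume i: "i \<in> X"
    then show "compose (free_carrier X) (restrict (subst f) (free_carrier X))
        (restrict (subst f) (free_carrier X)) (free_gen i) =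
      restrict (subst f) (free_carrier X) (free_gen i)"
      using assms[OF i] f by (auto simp: compose_eq Pi_iff)
  qed
  with hom show ?thesis by (simp add: idempotents_def)
qed

text \<open>An endomorphism is substitution of one element \<open>?p\<close>, and idempotence means
  that \<open>?p\<close> composed with itself is \<open>?p\<close>; only the zero map and the
  identity survive.\<close>

lemma card_idempotents_singleton:
  "card (idempotents {i} :: (('k::field, 'x) free_element \<Rightarrow> ('k, 'x) free_element) set) = 2"
proof -
  let ?e = "\<lambda>q :: ('k, 'x) free_element. restrict (subst (\<lambda>_. q)) (free_carrier {i})"
  have "idempotents {i} = {?e 0, ?e (free_gen i)}"
  proof
    show "{?e 0, ?e (free_gen i)} \<subseteq> idempotents {i}"
      using restrict_subst_idempotent[of "{i}" "\<lambda>_. 0"]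
        restrict_subst_idempotent[of "{i}" "\<lambda>_. free_gen i"] by simp
    show "idempotents {i} \<subseteq> {?e 0, ?e (free_gen i)}"
    proof
      fix e :: "('k, 'x) free_element \<Rightarrow> ('k, 'x) free_element"
      assume "e \<in> idempotents {i}"
      then have e: "e \<in> free_hom {i} {i}" and ee: "compose (free_carrier {i}) e e = e"
        by (auto simp: idempotents_def)
      let ?p = "e (free_gen i)"
      have p: "?p \<in> free_carrier {i}" by (rule free_homD(1)[OF e]) simp
      have "subst (\<lambda>_. ?p) ?p = subst (\<lambda>j. e (free_gen j)) ?p"
        by (rule subst_cong[OF p]) simp
      also have "\<dots> = e ?p" by (rule hom_subst[OF e p, symmetric])
      also have "\<dots> = ?p" using fun_cong[OF ee, of "free_gen i"] by (simp add: compose_eq)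
      finally have "?p = 0 \<or> ?p = free_gen i" by (rule idempotent_one_generator[OF p])
      moreover have "e = ?e ?p"
        using p by (intro hom_eqI[OF e subst_hom]) auto
      ultimately show "e \<in> {?e 0, ?e (free_gen i)}" by (metis insertCI)
    qed
  qed
  moreover have "?e 0 (free_gen i) \<noteq> ?e (free_gen i) (free_gen i)"
    by simp
  then have "?e 0 \<noteq> ?e (free_gen i)" by metis
  ultimately show ?thesis by simp
qed

text \<open>Killing some of the generators is idempotent. With two generators, keeping none, keeping
  only \<open>i\<close> and keeping all are already three idempotents; with no generator there is
  only one endomorphism.\<close>

lemma singleton_if_card_idempotents:
  assumes "card (idempotents X :: (('k::field, 'x) free_element \<Rightarrow> ('k, 'x) free_element) set) = 2"
  shows "\<exists>i. X = {i}"
proof -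
  let ?I = "idempotents X :: (('k, 'x) free_element \<Rightarrow> ('k, 'x) free_element) set"
  let ?e = "\<lambda>A. restrict (subst (\<lambda>i. if i \<in> A then free_gen i else 0)) (free_carrier X) ::
    ('k, 'x) free_element \<Rightarrow> ('k, 'x) free_element"
  have fin: "finite ?I" using assms card.infinite by fastforce
  have mem: "?e A \<in> ?I" for A
    by (rule restrict_subst_idempotent) simp
  have app: "?e A (free_gen i) = (if i \<in> A then free_gen i else 0)" if "i \<in> X" for A i
    using that by simp
  have "X \<noteq> {}"
  proof
    assume X: "X = {}"
    have "e = e'" if "e \<in> ?I" "e' \<in> ?I" for e e'
      using that by (intro hom_eqI[of _ X X]) (auto simp: idempotents_def X)
    then have "card ?I \<le> 1" using fin by (auto simp: card_le_Suc0_iff_eq)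
    with assms show False by simp
  qed
  then obtain i where i: "i \<in> X" by blast
  have "X = {i}"
  proof (rule ccontr)
    assume "X \<noteq> {i}"
    then obtain j where j: "j \<in> X" "j \<noteq> i" using i by blast
    have ne: "?e A \<noteq> ?e B" if "l \<in> X" "l \<in> A \<longleftrightarrow> l \<notin> B" for l A B
    proof
      assume "?e A = ?e B"
      then have "?e A (free_gen l) = ?e B (free_gen l)" by (rule fun_cong)
      then show False using that(2) unfolding app[OF that(1)] by (auto split: if_splits)
    qed
    have "?e {} \<noteq> ?e {i}" "?e {i} \<noteq> ?e UNIV" "?e {} \<noteq> ?e UNIV"
      by (rule ne[OF i] ne[OF j(1)]; use j in simp)+
    then have "card {?e {}, ?e {i}, ?e UNIV} = 3" by simp
    moreover have "card {?e {}, ?e {i}, ?e UNIV} \<le> card ?I"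
      using mem[of "{}"] mem[of "{i}"] mem[of UNIV] by (intro card_mono[OF fin]) blast
    ultimately show False using assms by simp
  qed
  then show ?thesis by blast
qed

text \<open>The forgetful functor to sets is represented by the free algebra on one
  generator.\<close>

lemma bij_betw_eval_gen:
  "bij_betw (\<lambda>h. h (free_gen i)) (free_hom {i} X) (free_carrier X)"
  unfolding bij_betw_def
proof
  show "inj_on (\<lambda>h. h (free_gen i)) (free_hom {i} X)"
    by (rule inj_onI) (auto intro: hom_eqI)
  show "(\<lambda>h. h (free_gen i)) ` free_hom {i} X = free_carrier X"
  proof
    show "(\<lambda>h. h (free_gen i)) ` free_hom {i} X \<subseteq> free_carrier X"
      by (auto intro: free_homD(1))
    show "free_carrier X \<subseteq> (\<lambda>h. h (free_gen i)) ` free_hom {i} X"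
      using subst_hom[of _ "{i}" X]
      by (intro subsetI image_eqI[of _ _ "restrict (subst (\<lambda>_. p)) (free_carrier {i})" for p]) simp_all
  qed
qed

text \<open>
  An automorphism of the category, seen through the injective indexing of its objects by sets of
  generators.
\<close>

locale free_automorphism =
  fixes gens :: "nat set \<Rightarrow> nat set"
    and arr :: "nat set \<Rightarrow> nat set \<Rightarrow> (('k::field, nat) free_element \<Rightarrow> ('k, nat) free_element) \<Rightarrow>
      ('k, nat) free_element \<Rightarrow> ('k, nat) free_element"
  assumes gens_finite [simp]: "finite X \<Longrightarrow> finite (gens X)"
    and gens_surj: "finite Y \<Longrightarrow> \<exists>X. finite X \<and> gens X = Y"
    and arr_bij: "finite X \<Longrightarrow> finite Y \<Longrightarrow>
      bij_betw (arr X Y) (free_hom X Y) (free_hom (gens X) (gens Y))"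
    and arr_compose: "finite X \<Longrightarrow> finite Y \<Longrightarrow> finite Z \<Longrightarrow> h \<in> free_hom X Y \<Longrightarrow> h' \<in> free_hom Y Z \<Longrightarrow>
      arr X Z (compose (free_carrier X) h' h) =
        compose (free_carrier (gens X)) (arr Y Z h') (arr X Y h)"
    and arr_id: "finite X \<Longrightarrow>
      arr X X (\<lambda>p \<in> free_carrier X. p) = (\<lambda>p \<in> free_carrier (gens X). p)"
begin

lemma arr_hom: "finite X \<Longrightarrow> finite Y \<Longrightarrow> h \<in> free_hom X Y \<Longrightarrow> arr X Y h \<in> free_hom (gens X) (gens Y)"
  by (rule bij_betw_apply[OF arr_bij])

lemma bij_betw_arr_idempotents:
  assumes X: "finite X"
  shows "bij_betw (arr X X) (idempotents X) (idempotents (gens X))"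
proof (rule bij_betw_subset[OF arr_bij[OF X X]])
  note bij = arr_bij[OF X X]
  show "idempotents X \<subseteq> free_hom X X" by (auto simp: idempotents_def)
  show "arr X X ` idempotents X = idempotents (gens X)"
  proof
    show "arr X X ` idempotents X \<subseteq> idempotents (gens X)"
    proof
      fix e :: "('k, nat) free_element \<Rightarrow> ('k, nat) free_element"
      assume "e \<in> arr X X ` idempotents X"
      then obtain d where d: "e = arr X X d" "d \<in> free_hom X X" "compose (free_carrier X) d d = d"
        by (auto simp: idempotents_def)
      then show "e \<in> idempotents (gens X)"
        using arr_compose[OF X X X d(2,2)] arr_hom[OF X X d(2)] by (simp add: idempotents_def)
    qed
    show "idempotents (gens X) \<subseteq> arr X X ` idempotents X"
    proof
      fix e :: "('k, nat) free_element \<Rightarrow> ('k, nat) free_element"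
      assume "e \<in> idempotents (gens X)"
      then have e: "e \<in> free_hom (gens X) (gens X)" "compose (free_carrier (gens X)) e e = e"
        by (auto simp: idempotents_def)
      then obtain d where d: "d \<in> free_hom X X" "e = arr X X d"
        using bij_betw_imp_surj_on[OF bij] by blast
      have "arr X X (compose (free_carrier X) d d) = arr X X d"
        using arr_compose[OF X X X d(1,1)] e d by simp
      then have "compose (free_carrier X) d d = d"
        using inj_onD[OF bij_betw_imp_inj_on[OF bij]] free_hom_compose[OF d(1,1)] d(1) by blast
      with d show "e \<in> arr X X ` idempotents X" by (simp add: idempotents_def)
    qed
  qed
qed

text \<open>The image of the algebra on \<open>{0}\<close> may be generated by a symbol other than
  0; its name is fixed here so that image arrows can be evaluated at it.\<close>

definition base_gen :: nat where
  "base_gen = (SOME y. gens {0} = {y})"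

lemma gens_base: "gens {0} = {base_gen}"
proof -
  have "card (idempotents (gens {0}) ::
      (('k, nat) free_element \<Rightarrow> ('k, nat) free_element) set) = 2"
    using bij_betw_same_card[OF bij_betw_arr_idempotents[of "{0}"]]
      card_idempotents_singleton[of "0::nat", where 'k = 'k] by simp
  then have "\<exists>y. gens {0} = {y}" by (rule singleton_if_card_idempotents)
  then show ?thesis unfolding base_gen_def by (rule someI_ex)
qed

section \<open>Transport of elements along the automorphism\<close>

definition point :: "('k, nat) free_element \<Rightarrow> ('k, nat) free_element \<Rightarrow> ('k, nat) free_element" where
  "point p = restrict (subst (\<lambda>_. p)) (free_carrier {0})"

lemma point_hom: "p \<in> free_carrier X \<Longrightarrow> point p \<in> free_hom {0} X"
  unfolding point_def by (rule subst_hom) simp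

lemma point_gen [simp]: "point p (free_gen 0) = p"
  by (simp add: point_def)

text \<open>
  An element of an algebra is an arrow from the algebra on one generator; transporting these arrows
  turns the automorphism into a natural family of bijections between the carriers.
\<close>

definition transport :: "nat set \<Rightarrow> ('k, nat) free_element \<Rightarrow> ('k, nat) free_element" where
  "transport X p = arr {0} X (point p) (free_gen base_gen)"

lemma transport_bij:
  assumes X: "finite X"
  shows "bij_betw (transport X) (free_carrier X) (free_carrier (gens X))"
proof -
  have "bij_betw point (free_carrier X) (free_hom {0} X)"
  proof (rule bij_betw_byWitness[where f' = "\<lambda>h. h (free_gen 0)"])
    show "\<forall>h \<in> free_hom {0} X. point (h (free_gen 0)) = h"
    proof
      fix h :: "('k, nat) free_element \<Rightarrow> ('k, nat) free_element"
      assume h: "h \<in> free_hom {0} X"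
      then have "h (free_gen 0) \<in> free_carrier X" by (rule free_homD(1)) simp
      then show "point (h (free_gen 0)) = h" by (intro hom_eqI[OF point_hom h]) auto
    qed
  qed (auto simp: point_hom intro: free_homD(1))
  \<comment> \<open>The three bijections lead from elements to the arrows naming them, then to the
    image arrows, then to their values at \<open>free_gen base_gen\<close>.\<close>
  from bij_betw_trans[OF bij_betw_trans[OF this arr_bij[of "{0}" X]], unfolded gens_base,
      OF _ X bij_betw_eval_gen]
  show ?thesis by (simp add: comp_def transport_def[abs_def])
qed

lemma transport_closed: "finite X \<Longrightarrow> p \<in> free_carrier X \<Longrightarrow> transport X p \<in> free_carrier (gens X)"
  by (rule bij_betw_apply[OF transport_bij])

lemma transport_inj:
  "finite X \<Longrightarrow> p \<in> free_carrier X \<Longrightarrow> q \<in> free_carrier X \<Longrightarrow> transport X p = transport X q \<Longrightarrow> p = q"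
  by (rule inj_onD[OF bij_betw_imp_inj_on[OF transport_bij]])

lemma transport_surj:
  assumes "finite X" "q \<in> free_carrier (gens X)"
  obtains p where "p \<in> free_carrier X" "transport X p = q"
proof -
  have "q \<in> transport X ` free_carrier X"
    using assms(2) by (simp only: bij_betw_imp_surj_on[OF transport_bij[OF assms(1)]])
  then show thesis using that by (elim imageE) simp
qed

lemma transport_natural:
  assumes X: "finite X" "finite Y" and h: "h \<in> free_hom X Y" and p: "p \<in> free_carrier X"
  shows "arr X Y h (transport X p) = transport Y (h p)"
proof -
  have "compose (free_carrier {0}) h (point p) = point (h p)"
    by (rule hom_eqI[OF free_hom_compose[OF point_hom[OF p] h] point_hom[OF free_homD(1)[OF h p]]])
      (simp add: compose_eq)
  then show ?thesis
    using arr_compose[of "{0}" X Y "point p" h] X h point_hom[OF p]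
    by (simp add: transport_def compose_eq gens_base)
qed

text \<open>An expression by a word, once known at the free generators, spreads to all arguments: by
  naturality the image of the arrow \<open>subst z\<close> carries it along.\<close>

lemma transport_subst_of_word:
  assumes X: "finite X" and p: "p \<in> free_carrier X" and w: "w \<in> free_carrier X"
    and pw: "transport X p = subst (\<lambda>i. transport X (free_gen i)) w"
    and Z: "finite Z" and z: "z \<in> X \<rightarrow> free_carrier Z"
  shows "transport Z (subst z p) = subst (\<lambda>i. transport Z (z i)) w"
proof -
  let ?h = "restrict (subst z) (free_carrier X)"
  note h = subst_hom[OF z]
  have gen: "(\<lambda>i. transport X (free_gen i)) \<in> X \<rightarrow> free_carrier (gens X)"
    using transport_closed[OF X] by simp
  have "transport Z (subst z p) = arr X Z ?h (transport X p)"
    using transport_natural[OF X Z h p] p by simp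
  also have "\<dots> = subst (\<lambda>i. arr X Z ?h (transport X (free_gen i))) w"
    unfolding pw by (rule hom_apply_subst[OF arr_hom[OF X Z h] gen w])
  also have "\<dots> = subst (\<lambda>i. transport Z (z i)) w"
    using transport_natural[OF X Z h] by (intro subst_cong[OF w]) simp
  finally show ?thesis .
qed

text \<open>Evaluating a word at transported elements that are free generators returns the word
  itself, so identities between words can be read off there. The set \<open>Z\<close> comes from
  surjectivity on objects; its size is not compared with that of \<open>X\<close>.\<close>

lemma transport_independent:
  assumes X: "finite X"
  obtains Z z where "finite Z" "z \<in> X \<rightarrow> free_carrier Z" "gens Z = X"
    "\<And>i. i \<in> X \<Longrightarrow> transport Z (z i) = free_gen i"
proof -
  obtain Z where Z: "finite Z" "gens Z = X" using gens_surj[OF X] by blast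
  have "\<forall>i \<in> X. \<exists>z. z \<in> free_carrier Z \<and> transport Z z = free_gen i"
  proof
    fix i assume "i \<in> X"
    then have "free_gen i \<in> free_carrier (gens Z)" using Z(2) by simp
    then show "\<exists>z. z \<in> free_carrier Z \<and> transport Z z = free_gen i"
      using transport_surj[OF Z(1)] by metis
  qed
  from bchoice[OF this] obtain z
    where "\<forall>i \<in> X. z i \<in> free_carrier Z \<and> transport Z (z i) = free_gen i" by blast
  with Z show thesis using that[of Z z] by auto
qed

text \<open>The transported generators are not known to generate \<open>gens X\<close>, so the word
  cannot be found by expanding in them. Instead a homomorphism \<open>g\<close> is built that sends
  each transported generator back to the corresponding generator, and the word is the value of
  \<open>g\<close> at \<open>transport X p\<close>.\<close>

lemma word_of_transport:
  assumes X: "finite X" and p: "p \<in> free_carrier X"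
  shows "\<exists>w \<in> free_carrier X. transport X p = subst (\<lambda>i. transport X (free_gen i)) w"
proof -
  obtain Z z where Z: "finite Z" "gens Z = X"
    and z: "z \<in> X \<rightarrow> free_carrier Z" "\<And>i. i \<in> X \<Longrightarrow> transport Z (z i) = free_gen i"
    using transport_independent[OF X] by metis
  define g where "g = arr X Z (restrict (subst z) (free_carrier X))"
  have g: "g \<in> free_hom (gens X) X"
    using arr_hom[OF X Z(1) subst_hom[OF z(1)]] Z(2) by (simp add: g_def)
  have g_gen: "g (transport X (free_gen i)) = free_gen i" if "i \<in> X" for i
    using transport_natural[OF X Z(1) subst_hom[OF z(1)], of "free_gen i"] that z(2)
    by (simp add: g_def)
  have gen: "(\<lambda>i. transport X (free_gen i)) \<in> X \<rightarrow> free_carrier (gens X)"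
    using transport_closed[OF X] by simp
  let ?\<beta> = "restrict (subst (\<lambda>i. transport X (free_gen i))) (free_carrier X)"
  have \<beta>: "?\<beta> \<in> free_hom X (gens X)" by (rule subst_hom[OF gen])
  \<comment> \<open>This endomorphism fixes the transported generators. By surjectivity on arrows it
    is the image of some \<open>h\<close>, which then fixes the generators themselves; so
    \<open>h\<close>, and with it \<open>?e\<close>, is the identity. Hence \<open>?\<beta>\<close>
    recovers \<open>transport X p\<close> from the word.\<close>
  let ?e = "compose (free_carrier (gens X)) ?\<beta> g"
  have e: "?e \<in> free_hom (gens X) (gens X)" by (rule free_hom_compose[OF g \<beta>])
  then obtain h where h: "h \<in> free_hom X X" "?e = arr X X h"
    using bij_betw_imp_surj_on[OF arr_bij[OF X X]] by blast
  have "h (free_gen i) = free_gen i" if i: "i \<in> X" for i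
  proof -
    have "transport X (h (free_gen i)) = ?e (transport X (free_gen i))"
      unfolding h(2) using transport_natural[OF X X h(1), of "free_gen i"] i by simp
    also have "\<dots> = transport X (free_gen i)"
      using transport_closed[OF X, of "free_gen i"] g_gen[OF i] i by (simp add: compose_eq)
    finally show ?thesis
      using transport_inj[OF X] free_homD(1)[OF h(1)] i by simp
  qed
  then have "h = (\<lambda>p \<in> free_carrier X. p)"
    by (intro hom_eqI[OF h(1) free_hom_id]) simp
  then have "?e = (\<lambda>p \<in> free_carrier (gens X). p)" using h(2) arr_id[OF X] by simp
  then have "?e (transport X p) = transport X p"
    using transport_closed[OF X p] by simp
  then have "subst (\<lambda>i. transport X (free_gen i)) (g (transport X p)) = transport X p"
    using transport_closed[OF X p] free_homD(1)[OF g] by (simp add: compose_eq)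
  then show ?thesis using free_homD(1)[OF g transport_closed[OF X p]] by metis
qed

lemma transport_word:
  assumes "finite X" "p \<in> free_carrier X"
  obtains w where "w \<in> free_carrier X" "\<And>Z z. finite Z \<Longrightarrow> z \<in> X \<rightarrow> free_carrier Z \<Longrightarrow>
    transport Z (subst z p) = subst (\<lambda>i. transport Z (z i)) w"
  using word_of_transport[OF assms] transport_subst_of_word[OF assms] by metis

text \<open>The reverse passage, through surjectivity of \<open>transport X\<close>: it is what
  makes every scalar a value of \<open>coeff_map\<close>.\<close>

lemma word_transport:
  assumes X: "finite X" and w: "w \<in> free_carrier X"
  obtains p where "p \<in> free_carrier X" "\<And>Z z. finite Z \<Longrightarrow> z \<in> X \<rightarrow> free_carrier Z \<Longrightarrow>
    transport Z (subst z p) = subst (\<lambda>i. transport Z (z i)) w"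
proof -
  have "subst (\<lambda>i. transport X (free_gen i)) w \<in> free_carrier (gens X)"
    using transport_closed[OF X] by (intro subst_closed[OF w]) simp
  then obtain p where "p \<in> free_carrier X" "transport X p = subst (\<lambda>i. transport X (free_gen i)) w"
    using transport_surj[OF X] by blast
  then show thesis using that transport_subst_of_word[OF X _ w] by blast
qed

end


section \<open>Transport of the operations\<close>

lemma words_of_len_1:
  assumes "len u = 1" obtains i where "u = Letter i"
proof (cases u)
  case (Juxt a b)
  with assms len_pos[of a] len_pos[of b] show thesis by simp
qed (rule that)

text \<open>The length is the sum of the degrees in the two letters, so the word has length 2 and
  each letter occurs once.\<close>

lemma words_of_bidegree_1_1:
  assumes "letters u \<subseteq> {i, j}" "i \<noteq> j"
    and "weight (\<lambda>l. if l = i then 1 else 0) u = 1" "weight (\<lambda>l. if l = j then 1 else 0) u = 1"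
  shows "u = Juxt (Letter i) (Letter j) \<or> u = Juxt (Letter j) (Letter i)"
proof -
  have len: "letters u \<subseteq> {i, j} \<Longrightarrow>
      len u = weight (\<lambda>l. if l = i then 1 else 0) u + weight (\<lambda>l. if l = j then 1 else 0) u" for u
  proof (induction u)
    case (Letter l)
    with assms(2) show ?case by (cases "l = i") simp_all
  next
    case (Juxt a b)
    then have "letters a \<subseteq> {i, j}" "letters b \<subseteq> {i, j}" by simp_all
    from Juxt.IH(1)[OF this(1)] Juxt.IH(2)[OF this(2)] show ?case
      by (simp only: weight.simps add_ac)
  qed
  show ?thesis
  proof (cases u)
    case (Letter l)
    have "l = i" "l = j" using assms(3,4) unfolding Letter weight.simps by (metis zero_neq_one)+
    with assms(2) show ?thesis by simp
  next
    case (Juxt a b)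
    then have "len a + len b = 2" using len[OF assms(1)] assms(3,4) by simp
    then have "len a = 1" "len b = 1" using len_pos[of a] len_pos[of b] by simp_all
    then obtain l m where u: "u = Juxt (Letter l) (Letter m)"
      using Juxt words_of_len_1 by metis
    have "l = i \<or> m = i" "l = j \<or> m = j"
      using assms(3,4) unfolding u weight.simps by (metis add_0 zero_neq_one)+
    with assms(2) show ?thesis unfolding u by metis
  qed
qed

lemma subst_two_words:
  assumes "\<And>u. Poly_Mapping.lookup w u \<noteq> 0 \<Longrightarrow> u = v \<or> u = v'" "v \<noteq> v'"
  shows "subst f w = free_smult (Poly_Mapping.lookup w v) (free_word f v) +
    free_smult (Poly_Mapping.lookup w v') (free_word f v')"
proof -
  have "w = Poly_Mapping.single v (Poly_Mapping.lookup w v) +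
      Poly_Mapping.single v' (Poly_Mapping.lookup w v')"
    using assms by (intro poly_mapping_eqI) (auto simp: lookup_add lookup_single when_def)
  then have "subst f w = subst f (Poly_Mapping.single v (Poly_Mapping.lookup w v) +
      Poly_Mapping.single v' (Poly_Mapping.lookup w v'))" by simp
  then show ?thesis by simp
qed

context free_automorphism
begin

text \<open>The zero element is also the zero word in one letter, so its transport is
  \<open>w\<close> evaluated at any transported element whatever. Evaluating at the element
  transported to 0 gives \<open>transport Y 0 = 0\<close>; evaluating at one transported to a free
  generator gives \<open>w\<close> itself. Hence \<open>w = 0\<close>.\<close>

lemma transport_zero:
  assumes Z: "finite Z"
  shows "transport Z 0 = 0"
proof -
  have fin: "finite {0 :: nat}" by simp
  obtain w where w: "w \<in> free_carrier {0}" "\<And>Z z. finite Z \<Longrightarrow> z \<in> {0} \<rightarrow> free_carrier Z \<Longrightarrow>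
      transport Z (subst z 0) = subst (\<lambda>i. transport Z (z i)) w"
    using transport_word[OF fin free_carrier_zero] by metis
  have w': "transport Z 0 = subst (\<lambda>_. transport Z q) w" if "finite Z" "q \<in> free_carrier Z" for Z q
    using w(2)[of Z "\<lambda>_. q"] that by simp
  obtain Y z where Y: "finite Y" "z \<in> {0} \<rightarrow> free_carrier Y" "gens Y = {0}"
      "\<And>i. i \<in> {0} \<Longrightarrow> transport Y (z i) = free_gen i"
    using transport_independent[OF fin] by metis
  obtain q where q: "q \<in> free_carrier Y" "transport Y q = 0"
    using transport_surj[OF Y(1) free_carrier_zero] by metis
  have "transport Y 0 = 0"
    using w'[OF Y(1) q(1)] q(2) by (simp add: subst_const_zero)
  then have "0 = subst (\<lambda>_. free_gen 0) w"
    using w'[OF Y(1), of "z 0"] Y by auto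
  also have "\<dots> = w"
    using subst_cong[OF w(1), of "\<lambda>_. free_gen 0" free_gen] by (simp add: subst_gen)
  finally have "w = 0" by simp
  then show ?thesis using w'[OF Z free_carrier_zero] by simp
qed

text \<open>For a unit, the transported word in one letter has an inverse under composition, so it is linear.\<close>

lemma transport_smult_exists:
  "\<exists>d. \<forall>Z p. finite Z \<longrightarrow> p \<in> free_carrier Z \<longrightarrow> transport Z (free_smult c p) = free_smult d (transport Z p)"
proof (cases "c = 0")
  case True
  then show ?thesis by (intro exI[of _ 0]) (simp add: transport_zero)
next
  case False
  have fin: "finite {0 :: nat}" by simp
  have word: "\<exists>w \<in> free_carrier {0}. \<forall>Z p. finite Z \<longrightarrow> p \<in> free_carrier Z \<longrightarrow>
      transport Z (free_smult c p) = subst (\<lambda>_. transport Z p) w" for c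
  proof -
    obtain w where w: "w \<in> free_carrier {0}" "\<And>Z z. finite Z \<Longrightarrow> z \<in> {0} \<rightarrow> free_carrier Z \<Longrightarrow>
        transport Z (subst z (Poly_Mapping.single (Letter 0) c)) = subst (\<lambda>i. transport Z (z i)) w"
      using transport_word[OF fin, of "Poly_Mapping.single (Letter 0) c"] by (metis free_single_carrier nonassoc_word.set(1) order_refl)
    show ?thesis
      using w(1) w(2)[of _ "\<lambda>_. p" for p] by (intro bexI[of _ w]) auto
  qed
  obtain w w' where w: "w \<in> free_carrier {0}" "\<And>Z p. finite Z \<Longrightarrow> p \<in> free_carrier Z \<Longrightarrow>
      transport Z (free_smult c p) = subst (\<lambda>_. transport Z p) w"
    and w': "w' \<in> free_carrier {0}" "\<And>Z p. finite Z \<Longrightarrow> p \<in> free_carrier Z \<Longrightarrow>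
      transport Z (free_smult (1 / c) p) = subst (\<lambda>_. transport Z p) w'"
    using word[of c] word[of "1 / c"] by metis
  obtain Y z where Y: "finite Y" "z \<in> {0} \<rightarrow> free_carrier Y" "gens Y = {0}"
      "\<And>i. i \<in> {0} \<Longrightarrow> transport Y (z i) = free_gen i"
    using transport_independent[OF fin] by metis
  have z: "z 0 \<in> free_carrier Y" "transport Y (z 0) = free_gen 0" using Y by auto
  have "subst (\<lambda>_. transport Y (free_smult (1 / c) (z 0))) w = free_gen 0"
    using w(2)[OF Y(1), of "free_smult (1 / c) (z 0)"] z False by simp
  then obtain d where "w = Poly_Mapping.single (Letter 0) d"
    using linear_if_left_invertible[OF w(1), of 1] by auto
  then show ?thesis using w(2) by auto
qed

definition coeff_map :: "'k \<Rightarrow> 'k" where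
  "coeff_map c = (SOME d. \<forall>Z p. finite Z \<longrightarrow> p \<in> free_carrier Z \<longrightarrow>
     transport Z (free_smult c p) = free_smult d (transport Z p))"

lemma transport_smult: "finite Z \<Longrightarrow> p \<in> free_carrier Z \<Longrightarrow>
    transport Z (free_smult c p) = free_smult (coeff_map c) (transport Z p)"
  using someI_ex[OF transport_smult_exists[of c]] unfolding coeff_map_def by blast

lemma transport_base_point:
  obtains Y z where "finite Y" "z \<in> free_carrier Y" "transport Y z = free_gen 0"
proof -
  have "finite {0 :: nat}" by simp
  then obtain Y z where Y: "finite Y" "z \<in> {0} \<rightarrow> free_carrier Y" "gens Y = {0}"
      "\<And>i. i \<in> {0} \<Longrightarrow> transport Y (z i) = free_gen i"
    using transport_independent by metis
  then show thesis using that[of Y "z 0"] by auto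
qed

text \<open>At an element transported to a free generator the scalar is a visible coefficient, so
  the choice made in \<open>coeff_map\<close> is unique.\<close>

lemma coeff_map_eqI:
  assumes "\<And>Z p. finite Z \<Longrightarrow> p \<in> free_carrier Z \<Longrightarrow>
    transport Z (free_smult c p) = free_smult d (transport Z p)"
  shows "coeff_map c = d"
proof -
  obtain Y z where Y: "finite Y" "z \<in> free_carrier Y" "transport Y z = free_gen 0"
    by (rule transport_base_point)
  then show ?thesis using assms[OF Y(1,2)] transport_smult[OF Y(1,2), of c]
    by (simp add: single_Letter_eq_iff)
qed

lemma coeff_map_one: "coeff_map 1 = 1"
  by (rule coeff_map_eqI) simp

lemma coeff_map_mult: "coeff_map (c * d) = coeff_map c * coeff_map d"
proof (rule coeff_map_eqI)
  fix Z and p :: "('k, nat) free_element" assume "finite Z" "p \<in> free_carrier Z"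
  then show "transport Z (free_smult (c * d) p) = free_smult (coeff_map c * coeff_map d) (transport Z p)"
    using transport_smult[of Z "free_smult d p" c] transport_smult[of Z p d] by simp
qed

lemma coeff_map_inj: "inj coeff_map"
proof (rule injI)
  fix c d assume eq: "coeff_map c = coeff_map d"
  obtain Y z where Y: "finite Y" "z \<in> free_carrier Y" "transport Y z = free_gen 0"
    by (rule transport_base_point)
  have "transport Y (free_smult c z) = transport Y (free_smult d z)"
    using Y eq by (simp add: transport_smult)
  then have eq': "free_smult c z = free_smult d z"
    by (rule transport_inj[OF Y(1) free_carrier_smult[OF Y(2)] free_carrier_smult[OF Y(2)]])
  have "z \<noteq> 0"
  proof
    assume "z = 0"
    with Y(3) transport_zero[OF Y(1)] show False by simp
  qed
  obtain u where u: "Poly_Mapping.lookup z u \<noteq> 0"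
    using top_word_exists[OF \<open>z \<noteq> 0\<close>] by blast
  have "c * Poly_Mapping.lookup z u = d * Poly_Mapping.lookup z u"
    unfolding lookup_smult[symmetric] eq' by (rule refl)
  with u show "c = d" by simp
qed

text \<open>The degree argument runs backwards: the linear words with coefficients
  \<open>\<nu>\<close> and \<open>1 / \<nu>\<close> come from elements \<open>p\<close> and
  \<open>p'\<close> that compose to the generator, so \<open>p\<close> is linear too and its
  coefficient is a preimage of \<open>\<nu>\<close>. Zero has no such inverse and is treated
  apart.\<close>

lemma coeff_map_surj: "surj coeff_map"
proof -
  have "\<exists>c. coeff_map c = \<nu>" for \<nu>
  proof (cases "\<nu> = 0")
    case True
    have "coeff_map 0 = 0" by (rule coeff_map_eqI) (simp add: transport_zero)
    with True show ?thesis by blast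
  next
    case False
    have fin: "finite {0 :: nat}" by simp
    have word: "\<exists>p \<in> free_carrier {0}. \<forall>Z q. finite Z \<longrightarrow> q \<in> free_carrier Z \<longrightarrow>
        transport Z (subst (\<lambda>_. q) p) = free_smult \<nu> (transport Z q)" for \<nu>
    proof -
      obtain p where p: "p \<in> free_carrier {0}" "\<And>Z z. finite Z \<Longrightarrow> z \<in> {0} \<rightarrow> free_carrier Z \<Longrightarrow>
          transport Z (subst z p) = subst (\<lambda>i. transport Z (z i)) (Poly_Mapping.single (Letter 0) \<nu>)"
        using word_transport[OF fin, of "Poly_Mapping.single (Letter 0) \<nu>"] by (metis free_single_carrier nonassoc_word.set(1) order_refl)
      show ?thesis
        using p(1) p(2)[of _ "\<lambda>_. q" for q] by (intro bexI[of _ p]) auto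
    qed
    obtain p p' where p: "p \<in> free_carrier {0}" "\<And>Z q. finite Z \<Longrightarrow> q \<in> free_carrier Z \<Longrightarrow>
        transport Z (subst (\<lambda>_. q) p) = free_smult \<nu> (transport Z q)"
      and p': "p' \<in> free_carrier {0}" "\<And>Z q. finite Z \<Longrightarrow> q \<in> free_carrier Z \<Longrightarrow>
        transport Z (subst (\<lambda>_. q) p') = free_smult (1 / \<nu>) (transport Z q)"
      using word[of \<nu>] word[of "1 / \<nu>"] by metis
    have p'_eq: "subst (\<lambda>_. free_gen 0) p' = p'"
      using subst_cong[OF p'(1), of "\<lambda>_. free_gen 0" free_gen] by (simp add: subst_gen)
    have "transport {0} (subst (\<lambda>_. p') p) = transport {0} (free_gen 0)"
      using p(2)[OF fin p'(1)] p'(2)[OF fin, of "free_gen 0"] False by (simp add: p'_eq)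
    then have "subst (\<lambda>_. p') p = free_gen 0"
      by (rule transport_inj[OF fin subst_closed[OF p(1)], rotated 2]) (simp_all add: p'(1))
    then obtain d where "p = Poly_Mapping.single (Letter 0) d"
      using linear_if_left_invertible[OF p(1), of 1] by auto
    then have "coeff_map d = \<nu>" using p(2) by (intro coeff_map_eqI) simp
    then show ?thesis by blast
  qed
  then show ?thesis by (metis surjI)
qed

lemma coeff_map_zero: "coeff_map 0 = 0"
  by (rule coeff_map_eqI) (simp add: transport_zero)

lemma transport_binary_word:
  assumes "p \<in> free_carrier {0, 1}"
  obtains w where "w \<in> free_carrier {0, 1}"
    "\<And>Z z. finite Z \<Longrightarrow> z 0 \<in> free_carrier Z \<Longrightarrow> z 1 \<in> free_carrier Z \<Longrightarrow>
      transport Z (subst z p) = subst (\<lambda>i. transport Z (z i)) w"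
proof -
  have fin: "finite {0 :: nat, 1}" by simp
  obtain w where "w \<in> free_carrier {0, 1}"
    "\<And>Z z. finite Z \<Longrightarrow> z \<in> {0, 1} \<rightarrow> free_carrier Z \<Longrightarrow>
      transport Z (subst z p) = subst (\<lambda>i. transport Z (z i)) w"
    using transport_word[OF fin assms] by metis
  then show thesis by (intro that[of w]) auto
qed

lemma transport_independent_pair:
  obtains Z and z :: "nat \<Rightarrow> ('k, nat) free_element" where "finite Z" "z 0 \<in> free_carrier Z" "z 1 \<in> free_carrier Z"
    "transport Z (z 0) = free_gen 0" "transport Z (z 1) = free_gen 1"
proof -
  have "finite {0 :: nat, 1}" by simp
  then obtain Z z where "finite Z" "z \<in> {0, 1} \<rightarrow> free_carrier Z" "gens Z = {0, 1}"
    "\<And>i. i \<in> {0, 1} \<Longrightarrow> transport Z (z i) = free_gen i"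
    using transport_independent by metis
  then show thesis using that[of Z z] by (simp add: Pi_iff)
qed

text \<open>Homogeneity of degree 1 passes from \<open>p\<close> to \<open>w\<close>. Scaling the
  letters by powers of \<open>c\<close> becomes scaling by the same powers of
  \<open>coeff_map c\<close>, and every \<open>\<nu>\<close> is such a value. Multiplicativity and
  surjectivity of \<open>coeff_map\<close> suffice; its additivity is derived only later, from the
  sum.\<close>

lemma weight_of_transported:
  assumes inf: "infinite (UNIV :: 'k set)"
    and w: "w \<in> free_carrier {0, 1}"
      "\<And>Z z. finite Z \<Longrightarrow> z 0 \<in> free_carrier Z \<Longrightarrow> z 1 \<in> free_carrier Z \<Longrightarrow>
        transport Z (subst z p) = subst (\<lambda>i. transport Z (z i)) w"
    and p: "p \<in> free_carrier {0, 1}"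
    and hom: "\<And>c z. subst (\<lambda>i. free_smult (c ^ f i) (z i)) p = free_smult c (subst z p)"
    and u: "Poly_Mapping.lookup w u \<noteq> 0"
  shows "weight f u = 1"
proof (rule weight_1_if_homogeneous[OF inf _ u])
  fix \<nu> :: 'k
  obtain c where c: "coeff_map c = \<nu>" using coeff_map_surj by (metis surjD)
  have pow: "coeff_map (c ^ n) = \<nu> ^ n" for n
    using c by (induction n) (simp_all add: coeff_map_one coeff_map_mult)
  obtain Z and z :: "nat \<Rightarrow> ('k, nat) free_element" where Z: "finite Z" "z 0 \<in> free_carrier Z" "z 1 \<in> free_carrier Z"
    "transport Z (z 0) = free_gen 0" "transport Z (z 1) = free_gen 1"
    by (rule transport_independent_pair)
  \<comment> \<open>The transports of \<open>z 0\<close> and \<open>z 1\<close> are free generators,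
    so those of \<open>?z\<close> are the generators scaled by powers of
    \<open>\<nu>\<close>.\<close>
  let ?z = "\<lambda>i. free_smult (c ^ f i) (z i)"
  have 1: "subst (\<lambda>i. transport Z (?z i)) w = subst (\<lambda>i. Poly_Mapping.single (Letter i) (\<nu> ^ f i)) w"
    using Z by (intro subst_cong[OF w(1)]) (auto simp: transport_smult pow)
  have 2: "subst (\<lambda>i. transport Z (z i)) w = subst free_gen w"
    using Z by (intro subst_cong[OF w(1)]) auto
  have "subst z p \<in> free_carrier Z" using Z by (intro subst_closed[OF p]) auto
  then have "transport Z (subst ?z p) = free_smult \<nu> (transport Z (subst z p))"
    using Z(1) unfolding hom by (simp add: transport_smult c)
  then show "subst (\<lambda>i. Poly_Mapping.single (Letter i) (\<nu> ^ f i)) w = free_smult \<nu> w"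
    using w(2)[of Z ?z] w(2)[of Z z] Z unfolding 1 2 by (simp add: subst_gen)
qed

text \<open>The sum of two letters is homogeneous in total degree only, so constant weight is used;
  it leaves a linear combination of the two letters.\<close>

lemma transport_add:
  assumes inf: "infinite (UNIV :: 'k set)"
    and Z: "finite Z" "p \<in> free_carrier Z" "q \<in> free_carrier Z"
  shows "transport Z (p + q) = transport Z p + transport Z q"
proof -
  let ?p = "free_gen 0 + free_gen 1 :: ('k, nat) free_element"
  have p: "?p \<in> free_carrier {0, 1}" by simp
  obtain w where w: "w \<in> free_carrier {0, 1}"
      "\<And>Z z. finite Z \<Longrightarrow> z 0 \<in> free_carrier Z \<Longrightarrow> z 1 \<in> free_carrier Z \<Longrightarrow>
        transport Z (subst z ?p) = subst (\<lambda>i. transport Z (z i)) w"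
    using transport_binary_word[OF p] by metis
  have "weight (\<lambda>_. 1) u = 1" if "Poly_Mapping.lookup w u \<noteq> 0" for u
    by (rule weight_of_transported[OF inf w p _ that]) (simp_all add: free_smult_add)
  then have "u = Letter 0 \<or> u = Letter 1" if "Poly_Mapping.lookup w u \<noteq> 0" for u
    using words_of_len_1 that w(1) unfolding free_carrier_iff
    by (metis empty_iff insert_iff insert_subset nonassoc_word.set(1))
  then have two: "subst f w = free_smult (Poly_Mapping.lookup w (Letter 0)) (f 0) +
      free_smult (Poly_Mapping.lookup w (Letter 1)) (f 1)" for f
    using subst_two_words[of w "Letter 0" "Letter 1" f] by simp
  define \<alpha> \<beta> where "\<alpha> = Poly_Mapping.lookup w (Letter 0)" and "\<beta> = Poly_Mapping.lookup w (Letter 1)"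
  have sum: "transport Z (p + q) = free_smult \<alpha> (transport Z p) + free_smult \<beta> (transport Z q)"
    if "finite Z" "p \<in> free_carrier Z" "q \<in> free_carrier Z" for Z p q
    using w(2)[of Z "\<lambda>i. if i = 0 then p else q"] that by (simp add: two \<alpha>_def \<beta>_def)
  obtain Y z where Y: "finite Y" "z \<in> free_carrier Y" "transport Y z = free_gen 0"
    by (rule transport_base_point)
  \<comment> \<open>Putting 0 for one summand isolates the coefficient of the other.\<close>
  have "\<alpha> = 1" "\<beta> = 1"
    using sum[of Y z 0] sum[of Y 0 z] Y transport_zero[OF Y(1)] by (simp_all add: single_Letter_eq_iff)
  with sum Z show ?thesis by simp
qed

lemma coeff_map_add:
  assumes inf: "infinite (UNIV :: 'k set)"
  shows "coeff_map (c + d) = coeff_map c + coeff_map d"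
  by (rule coeff_map_eqI) (simp add: free_smult_add_left transport_add[OF inf] transport_smult)

lemma coeff_map_field_automorphism:
  "infinite (UNIV :: 'k set) \<Longrightarrow> coeff_map \<in> carrier field_automorphism_group"
  by (simp add: field_automorphism_group_def bij_def coeff_map_inj coeff_map_surj coeff_map_one
      coeff_map_add coeff_map_mult)

text \<open>The product of two letters has degree 1 in each of them, and only two words have this
  bidegree. The inequality expresses that transport is injective on the span of these two
  words.\<close>

lemma transport_mult:
  assumes inf: "infinite (UNIV :: 'k set)"
  obtains a b where "a * a \<noteq> b * b"
    "\<And>Z p q. finite Z \<Longrightarrow> p \<in> free_carrier Z \<Longrightarrow> q \<in> free_carrier Z \<Longrightarrow>
      transport Z (free_mult p q) = free_smult a (free_mult (transport Z p) (transport Z q)) +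
        free_smult b (free_mult (transport Z q) (transport Z p))"
proof -
  let ?p = "free_mult (free_gen 0) (free_gen 1) :: ('k, nat) free_element"
  have p: "?p \<in> free_carrier {0, 1}" by simp
  obtain w where w: "w \<in> free_carrier {0, 1}"
      "\<And>Z z. finite Z \<Longrightarrow> z 0 \<in> free_carrier Z \<Longrightarrow> z 1 \<in> free_carrier Z \<Longrightarrow>
        transport Z (subst z ?p) = subst (\<lambda>i. transport Z (z i)) w"
    using transport_binary_word[OF p] by metis
  have "weight (\<lambda>l. if l = i then 1 else 0) u = 1"
    if "i \<in> {0, 1}" "Poly_Mapping.lookup w u \<noteq> 0" for i u
    by (rule weight_of_transported[OF inf w p _ that(2)]) (use that(1) in auto)
  then have "u = Juxt (Letter 0) (Letter 1) \<or> u = Juxt (Letter 1) (Letter 0)"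
    if "Poly_Mapping.lookup w u \<noteq> 0" for u
    using that w(1) by (intro words_of_bidegree_1_1) (auto simp: free_carrier_iff)
  then have two: "subst f w =
      free_smult (Poly_Mapping.lookup w (Juxt (Letter 0) (Letter 1))) (free_mult (f 0) (f 1)) +
      free_smult (Poly_Mapping.lookup w (Juxt (Letter 1) (Letter 0))) (free_mult (f 1) (f 0))" for f
    using subst_two_words[of w "Juxt (Letter 0) (Letter 1)" "Juxt (Letter 1) (Letter 0)" f] by simp
  define a b where "a = Poly_Mapping.lookup w (Juxt (Letter 0) (Letter 1))"
    and "b = Poly_Mapping.lookup w (Juxt (Letter 1) (Letter 0))"
  have mult: "transport Z (free_mult p q) = free_smult a (free_mult (transport Z p) (transport Z q)) +
        free_smult b (free_mult (transport Z q) (transport Z p))"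
    if "finite Z" "p \<in> free_carrier Z" "q \<in> free_carrier Z" for Z p q
    using w(2)[of Z "\<lambda>i. if i = 0 then p else q"] that by (simp add: two a_def b_def)
  have "a * a \<noteq> b * b"
  proof
    assume eq: "a * a = b * b"
    \<comment> \<open>The combination with coefficients \<open>- b\<close> and \<open>a\<close>
      cancels one word identically and leaves \<open>a * a - b * b\<close> on the other. So
      \<open>?r\<close> transports to 0 and must vanish, which forces \<open>a\<close> and
      \<open>b\<close> to be 0 and sends the product of the letters to 0.\<close>
    obtain c d where cd: "coeff_map c = - b" "coeff_map d = a"
      using coeff_map_surj by (metis surjD)
    let ?Z = "{0, 1} :: nat set"
    let ?x = "free_gen 0 :: ('k, nat) free_element" and ?y = "free_gen 1 :: ('k, nat) free_element"
    let ?r = "free_smult c (free_mult ?x ?y) + free_smult d (free_mult ?y ?x)"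
    let ?s = "transport {0, 1}"
    have "?s ?r = free_smult (- b) (?s (free_mult ?x ?y)) + free_smult a (?s (free_mult ?y ?x))"
      by (simp add: transport_add[OF inf] transport_smult cd flip: mult_single smult_single)
    also have "\<dots> = 0"
      using mult[of ?Z ?x ?y] mult[of ?Z ?y ?x] eq
      by (intro poly_mapping_eqI) (simp add: lookup_add lookup_smult algebra_simps)
    finally have "?s ?r = ?s 0" using transport_zero[of ?Z] by simp
    then have "?r = 0" by (rule transport_inj[of ?Z, rotated 3]) simp_all
    then have "Poly_Mapping.lookup ?r (Juxt (Letter 0) (Letter 1)) = 0"
      "Poly_Mapping.lookup ?r (Juxt (Letter 1) (Letter 0)) = 0" by simp_all
    then have "c = 0" "d = 0" by (simp_all add: lookup_add lookup_single when_def)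
    then have "a = 0" "b = 0" using cd coeff_map_zero by simp_all
    then have "?s (free_mult ?x ?y) = ?s 0" using mult[of ?Z ?x ?y] transport_zero[of ?Z] by simp
    then have "free_mult ?x ?y = (0 :: ('k, nat) free_element)"
      by (rule transport_inj[of ?Z, rotated 3]) simp_all
    then show False by simp
  qed
  with mult show thesis using that by blast
qed

end


section \<open>The twist of an automorphism\<close>

interpretation free_cat: category free_algebra_category
  by (rule category_free_algebra_category)

interpretation free_aut: group "Aut_group free_algebra_category"
  by (rule free_cat.group_Aut)

type_synonym 'k free_functor =
  "(('k, ('k, nat) free_element) module \<Rightarrow> ('k, ('k, nat) free_element) module) \<times>
   (('k, ('k, nat) free_element) module \<times> (('k, nat) free_element \<Rightarrow> ('k, nat) free_element) \<times>
      ('k, ('k, nat) free_element) module \<Rightarrow>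
    ('k, ('k, nat) free_element) module \<times> (('k, nat) free_element \<Rightarrow> ('k, nat) free_element) \<times>
      ('k, ('k, nat) free_element) module)"

section \<open>Functors re-indexed by sets of generators\<close>

lemma free_Ob: "A \<in> Ob free_algebra_category \<longleftrightarrow> (\<exists>X. finite X \<and> A = free_linear_algebra X)"
  by (auto simp: free_algebra_category_def linear_algebra_category_def)

lemma free_ObI: "finite X \<Longrightarrow> free_linear_algebra X \<in> Ob free_algebra_category"
  by (auto simp: free_Ob)

lemma free_Hom:
  assumes "finite X" "finite Y"
  shows "f \<in> Hom free_algebra_category (free_linear_algebra X) (free_linear_algebra Y) \<longleftrightarrow>
    (\<exists>h \<in> free_hom X Y. f = (free_linear_algebra X, h, free_linear_algebra Y))"
  using assms by (auto simp: Hom_def free_algebra_category_def linear_algebra_category_def)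

lemma free_Mor: "f \<in> Mor free_algebra_category \<longleftrightarrow>
    (\<exists>X Y. finite X \<and> finite Y \<and> (\<exists>h \<in> free_hom X Y. f = (free_linear_algebra X, h, free_linear_algebra Y)))"
  by (auto simp: free_algebra_category_def linear_algebra_category_def)

lemma free_Comp: "Comp free_algebra_category (B, g, D) (A, f, B') = (A, compose (carrier A) g f, D)"
  by (simp add: free_algebra_category_def linear_algebra_category_def)

lemma free_Ident: "Ident free_algebra_category A = (A, \<lambda>p \<in> carrier A. p, A)"
  by (simp add: free_algebra_category_def linear_algebra_category_def)

definition gens_of :: "'k::field free_functor \<Rightarrow> nat set \<Rightarrow> nat set" where
  "gens_of F X = the_inv free_linear_algebra (fst F (free_linear_algebra X))"

definition arr_of :: "'k::field free_functor \<Rightarrow> nat set \<Rightarrow> nat set \<Rightarrow>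
    (('k, nat) free_element \<Rightarrow> ('k, nat) free_element) \<Rightarrow> ('k, nat) free_element \<Rightarrow> ('k, nat) free_element" where
  "arr_of F X Y h = fst (snd (snd F (free_linear_algebra X, h, free_linear_algebra Y)))"

context
  fixes F :: "'k::field free_functor"
  assumes F: "F \<in> endofunctors free_algebra_category"
begin

lemma functor_object:
  assumes "finite X"
  shows "fst F (free_linear_algebra X) = free_linear_algebra (gens_of F X)" "finite (gens_of F X)"
proof -
  have "fst F (free_linear_algebra X) \<in> Ob free_algebra_category"
    by (rule free_cat.endofunctorD(3)[OF F free_ObI[OF assms]])
  then obtain Y where "finite Y" "fst F (free_linear_algebra X) = free_linear_algebra Y"
    by (auto simp: free_Ob)
  then show "fst F (free_linear_algebra X) = free_linear_algebra (gens_of F X)" "finite (gens_of F X)"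
    by (simp_all add: gens_of_def the_inv_f_f[OF inj_free_linear_algebra])
qed

lemma functor_arrow:
  assumes "finite X" "finite Y" "h \<in> free_hom X Y"
  shows "snd F (free_linear_algebra X, h, free_linear_algebra Y) =
      (free_linear_algebra (gens_of F X), arr_of F X Y h, free_linear_algebra (gens_of F Y))"
    and "arr_of F X Y h \<in> free_hom (gens_of F X) (gens_of F Y)"
proof -
  let ?f = "(free_linear_algebra X, h, free_linear_algebra Y)"
  have "?f \<in> Hom free_algebra_category (free_linear_algebra X) (free_linear_algebra Y)"
    using assms by (simp add: free_Hom)
  from free_cat.endofunctorD(4)[OF F this]
  have "snd F ?f \<in> Hom free_algebra_category (free_linear_algebra (gens_of F X))
      (free_linear_algebra (gens_of F Y))"
    by (simp only: functor_object assms)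
  then obtain h' where "h' \<in> free_hom (gens_of F X) (gens_of F Y)"
    "snd F ?f = (free_linear_algebra (gens_of F X), h', free_linear_algebra (gens_of F Y))"
    using free_Hom[OF functor_object(2)[OF assms(1)] functor_object(2)[OF assms(2)]] by blast
  then show "snd F ?f =
      (free_linear_algebra (gens_of F X), arr_of F X Y h, free_linear_algebra (gens_of F Y))"
    "arr_of F X Y h \<in> free_hom (gens_of F X) (gens_of F Y)"
    by (simp_all add: arr_of_def)
qed

lemma arr_of_compose:
  assumes "finite X" "finite Y" "finite Z" "h \<in> free_hom X Y" "h' \<in> free_hom Y Z"
  shows "arr_of F X Z (compose (free_carrier X) h' h) =
    compose (free_carrier (gens_of F X)) (arr_of F Y Z h') (arr_of F X Y h)"
proof -
  have "(free_linear_algebra X, h, free_linear_algebra Y)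
      \<in> Hom free_algebra_category (free_linear_algebra X) (free_linear_algebra Y)"
    "(free_linear_algebra Y, h', free_linear_algebra Z)
      \<in> Hom free_algebra_category (free_linear_algebra Y) (free_linear_algebra Z)"
    using assms by (simp_all add: free_Hom)
  from free_cat.endofunctorD(6)[OF F this]
  show ?thesis
    by (simp add: free_Comp functor_arrow assms free_hom_compose[OF assms(4,5)])
qed

lemma arr_of_id:
  assumes "finite X"
  shows "arr_of F X X (\<lambda>p \<in> free_carrier X. p) = (\<lambda>p \<in> free_carrier (gens_of F X). p)"
proof -
  from free_cat.endofunctorD(5)[OF F free_ObI[OF assms]]
  show ?thesis by (simp add: free_Ident functor_arrow functor_object assms free_hom_id)
qed

end

text \<open>Surjectivity on objects and bijectivity on arrows are both read off the inverse functor
  \<open>?G\<close>.\<close>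

lemma free_automorphism_Aut:
  fixes F :: "'k::field free_functor"
  assumes FA: "F \<in> carrier (Aut_group free_algebra_category)"
  shows "free_automorphism (gens_of F) (arr_of F)"
proof
  let ?G = "inv\<^bsub>Aut_group free_algebra_category\<^esub> F"
  have GA: "?G \<in> carrier (Aut_group free_algebra_category)" using FA by (rule free_aut.inv_closed)
  note F = free_cat.Aut_endofunctor[OF FA] and G = free_cat.Aut_endofunctor[OF GA]
  note FG = free_cat.Aut_inv[OF FA]
  note GF = free_cat.Aut_inv[OF GA, unfolded free_aut.inv_inv[OF FA]]
  fix X Y Z :: "nat set" and h h' :: "('k, nat) free_element \<Rightarrow> ('k, nat) free_element"
  show "finite X \<Longrightarrow> finite (gens_of F X)" by (rule functor_object(2)[OF F])
  show "\<exists>X. finite X \<and> gens_of F X = Y" if Y: "finite Y"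
  proof (intro exI[of _ "gens_of ?G Y"] conjI)
    show X: "finite (gens_of ?G Y)" by (rule functor_object(2)[OF G Y])
    from FG(1)[OF free_ObI[OF Y]] have "free_linear_algebra (gens_of F (gens_of ?G Y)) =
        (free_linear_algebra Y :: ('k, ('k, nat) free_element) module)"
      by (simp only: functor_object[OF G Y] functor_object[OF F X])
    then show "gens_of F (gens_of ?G Y) = Y" by (rule injD[OF inj_free_linear_algebra])
  qed
  show "bij_betw (arr_of F X Y) (free_hom X Y) (free_hom (gens_of F X) (gens_of F Y))"
    if X: "finite X" and Y: "finite Y"
  proof -
    note gX = functor_object(2)[OF F X] and gY = functor_object(2)[OF F Y]
    let ?m = "\<lambda>X (h :: ('k, nat) free_element \<Rightarrow> ('k, nat) free_element) Y.
      (free_linear_algebra X :: ('k, ('k, nat) free_element) module, h,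
       free_linear_algebra Y :: ('k, ('k, nat) free_element) module)"
    have GFX: "fst ?G (free_linear_algebra (gens_of F X)) = free_linear_algebra X"
      if "finite X" for X
      using GF(1)[OF free_ObI[OF that]] by (simp only: functor_object[OF F that])
    show ?thesis
      unfolding bij_betw_def
    proof
      show "inj_on (arr_of F X Y) (free_hom X Y)"
      proof (rule inj_onI)
        fix h h' :: "('k, nat) free_element \<Rightarrow> ('k, nat) free_element"
        assume h: "h \<in> free_hom X Y" "h' \<in> free_hom X Y" "arr_of F X Y h = arr_of F X Y h'"
        have eq: "snd F (?m X h Y) = snd F (?m X h' Y)"
          by (simp only: functor_arrow(1)[OF F X Y] h)
        have m: "?m X h Y \<in> Mor free_algebra_category" "?m X h' Y \<in> Mor free_algebra_category"
          using X Y h by (auto simp: free_Mor)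
        have "?m X h Y = snd ?G (snd F (?m X h Y))" by (rule GF(2)[OF m(1), symmetric])
        also have "\<dots> = snd ?G (snd F (?m X h' Y))" by (simp only: eq)
        also have "\<dots> = ?m X h' Y" by (rule GF(2)[OF m(2)])
        finally have "?m X h Y = ?m X h' Y" .
        then show "h = h'" by simp
      qed
      show "arr_of F X Y ` free_hom X Y = free_hom (gens_of F X) (gens_of F Y)"
      proof
        show "arr_of F X Y ` free_hom X Y \<subseteq> free_hom (gens_of F X) (gens_of F Y)"
          using functor_arrow(2)[OF F X Y] by blast
        show "free_hom (gens_of F X) (gens_of F Y) \<subseteq> arr_of F X Y ` free_hom X Y"
        proof
          fix h' :: "('k, nat) free_element \<Rightarrow> ('k, nat) free_element"
          assume h': "h' \<in> free_hom (gens_of F X) (gens_of F Y)"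
          let ?f = "?m (gens_of F X) h' (gens_of F Y)"
          have f: "?f \<in> Hom free_algebra_category (free_linear_algebra (gens_of F X))
              (free_linear_algebra (gens_of F Y))"
            using h' by (simp add: free_Hom gX gY)
          have "snd ?G ?f \<in> Hom free_algebra_category (free_linear_algebra X) (free_linear_algebra Y)"
            using free_cat.endofunctorD(4)[OF G f] by (simp only: GFX[OF X] GFX[OF Y])
          then obtain h where h: "h \<in> free_hom X Y" "snd ?G ?f = ?m X h Y"
            using free_Hom[OF X Y] by blast
          have "snd F (?m X h Y) = ?f"
            using FG(2)[OF free_cat.Hom_Ob(3)[OF f]] by (simp only: h(2))
          then have "h' = arr_of F X Y h" by (simp add: functor_arrow[OF F X Y h(1)])
          with h(1) show "h' \<in> arr_of F X Y ` free_hom X Y" by blast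
        qed
      qed
    qed
  qed
  show "arr_of F X Z (compose (free_carrier X) h' h) =
      compose (free_carrier (gens_of F X)) (arr_of F Y Z h') (arr_of F X Y h)"
    if "finite X" "finite Y" "finite Z" "h \<in> free_hom X Y" "h' \<in> free_hom Y Z"
    by (rule arr_of_compose[OF F that])
  show "arr_of F X X (\<lambda>p \<in> free_carrier X. p) = (\<lambda>p \<in> free_carrier (gens_of F X). p)"
    if "finite X" by (rule arr_of_id[OF F that])
qed

text \<open>This is a natural isomorphism from the forgetful functor to sets to its composite with
  \<open>F\<close>. The components are plain bijections, with values outside the carriers left
  free.\<close>

definition natural_family :: "'k::field free_functor \<Rightarrow>
    (nat set \<Rightarrow> ('k, nat) free_element \<Rightarrow> ('k, nat) free_element) \<Rightarrow> bool" where
  "natural_family F s \<longleftrightarrow>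
     (\<forall>X. finite X \<longrightarrow> bij_betw (s X) (free_carrier X) (free_carrier (gens_of F X))) \<and>
     (\<forall>X Y. finite X \<longrightarrow> finite Y \<longrightarrow> (\<forall>h \<in> free_hom X Y. \<forall>p \<in> free_carrier X.
        arr_of F X Y h (s X p) = s Y (h p)))"

text \<open>Such a \<open>\<sigma>\<close> respects the operations when its target has scalars
  acting through \<open>\<phi>\<close> and the product changed to \<open>a p q + b q p\<close>, the
  structure of \<open>twisted_algebra\<close>.\<close>

definition twisted_on :: "('k::field \<Rightarrow> 'k) \<Rightarrow> 'k \<Rightarrow> 'k \<Rightarrow> nat set \<Rightarrow>
    (('k, nat) free_element \<Rightarrow> ('k, nat) free_element) \<Rightarrow> bool" where
  "twisted_on \<phi> a b X \<sigma> \<longleftrightarrow>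
     (\<forall>p \<in> free_carrier X. \<forall>q \<in> free_carrier X. \<sigma> (p + q) = \<sigma> p + \<sigma> q) \<and>
     (\<forall>p \<in> free_carrier X. \<forall>c. \<sigma> (free_smult c p) = free_smult (\<phi> c) (\<sigma> p)) \<and>
     (\<forall>p \<in> free_carrier X. \<forall>q \<in> free_carrier X. \<sigma> (free_mult p q) =
        free_smult a (free_mult (\<sigma> p) (\<sigma> q)) + free_smult b (free_mult (\<sigma> q) (\<sigma> p)))"

text \<open>A relation rather than a function of \<open>F\<close>, because \<open>a\<close> and
  \<open>b\<close> are determined only up to a common factor.\<close>

definition twist :: "'k::field free_functor \<Rightarrow> ('k \<Rightarrow> 'k) \<Rightarrow> 'k \<Rightarrow> 'k \<Rightarrow> bool" where
  "twist F \<phi> a b \<longleftrightarrow> F \<in> carrier (Aut_group free_algebra_category) \<and>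
     \<phi> \<in> carrier field_automorphism_group \<and> a * a \<noteq> b * b \<and>
     (\<exists>s. natural_family F s \<and> (\<forall>X. finite X \<longrightarrow> twisted_on \<phi> a b X (s X)))"

lemma twist_exists:
  assumes inf: "infinite (UNIV :: 'k::field set)"
    and F: "(F :: 'k free_functor) \<in> carrier (Aut_group free_algebra_category)"
  shows "\<exists>\<phi> a b. twist F \<phi> a b"
proof -
  interpret free_automorphism "gens_of F" "arr_of F" by (rule free_automorphism_Aut[OF F])
  obtain a b where ab: "a * a \<noteq> b * b"
    "\<And>Z p q. finite Z \<Longrightarrow> p \<in> free_carrier Z \<Longrightarrow> q \<in> free_carrier Z \<Longrightarrow>
      transport Z (free_mult p q) = free_smult a (free_mult (transport Z p) (transport Z q)) +
        free_smult b (free_mult (transport Z q) (transport Z p))"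
    by (rule transport_mult[OF inf], rule that)
  have "natural_family F transport"
    by (simp add: natural_family_def transport_bij transport_natural)
  moreover have "twisted_on coeff_map a b X (transport X)" if "finite X" for X
    using that by (simp add: twisted_on_def transport_add[OF inf] transport_smult ab(2))
  ultimately show ?thesis
    using F ab(1) coeff_map_field_automorphism[OF inf] unfolding twist_def
    by (intro exI[of _ coeff_map] exI[of _ a] exI[of _ b] conjI exI[of _ transport]) simp_all
qed

lemma natural_familyD:
  assumes "natural_family F s" "finite X"
  shows "p \<in> free_carrier X \<Longrightarrow> s X p \<in> free_carrier (gens_of F X)"
    "p \<in> free_carrier X \<Longrightarrow> q \<in> free_carrier X \<Longrightarrow> s X p = s X q \<Longrightarrow> p = q"
    "r \<in> free_carrier (gens_of F X) \<Longrightarrow> \<exists>p \<in> free_carrier X. s X p = r"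
    "finite Y \<Longrightarrow> h \<in> free_hom X Y \<Longrightarrow> p \<in> free_carrier X \<Longrightarrow> arr_of F X Y h (s X p) = s Y (h p)"
proof -
  have bij: "bij_betw (s X) (free_carrier X) (free_carrier (gens_of F X))"
    using assms by (simp add: natural_family_def)
  show "p \<in> free_carrier X \<Longrightarrow> s X p \<in> free_carrier (gens_of F X)"
    by (rule bij_betw_apply[OF bij])
  show "p \<in> free_carrier X \<Longrightarrow> q \<in> free_carrier X \<Longrightarrow> s X p = s X q \<Longrightarrow> p = q"
    by (rule inj_onD[OF bij_betw_imp_inj_on[OF bij]])
  show "\<exists>p \<in> free_carrier X. s X p = r" if "r \<in> free_carrier (gens_of F X)"
  proof -
    have "r \<in> s X ` free_carrier X" using that by (simp only: bij_betw_imp_surj_on[OF bij])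
    then show ?thesis by blast
  qed
  show "finite Y \<Longrightarrow> h \<in> free_hom X Y \<Longrightarrow> p \<in> free_carrier X \<Longrightarrow> arr_of F X Y h (s X p) = s Y (h p)"
    using assms by (simp add: natural_family_def)
qed

lemma twisted_onD:
  assumes "twisted_on \<phi> a b X \<sigma>" "p \<in> free_carrier X"
  shows "q \<in> free_carrier X \<Longrightarrow> \<sigma> (p + q) = \<sigma> p + \<sigma> q"
    "\<sigma> (free_smult c p) = free_smult (\<phi> c) (\<sigma> p)"
    "q \<in> free_carrier X \<Longrightarrow> \<sigma> (free_mult p q) =
      free_smult a (free_mult (\<sigma> p) (\<sigma> q)) + free_smult b (free_mult (\<sigma> q) (\<sigma> p))"
  using assms by (simp_all add: twisted_on_def)

text \<open>Here the circulant matrices appear. Applying \<open>\<sigma>\<close> to the product rule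
  of \<open>\<tau>\<close> moves \<open>c\<close> and \<open>d\<close> by \<open>\<phi>\<close>, and
  collecting the two orders of multiplication gives the first row of
  \<open>circulant a b ** circulant (\<phi> c) (\<phi> d)\<close>.\<close>

lemma twisted_on_compose:
  assumes \<sigma>: "twisted_on \<phi> a b Y \<sigma>" and \<tau>: "twisted_on \<psi> c d X \<tau>"
    and maps: "\<And>p. p \<in> free_carrier X \<Longrightarrow> \<tau> p \<in> free_carrier Y"
  shows "twisted_on (\<phi> \<circ> \<psi>) (a * \<phi> c + b * \<phi> d) (a * \<phi> d + b * \<phi> c) X (\<lambda>p. \<sigma> (\<tau> p))"
proof -
  have "\<sigma> (\<tau> (free_mult p q)) =
      free_smult (a * \<phi> c + b * \<phi> d) (free_mult (\<sigma> (\<tau> p)) (\<sigma> (\<tau> q))) +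
      free_smult (a * \<phi> d + b * \<phi> c) (free_mult (\<sigma> (\<tau> q)) (\<sigma> (\<tau> p)))"
    if p: "p \<in> free_carrier X" "q \<in> free_carrier X" for p q
  proof -
    have "\<sigma> (\<tau> (free_mult p q)) =
      free_smult (\<phi> c) (\<sigma> (free_mult (\<tau> p) (\<tau> q))) + free_smult (\<phi> d) (\<sigma> (free_mult (\<tau> q) (\<tau> p)))"
      using p maps by (simp add: twisted_onD(3)[OF \<tau>] twisted_onD(1,2)[OF \<sigma>])
    also have "\<dots> = free_smult (a * \<phi> c + b * \<phi> d) (free_mult (\<sigma> (\<tau> p)) (\<sigma> (\<tau> q))) +
      free_smult (a * \<phi> d + b * \<phi> c) (free_mult (\<sigma> (\<tau> q)) (\<sigma> (\<tau> p)))"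
      using p maps twisted_onD(3)[OF \<sigma>]
      by (simp add: free_smult_add free_smult_add_left algebra_simps)
    finally show ?thesis .
  qed
  then show ?thesis
    using maps by (simp add: twisted_on_def twisted_onD(1,2)[OF \<sigma>] twisted_onD(1,2)[OF \<tau>])
qed

text \<open>Multiplicativity of the determinant \<open>a * a - b * b\<close>.\<close>

lemma circulant_mult_invertible:
  assumes "a * a \<noteq> b * b" "c * c \<noteq> d * (d :: 'k::field)"
  shows "(a * c + b * d) * (a * c + b * d) \<noteq> (a * d + b * c) * (a * d + b * c)"
proof -
  have "(a * c + b * d) * (a * c + b * d) - (a * d + b * c) * (a * d + b * c) =
      (a * a - b * b) * (c * c - d * d)"
    by (simp add: algebra_simps)
  with assms show ?thesis by (metis eq_iff_diff_eq_0 mult_eq_0_iff)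
qed

lemma functor_mult_data:
  fixes F G :: "'k::field free_functor"
  assumes F: "F \<in> carrier (Aut_group free_algebra_category)"
    and G: "G \<in> carrier (Aut_group free_algebra_category)"
    and X: "finite X"
  defines "FG \<equiv> F \<otimes>\<^bsub>Aut_group free_algebra_category\<^esub> G"
  shows "gens_of FG X = gens_of F (gens_of G X)"
    and "finite Y \<Longrightarrow> h \<in> free_hom X Y \<Longrightarrow>
      arr_of FG X Y h = arr_of F (gens_of G X) (gens_of G Y) (arr_of G X Y h)"
proof -
  note F' = free_cat.Aut_endofunctor[OF F] and G' = free_cat.Aut_endofunctor[OF G]
  have "fst FG (free_linear_algebra X) = free_linear_algebra (gens_of F (gens_of G X))"
    by (simp add: FG_def free_cat.Aut_mult compose_eq[OF free_ObI[OF X]] functor_object(1)[OF G' X]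
        functor_object(1)[OF F' functor_object(2)[OF G' X]])
  then show "gens_of FG X = gens_of F (gens_of G X)"
    by (simp add: gens_of_def[of FG] the_inv_f_f[OF inj_free_linear_algebra])
  assume Y: "finite Y" and h: "h \<in> free_hom X Y"
  have "(free_linear_algebra X, h, free_linear_algebra Y) \<in> Mor free_algebra_category"
    using X Y h by (auto simp: free_Mor)
  then have "snd FG (free_linear_algebra X, h, free_linear_algebra Y) =
      snd F (snd G (free_linear_algebra X, h, free_linear_algebra Y))"
    by (simp add: FG_def free_cat.Aut_mult compose_eq)
  then show "arr_of FG X Y h = arr_of F (gens_of G X) (gens_of G Y) (arr_of G X Y h)"
    unfolding functor_arrow(1)[OF G' X Y h] by (simp add: arr_of_def[of FG] arr_of_def[of F])
qed

lemma twist_mult: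
  fixes F G :: "'k::field free_functor"
  assumes "twist F \<phi> a b" "twist G \<psi> c d"
  shows "twist (F \<otimes>\<^bsub>Aut_group free_algebra_category\<^esub> G) (\<phi> \<circ> \<psi>)
    (a * \<phi> c + b * \<phi> d) (a * \<phi> d + b * \<phi> c)"
proof -
  obtain s where F: "F \<in> carrier (Aut_group free_algebra_category)"
    and \<phi>: "\<phi> \<in> carrier field_automorphism_group" and ab: "a * a \<noteq> b * b"
    and s: "natural_family F s" "\<And>X. finite X \<Longrightarrow> twisted_on \<phi> a b X (s X)"
    using assms(1) by (auto simp: twist_def)
  obtain t where G: "G \<in> carrier (Aut_group free_algebra_category)"
    and \<psi>: "\<psi> \<in> carrier field_automorphism_group" and cd: "c * c \<noteq> d * d"
    and t: "natural_family G t" "\<And>X. finite X \<Longrightarrow> twisted_on \<psi> c d X (t X)"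
    using assms(2) by (auto simp: twist_def)
  note F' = free_cat.Aut_endofunctor[OF F] and G' = free_cat.Aut_endofunctor[OF G]
  interpret field_aut: group "field_automorphism_group :: ('k \<Rightarrow> 'k) monoid"
    by (rule group_field_automorphism_group)
  define st where "st X p = s (gens_of G X) (t X p)" for X p
  have "natural_family (F \<otimes>\<^bsub>Aut_group free_algebra_category\<^esub> G) st"
    unfolding natural_family_def
  proof (intro conjI allI impI ballI)
    fix X :: "nat set" assume X: "finite X"
    have "bij_betw (t X) (free_carrier X) (free_carrier (gens_of G X))"
      using t(1) X by (simp add: natural_family_def)
    moreover have "bij_betw (s (gens_of G X)) (free_carrier (gens_of G X)) (free_carrier (gens_of F (gens_of G X)))"
      using s(1) functor_object(2)[OF G' X] by (simp add: natural_family_def)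
    ultimately show "bij_betw (st X) (free_carrier X)
        (free_carrier (gens_of (F \<otimes>\<^bsub>Aut_group free_algebra_category\<^esub> G) X))"
      using bij_betw_trans unfolding functor_mult_data(1)[OF F G X] st_def[abs_def] comp_def by blast
    fix Y and h :: "('k, nat) free_element \<Rightarrow> ('k, nat) free_element" and p :: "('k, nat) free_element"
    assume Y: "finite Y" and h: "h \<in> free_hom X Y" and p: "p \<in> free_carrier X"
    show "arr_of (F \<otimes>\<^bsub>Aut_group free_algebra_category\<^esub> G) X Y h (st X p) = st Y (h p)"
      unfolding functor_mult_data(2)[OF F G X Y h] st_def
      using natural_familyD(4)[OF s(1) functor_object(2)[OF G' X] functor_object(2)[OF G' Y]
          functor_arrow(2)[OF G' X Y h] natural_familyD(1)[OF t(1) X p]]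
        natural_familyD(4)[OF t(1) X Y h p] by simp
  qed
  moreover have "twisted_on (\<phi> \<circ> \<psi>) (a * \<phi> c + b * \<phi> d) (a * \<phi> d + b * \<phi> c) X (st X)"
    if X: "finite X" for X
    unfolding st_def
    by (rule twisted_on_compose[OF s(2)[OF functor_object(2)[OF G' X]] t(2)[OF X]
          natural_familyD(1)[OF t(1) X]])
  moreover have "\<phi> c * \<phi> c \<noteq> \<phi> d * \<phi> d"
    unfolding field_automorphismD(4)[OF \<phi>, symmetric] field_automorphismD(6)[OF \<phi>] by (rule cd)
  then have "(a * \<phi> c + b * \<phi> d) * (a * \<phi> c + b * \<phi> d) \<noteq> (a * \<phi> d + b * \<phi> c) * (a * \<phi> d + b * \<phi> c)"
    by (rule circulant_mult_invertible[OF ab])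
  moreover have "\<phi> \<circ> \<psi> \<in> carrier field_automorphism_group"
    using field_aut.m_closed[OF \<phi> \<psi>] by (simp add: field_automorphism_group_def)
  ultimately show ?thesis
    using free_aut.m_closed[OF F G] unfolding twist_def by blast
qed

text \<open>Homomorphisms commute with scalars, so dividing a natural family by \<open>c\<close>
  keeps it natural. The product rule is quadratic on its right-hand side and linear on its left, so
  both coefficients are multiplied by \<open>c\<close>.\<close>

lemma twist_scale:
  fixes F :: "'k::field free_functor"
  assumes "twist F \<phi> a b" "c \<noteq> 0"
  shows "twist F \<phi> (c * a) (c * b)"
proof -
  obtain s where F: "F \<in> carrier (Aut_group free_algebra_category)"
    and \<phi>: "\<phi> \<in> carrier field_automorphism_group" and ab: "a * a \<noteq> b * b"
    and s: "natural_family F s" "\<And>X. finite X \<Longrightarrow> twisted_on \<phi> a b X (s X)"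
    using assms(1) by (auto simp: twist_def)
  note F' = free_cat.Aut_endofunctor[OF F]
  define t where "t X p = free_smult (1 / c) (s X p)" for X p
  have "natural_family F t"
    unfolding natural_family_def
  proof (intro conjI allI impI ballI)
    fix X :: "nat set" assume X: "finite X"
    have "bij_betw (free_smult (1 / c)) (free_carrier (gens_of F X)) (free_carrier (gens_of F X))"
      using assms(2) by (intro bij_betw_byWitness[where f' = "free_smult c"]) auto
    moreover have "bij_betw (s X) (free_carrier X) (free_carrier (gens_of F X))"
      using s(1) X by (simp add: natural_family_def)
    ultimately show "bij_betw (t X) (free_carrier X) (free_carrier (gens_of F X))"
      using bij_betw_trans unfolding t_def[abs_def] comp_def by blast
    fix Y and h :: "('k, nat) free_element \<Rightarrow> ('k, nat) free_element" and p :: "('k, nat) free_element"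
    assume Y: "finite Y" and h: "h \<in> free_hom X Y" and p: "p \<in> free_carrier X"
    show "arr_of F X Y h (t X p) = t Y (h p)"
      unfolding t_def free_homD(2)[OF functor_arrow(2)[OF F' X Y h] natural_familyD(1)[OF s(1) X p]]
        natural_familyD(4)[OF s(1) X Y h p] by (rule refl)
  qed
  moreover have "twisted_on \<phi> (c * a) (c * b) X (t X)" if X: "finite X" for X
    using assms(2) by (simp add: twisted_on_def t_def twisted_onD[OF s(2)[OF X]] free_smult_add mult.commute)
  moreover have "c * a * (c * a) \<noteq> c * b * (c * b)"
    using ab assms(2) by (simp add: algebra_simps)
  ultimately show ?thesis using F \<phi> unfolding twist_def by blast
qed

text \<open>By naturality two families are compared through their values at one generator, which
  gives a word \<open>w\<close> in one letter; it is invertible under composition, hence linear. The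
  families are therefore proportional, and comparing their rules at independent elements gives both
  claims.\<close>

lemma twist_unique:
  fixes F :: "'k::field free_functor"
  assumes "twist F \<phi> a b" "twist F \<psi> c d"
  shows "\<phi> = \<psi>" "\<exists>\<delta>. \<delta> \<noteq> 0 \<and> c = \<delta> * a \<and> d = \<delta> * b"
proof -
  obtain s where F: "F \<in> carrier (Aut_group free_algebra_category)"
    and \<phi>: "\<phi> \<in> carrier field_automorphism_group"
    and s: "natural_family F s" "\<And>X. finite X \<Longrightarrow> twisted_on \<phi> a b X (s X)"
    using assms(1) by (auto simp: twist_def)
  obtain t where \<psi>: "\<psi> \<in> carrier field_automorphism_group"
    and t: "natural_family F t" "\<And>X. finite X \<Longrightarrow> twisted_on \<psi> c d X (t X)"
    using assms(2) by (auto simp: twist_def)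
  interpret free_automorphism "gens_of F" "arr_of F" by (rule free_automorphism_Aut[OF F])
  let ?x = "free_gen 0 :: ('k, nat) free_element"
  have fin: "finite {0 :: nat}" and x: "?x \<in> free_carrier {0}" by simp_all
  \<comment> \<open>A Yoneda argument: this \<open>w\<close> determines how \<open>s\<close> is
    expressed by \<open>t\<close> on every algebra.\<close>
  obtain w where w: "w \<in> free_carrier {0}" "t {0} w = s {0} ?x"
    using natural_familyD(3)[OF t(1) fin natural_familyD(1)[OF s(1) fin x]] by blast
  have s_w: "s Z q = t Z (subst (\<lambda>_. q) w)" if Z: "finite Z" and q: "q \<in> free_carrier Z" for Z q
  proof -
    have "s Z (point q ?x) = arr_of F {0} Z (point q) (t {0} w)"
      unfolding w(2) by (rule natural_familyD(4)[OF s(1) fin Z point_hom[OF q] x, symmetric])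
    also have "\<dots> = t Z (point q w)"
      by (rule natural_familyD(4)[OF t(1) fin Z point_hom[OF q] w(1)])
    finally show ?thesis using w(1) by (simp add: point_def)
  qed
  obtain q where q: "q \<in> free_carrier {0}" "s {0} q = t {0} ?x"
    using natural_familyD(3)[OF s(1) fin natural_familyD(1)[OF t(1) fin x]] by blast
  have "subst (\<lambda>_. q) w \<in> free_carrier {0}" using q(1) by (intro subst_closed[OF w(1)]) simp
  then have "subst (\<lambda>_. q) w = ?x"
    using natural_familyD(2)[OF t(1) fin _ x] s_w[OF fin q(1)] q(2) by simp
  then obtain \<gamma> where \<gamma>: "w = Poly_Mapping.single (Letter 0) \<gamma>"
    using linear_if_left_invertible[OF w(1), of 1] by auto
  \<comment> \<open>The scalar \<open>\<gamma>\<close> passes through \<open>t\<close>, which is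
    semilinear along \<open>\<psi>\<close>.\<close>
  define \<delta> where "\<delta> = \<psi> \<gamma>"
  have st: "s Z q = free_smult \<delta> (t Z q)" if "finite Z" "q \<in> free_carrier Z" for Z q
    using s_w[OF that] twisted_onD(2)[OF t(2)[OF that(1)] that(2)] by (simp add: \<gamma> \<delta>_def)
  have "\<gamma> \<noteq> 0" using \<open>subst (\<lambda>_. q) w = ?x\<close> \<gamma> by auto
  then have \<delta>: "\<delta> \<noteq> 0" using field_automorphismD(5,6)[OF \<psi>] unfolding \<delta>_def by metis
  obtain Z where Z: "finite Z" "gens_of F Z = {0, 1}" using gens_surj[of "{0, 1}"] by auto
  obtain x y where xy: "x \<in> free_carrier Z" "y \<in> free_carrier Z"
    and txy: "t Z x = free_gen 0" "t Z y = free_gen 1"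
    using natural_familyD(3)[OF t(1) Z(1)] Z(2) by (metis free_single_carrier insertI1 insertI2 nonassoc_word.set(1) singleton_iff subsetI)
  note tw = twisted_onD[OF s(2)[OF Z(1)]] twisted_onD[OF t(2)[OF Z(1)]]
  show "\<phi> = \<psi>"
  proof
    fix e
    have "free_smult (\<phi> e) (s Z x) = free_smult \<delta> (free_smult (\<psi> e) (t Z x))"
      using st[OF Z(1), of "free_smult e x"] xy by (simp add: tw)
    then show "\<phi> e = \<psi> e" using st[OF Z(1) xy(1)] \<delta> by (simp add: txy single_Letter_eq_iff mult.commute)
  qed
  have eq: "s Z (free_mult x y) = free_smult \<delta> (t Z (free_mult x y))"
    using st[OF Z(1)] xy by simp
  have "free_smult a (free_mult (s Z x) (s Z y)) + free_smult b (free_mult (s Z y) (s Z x)) =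
     free_smult \<delta> (free_smult c (free_mult (t Z x) (t Z y)) + free_smult d (free_mult (t Z y) (t Z x)))"
    (is "?lhs = ?rhs")
    using eq tw(3)[OF xy] tw(6)[OF xy] by metis
  let ?u = "Juxt (Letter 0) (Letter 1) :: nat nonassoc_word"
  let ?v = "Juxt (Letter 1) (Letter 0) :: nat nonassoc_word"
  have *: "Poly_Mapping.single ?u (a * (\<delta> * \<delta>)) +
      Poly_Mapping.single ?v (b * (\<delta> * \<delta>)) =
      Poly_Mapping.single ?u (\<delta> * c) +
      Poly_Mapping.single ?v (\<delta> * (d :: 'k))"
    using \<open>?lhs = ?rhs\<close> unfolding st[OF Z(1) xy(1)] st[OF Z(1) xy(2)] txy by (simp add: free_smult_add)
  \<comment> \<open>The left factor is squared because \<open>s\<close> occurs twice in its product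
    rule; cancelling one \<open>\<delta>\<close> leaves the common factor.\<close>
  have "a * (\<delta> * \<delta>) = \<delta> * c" "b * (\<delta> * \<delta>) = \<delta> * d"
    using arg_cong[OF *, of "\<lambda>p. Poly_Mapping.lookup p ?u"]
      arg_cong[OF *, of "\<lambda>p. Poly_Mapping.lookup p ?v"]
    by (simp_all add: lookup_add lookup_single when_def)
  then have "c = \<delta> * a" "d = \<delta> * b" using \<delta> by (simp_all add: mult.commute mult.left_commute)
  with \<delta> show "\<exists>\<delta>. \<delta> \<noteq> 0 \<and> c = \<delta> * a \<and> d = \<delta> * b" by blast
qed


section \<open>Inner automorphisms\<close>

lemma twisted_on_hom: "h \<in> free_hom X Y \<Longrightarrow> twisted_on id 1 0 X h"
  by (simp add: twisted_on_def free_homD)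

lemma hom_if_twisted_on:
  assumes "twisted_on id 1 0 X \<sigma>" "\<And>p. p \<in> free_carrier X \<Longrightarrow> \<sigma> p \<in> free_carrier Y"
  shows "restrict \<sigma> (free_carrier X) \<in> free_hom X Y"
  using assms by (auto simp: linear_algebra_hom_def twisted_onD)

text \<open>The components of an isomorphism from the identity functor are invertible homomorphisms,
  so their underlying maps form a natural family without any twist.\<close>

lemma twist_if_inner:
  fixes F :: "'k::field free_functor"
  assumes "F \<in> inner_automorphisms free_algebra_category"
  shows "twist F id 1 0"
proof -
  obtain s t where FA: "F \<in> carrier (Aut_group free_algebra_category)"
    and s: "\<And>A. A \<in> Ob free_algebra_category \<Longrightarrow> s A \<in> Hom free_algebra_category A (fst F A)"
    and t: "\<And>A. A \<in> Ob free_algebra_category \<Longrightarrow> t A \<in> Hom free_algebra_category (fst F A) A"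
    and ts: "\<And>A. A \<in> Ob free_algebra_category \<Longrightarrow>
        Comp free_algebra_category (t A) (s A) = Ident free_algebra_category A"
    and st: "\<And>A. A \<in> Ob free_algebra_category \<Longrightarrow>
        Comp free_algebra_category (s A) (t A) = Ident free_algebra_category (fst F A)"
    and nat: "\<And>A B f. f \<in> Hom free_algebra_category A B \<Longrightarrow>
        Comp free_algebra_category (snd F f) (s A) = Comp free_algebra_category (s B) f"
    by (rule free_cat.inner_automorphismsD[OF assms]) (rule that)
  note F = free_cat.Aut_endofunctor[OF FA]
  define \<sigma> \<tau> where "\<sigma> X = fst (snd (s (free_linear_algebra X)))"
    and "\<tau> X = fst (snd (t (free_linear_algebra X)))" for X
  have \<sigma>: "s (free_linear_algebra X) = (free_linear_algebra X, \<sigma> X, free_linear_algebra (gens_of F X))"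
      "\<sigma> X \<in> free_hom X (gens_of F X)"
    and \<tau>: "t (free_linear_algebra X) = (free_linear_algebra (gens_of F X), \<tau> X, free_linear_algebra X)"
      "\<tau> X \<in> free_hom (gens_of F X) X" if X: "finite X" for X
    using s[OF free_ObI[OF X]] t[OF free_ObI[OF X]] functor_object[OF F X]
    by (auto simp: free_Hom X \<sigma>_def \<tau>_def)
  have \<tau>\<sigma>: "\<tau> X (\<sigma> X p) = p" if X: "finite X" and p: "p \<in> free_carrier X" for X p
  proof -
    have "compose (free_carrier X) (\<tau> X) (\<sigma> X) = (\<lambda>p \<in> free_carrier X. p)"
      using ts[OF free_ObI[OF X]] by (simp add: \<sigma>(1)[OF X] \<tau>(1)[OF X] free_Comp free_Ident)
    from fun_cong[OF this, of p] p show ?thesis by (simp add: compose_eq)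
  qed
  have \<sigma>\<tau>: "\<sigma> X (\<tau> X p) = p" if X: "finite X" and p: "p \<in> free_carrier (gens_of F X)" for X p
  proof -
    have "compose (free_carrier (gens_of F X)) (\<sigma> X) (\<tau> X) = (\<lambda>p \<in> free_carrier (gens_of F X). p)"
      using st[OF free_ObI[OF X]] functor_object(1)[OF F X]
      by (simp add: \<sigma>(1)[OF X] \<tau>(1)[OF X] free_Comp free_Ident)
    from fun_cong[OF this, of p] p show ?thesis by (simp add: compose_eq)
  qed
  have "natural_family F \<sigma>"
    unfolding natural_family_def
  proof (intro conjI allI impI ballI)
    fix X :: "nat set" assume X: "finite X"
    show "bij_betw (\<sigma> X) (free_carrier X) (free_carrier (gens_of F X))"
      using \<tau>\<sigma>[OF X] \<sigma>\<tau>[OF X] free_homD(1)[OF \<sigma>(2)[OF X]] free_homD(1)[OF \<tau>(2)[OF X]]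
      by (intro bij_betw_byWitness[where f' = "\<tau> X"]) auto
    fix Y and h :: "('k, nat) free_element \<Rightarrow> ('k, nat) free_element" and p :: "('k, nat) free_element"
    assume Y: "finite Y" and h: "h \<in> free_hom X Y" and p: "p \<in> free_carrier X"
    have "(free_linear_algebra X, h, free_linear_algebra Y)
        \<in> Hom free_algebra_category (free_linear_algebra X) (free_linear_algebra Y)"
      using h by (simp add: free_Hom X Y)
    from nat[OF this] have "compose (free_carrier X) (arr_of F X Y h) (\<sigma> X) = compose (free_carrier X) (\<sigma> Y) h"
      by (simp add: \<sigma>(1)[OF X] \<sigma>(1)[OF Y] functor_arrow(1)[OF F X Y h] free_Comp)
    from fun_cong[OF this, of p] p show "arr_of F X Y h (\<sigma> X p) = \<sigma> Y (h p)"
      by (simp add: compose_eq)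
  qed
  moreover have "id \<in> carrier (field_automorphism_group :: ('k \<Rightarrow> 'k) monoid)"
    by (simp add: field_automorphism_group_def)
  ultimately show ?thesis
    using FA twisted_on_hom[OF \<sigma>(2)] unfolding twist_def by (intro conjI exI[of _ \<sigma>]) auto
qed

text \<open>With trivial twist each component is a bijective homomorphism, and the inverse of such a
  map is again a homomorphism. So the natural bijections are isomorphisms in the category.\<close>

lemma inner_if_twist:
  fixes F :: "'k::field free_functor"
  assumes "twist F id 1 0"
  shows "F \<in> inner_automorphisms free_algebra_category"
proof -
  obtain \<sigma> where FA: "F \<in> carrier (Aut_group free_algebra_category)"
    and nat: "natural_family F \<sigma>" and tw: "\<And>X. finite X \<Longrightarrow> twisted_on id 1 0 X (\<sigma> X)"
    using assms by (auto simp: twist_def)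
  note F = free_cat.Aut_endofunctor[OF FA] and nf = natural_familyD[OF nat]
  define \<tau> where "\<tau> X = inv_into (free_carrier X) (\<sigma> X)" for X
  have \<tau>\<sigma>: "\<tau> X (\<sigma> X p) = p" if "finite X" "p \<in> free_carrier X" for X p
    unfolding \<tau>_def using nf(2)[OF that(1)] that(2) by (intro inv_into_f_f inj_onI)
  have \<tau>: "\<tau> X r \<in> free_carrier X" "\<sigma> X (\<tau> X r) = r"
    if "finite X" "r \<in> free_carrier (gens_of F X)" for X r
  proof -
    have "r \<in> \<sigma> X ` free_carrier X" using nf(3)[OF that] by blast
    then show "\<tau> X r \<in> free_carrier X" "\<sigma> X (\<tau> X r) = r"
      unfolding \<tau>_def by (auto intro: inv_into_into f_inv_into_f)
  qed
  define s where "s X = restrict (\<sigma> X) (free_carrier X)" for X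
  define t where "t X = restrict (\<tau> X) (free_carrier (gens_of F X))" for X
  have s: "s X \<in> free_hom X (gens_of F X)" if X: "finite X" for X
    unfolding s_def by (rule hom_if_twisted_on[OF tw[OF X] nf(1)[OF X]])
  have t: "t X \<in> free_hom (gens_of F X) X" if X: "finite X" for X
    unfolding t_def
  proof (rule hom_if_twisted_on[OF _ \<tau>(1)[OF X]])
    note tw' = twisted_onD[OF tw[OF X]] and \<tau>' = \<tau>[OF X]
    show "twisted_on id 1 0 (gens_of F X) (\<tau> X)"
      unfolding twisted_on_def
    proof (intro conjI ballI allI)
      fix p q :: "('k, nat) free_element" and c :: 'k
      assume p: "p \<in> free_carrier (gens_of F X)"
      have "\<tau> X (\<sigma> X (free_smult c (\<tau> X p))) = free_smult c (\<tau> X p)"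
        using \<tau>' p by (intro \<tau>\<sigma>[OF X]) simp
      then show "\<tau> X (free_smult c p) = free_smult (id c) (\<tau> X p)"
        using \<tau>' p by (simp add: tw')
      assume q: "q \<in> free_carrier (gens_of F X)"
      have "\<tau> X (\<sigma> X (\<tau> X p + \<tau> X q)) = \<tau> X p + \<tau> X q"
        using \<tau>' p q by (intro \<tau>\<sigma>[OF X]) simp
      then show "\<tau> X (p + q) = \<tau> X p + \<tau> X q" using \<tau>' p q by (simp add: tw')
      have "\<tau> X (\<sigma> X (free_mult (\<tau> X p) (\<tau> X q))) = free_mult (\<tau> X p) (\<tau> X q)"
        using \<tau>' p q by (intro \<tau>\<sigma>[OF X]) simp
      then show "\<tau> X (free_mult p q) =
          free_smult 1 (free_mult (\<tau> X p) (\<tau> X q)) + free_smult 0 (free_mult (\<tau> X q) (\<tau> X p))"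
        using \<tau>' p q by (simp add: tw')
    qed
  qed
  let ?X = "the_inv (free_linear_algebra :: nat set \<Rightarrow> ('k, _) module)"
  have X_eq: "?X (free_linear_algebra X) = X" for X
    by (rule the_inv_f_f[OF inj_free_linear_algebra])
  show ?thesis
  proof (rule free_cat.inner_automorphismsI[OF FA,
        where s = "\<lambda>A. (A, s (?X A), fst F A)" and t = "\<lambda>A. (fst F A, t (?X A), A)"])
    fix A :: "('k, ('k, nat) free_element) module"
    assume "A \<in> Ob free_algebra_category"
    then obtain X where X: "finite X" and A: "A = free_linear_algebra X" by (auto simp: free_Ob)
    show "(A, s (?X A), fst F A) \<in> Hom free_algebra_category A (fst F A)"
      "(fst F A, t (?X A), A) \<in> Hom free_algebra_category (fst F A) A"
      unfolding A X_eq functor_object(1)[OF F X]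
      using free_Hom X functor_object(2)[OF F X] s[OF X] t[OF X] by blast+
    have "compose (free_carrier X) (t X) (s X) = (\<lambda>p \<in> free_carrier X. p)"
      using \<tau>\<sigma>[OF X] nf(1)[OF X] by (auto simp: fun_eq_iff compose_def s_def t_def)
    then show "Comp free_algebra_category (fst F A, t (?X A), A) (A, s (?X A), fst F A) =
        Ident free_algebra_category A"
      by (simp add: free_Comp free_Ident A X_eq)
    have "compose (free_carrier (gens_of F X)) (s X) (t X) = (\<lambda>p \<in> free_carrier (gens_of F X). p)"
      using \<tau>[OF X] by (auto simp: fun_eq_iff compose_def s_def t_def)
    then show "Comp free_algebra_category (A, s (?X A), fst F A) (fst F A, t (?X A), A) =
        Ident free_algebra_category (fst F A)"
      by (simp add: free_Comp free_Ident A X_eq functor_object(1)[OF F X])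
  next
    fix A B :: "('k, ('k, nat) free_element) module" and f
    assume f: "f \<in> Hom free_algebra_category A B"
    then obtain X Y where X: "finite X" and A: "A = free_linear_algebra X"
      and Y: "finite Y" and B: "B = free_linear_algebra Y"
      using free_cat.Hom_Ob(1,2)[OF f] by (auto simp: free_Ob)
    obtain h where h: "h \<in> free_hom X Y" and f_eq: "f = (free_linear_algebra X, h, free_linear_algebra Y)"
      using f unfolding A B free_Hom[OF X Y] by blast
    have "compose (free_carrier X) (arr_of F X Y h) (s X) = compose (free_carrier X) (s Y) h"
      using nf(4)[OF X Y h] free_homD(1)[OF h] by (auto simp: fun_eq_iff compose_def s_def)
    then show "Comp free_algebra_category (snd F f) (A, s (?X A), fst F A) =
        Comp free_algebra_category (B, s (?X B), fst F B) f"
      unfolding A B f_eq X_eq functor_arrow(1)[OF F X Y h]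
      by (simp add: free_Comp functor_object(1)[OF F Y])
  qed
qed

section \<open>Every twist is realised\<close>

text \<open>
  The free algebra with scalars acting through \<open>\<phi>\<close> and with product \<open>a p q + b q p\<close> is again a linear
  algebra, so the universal property provides the twisting map.
\<close>

definition twisted_algebra :: "('k::field \<Rightarrow> 'k) \<Rightarrow> 'k \<Rightarrow> 'k \<Rightarrow> ('k, ('k, 'x) free_element) module" where
  "twisted_algebra \<phi> a b =
     \<lparr>carrier = UNIV,
      monoid.mult = (\<lambda>p q. free_smult a (free_mult p q) + free_smult b (free_mult q p)),
      one = undefined,
      zero = 0,
      add = (+),
      module.smult = (\<lambda>c. free_smult (\<phi> c))\<rparr>"

definition twist_map :: "('k::field \<Rightarrow> 'k) \<Rightarrow> 'k \<Rightarrow> 'k \<Rightarrow> ('k, 'x) free_element \<Rightarrow> ('k, 'x) free_element" where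
  "twist_map \<phi> a b = linear_algebra.free_extend (twisted_algebra \<phi> a b) free_gen"

context
  fixes \<phi> :: "'k::field \<Rightarrow> 'k" and a b :: 'k
  assumes \<phi>: "\<phi> \<in> carrier field_automorphism_group"
begin

lemma linear_algebra_twisted:
  "linear_algebra (twisted_algebra \<phi> a b :: ('k, ('k, 'x) free_element) module)"
proof -
  let ?H = "twisted_algebra \<phi> a b :: ('k, ('k, 'x) free_element) module"
  have "abelian_group ?H"
  proof (rule abelian_groupI)
    show "\<exists>y \<in> carrier ?H. y \<oplus>\<^bsub>?H\<^esub> x = \<zero>\<^bsub>?H\<^esub>" for x
      by (intro bexI[of _ "- x"]) (simp_all add: twisted_algebra_def)
  qed (simp_all add: twisted_algebra_def add_ac)
  moreover have "linear_algebra_axioms ?H"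
    by unfold_locales
      (simp_all add: twisted_algebra_def field_automorphismD[OF \<phi>] free_smult_add free_smult_add_left
        free_mult_add mult.commute add_ac)
  ultimately show ?thesis by (rule linear_algebra.intro)
qed

lemma twist_map_twisted: "twisted_on \<phi> a b X (twist_map \<phi> a b)"
proof -
  interpret linear_algebra "twisted_algebra \<phi> a b :: ('k, (nat nonassoc_word \<Rightarrow>\<^sub>0 'k)) module"
    by (rule linear_algebra_twisted)
  have f: "free_gen \<in> UNIV \<rightarrow> carrier (twisted_algebra \<phi> a b :: ('k, (nat nonassoc_word \<Rightarrow>\<^sub>0 'k)) module)"
    by (simp add: twisted_algebra_def)
  show ?thesis
    using free_extend_add[OF f] free_extend_smult[OF f] free_extend_mult[OF f]
    by (simp add: twisted_on_def twist_map_def) (simp add: twisted_algebra_def)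
qed

lemma twist_map_single:
  fixes u :: "'x nonassoc_word"
  shows "twist_map \<phi> a b (Poly_Mapping.single u c) =
    free_smult (\<phi> c) (word_eval (twisted_algebra \<phi> a b) free_gen u)"
proof -
  interpret linear_algebra "twisted_algebra \<phi> a b :: ('k, ('x nonassoc_word \<Rightarrow>\<^sub>0 'k)) module"
    by (rule linear_algebra_twisted)
  have f: "free_gen \<in> UNIV \<rightarrow> carrier (twisted_algebra \<phi> a b :: ('k, ('x nonassoc_word \<Rightarrow>\<^sub>0 'k)) module)"
    by (simp add: twisted_algebra_def)
  show ?thesis
    using free_extend_single[OF f, of u c] by (simp add: twist_map_def) (simp add: twisted_algebra_def)
qed

lemma twist_map_gen: "twist_map \<phi> a b (free_gen i) = free_gen i"
  by (simp add: twist_map_single field_automorphismD[OF \<phi>])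

text \<open>The map is defined on the algebra with all letters. It preserves each free subalgebra
  because evaluating a word in the twisted algebra introduces no new letters.\<close>

lemma twist_map_closed:
  fixes p :: "('k, nat) free_element"
  assumes "p \<in> free_carrier X"
  shows "twist_map \<phi> a b p \<in> free_carrier X"
proof -
  have word: "word_eval (twisted_algebra \<phi> a b) free_gen u \<in> (free_carrier X :: ('k, nat) free_element set)"
    if "letters u \<subseteq> X" for u
    using that by (induction u) (simp_all add: twisted_algebra_def)
  note tw = twisted_onD[OF twist_map_twisted]
  from assms show ?thesis
  proof (induction p rule: free_induct)
    case zero
    \<comment> \<open>Writing 0 as a multiple by the scalar 0 makes the semilinear rule give its
      value.\<close>
    have "twist_map \<phi> a b (free_smult 0 0 :: ('k, nat) free_element) = 0"
      by (subst tw(2)[of _ UNIV]) (simp_all add: field_automorphismD[OF \<phi>])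
    then show ?case by simp
  next
    case (single u c)
    then show ?case using word by (simp add: twist_map_single)
  next
    case (add p q)
    then show ?case by (simp add: tw(1)[of _ X])
  qed
qed

end

text \<open>Generators fix the values on words by the product rule, words fix their multiples by the
  scalar rule, and additivity does the rest. No restriction to \<open>free_carrier X\<close> is
  imposed on the maps, so \<open>twist_map\<close> and its composites can be compared
  directly.\<close>

lemma twisted_on_unique:
  assumes \<sigma>: "twisted_on \<phi> a b X \<sigma>" and \<tau>: "twisted_on \<phi> a b X \<tau>"
    and gen: "\<And>i. i \<in> X \<Longrightarrow> \<sigma> (free_gen i) = \<tau> (free_gen i)"
    and p: "p \<in> free_carrier X"
  shows "\<sigma> p = \<tau> p"
proof -
  have word: "letters u \<subseteq> X \<Longrightarrow> \<sigma> (Poly_Mapping.single u 1) = \<tau> (Poly_Mapping.single u 1)" for u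
  proof (induction u)
    case (Letter i)
    then show ?case using gen by simp
  next
    case (Juxt u v)
    then show ?case
      using twisted_onD(3)[OF \<sigma>, of "Poly_Mapping.single u 1" "Poly_Mapping.single v 1"]
        twisted_onD(3)[OF \<tau>, of "Poly_Mapping.single u 1" "Poly_Mapping.single v 1"] by simp
  qed
  have null: "\<rho> 0 = 0" if "twisted_on \<phi> a b X \<rho>" for \<rho>
    using twisted_onD(1)[OF that, of 0 0] by simp
  from p show ?thesis
  proof (induction p rule: free_induct)
    case zero
    then show ?case using null[OF \<sigma>] null[OF \<tau>] by simp
  next
    case (single u c)
    then show ?case
      using word twisted_onD(2)[OF \<sigma>, of "Poly_Mapping.single u 1" c]
        twisted_onD(2)[OF \<tau>, of "Poly_Mapping.single u 1" c] by simp
  next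
    case (add p q)
    then show ?case by (simp add: twisted_onD(1)[OF \<sigma>] twisted_onD(1)[OF \<tau>])
  qed
qed

text \<open>The three equations say that the composite has trivial twist; it fixes every generator,
  as the identity does.\<close>

lemma twist_map_inverse:
  fixes \<phi> \<psi> :: "'k::field \<Rightarrow> 'k" and p :: "('k, nat) free_element"
  assumes \<phi>: "\<phi> \<in> carrier field_automorphism_group" and \<psi>: "\<psi> \<in> carrier field_automorphism_group"
    and "\<phi> \<circ> \<psi> = id" "a * \<phi> c + b * \<phi> d = 1" "a * \<phi> d + b * \<phi> c = 0"
  shows "twist_map \<phi> a b (twist_map \<psi> c d p) = p"
proof -
  have "twisted_on id 1 0 UNIV (\<lambda>p. twist_map \<phi> a b (twist_map \<psi> c d p) :: ('k, nat) free_element)"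
    using twisted_on_compose[OF twist_map_twisted[OF \<phi>, of a b UNIV] twist_map_twisted[OF \<psi>, of c d UNIV]]
    unfolding assms(3-5) by simp
  moreover have "twisted_on id 1 0 UNIV (\<lambda>p :: ('k, nat) free_element. p)"
    by (simp add: twisted_on_def)
  ultimately show ?thesis
    by (rule twisted_on_unique) (simp_all add: twist_map_gen \<phi> \<psi>)
qed

text \<open>This is inversion in the semidirect product: \<open>\<psi>\<close> is the inverse of
  \<open>\<phi>\<close>, and \<open>c\<close>, \<open>d\<close> are obtained by applying
  \<open>\<psi>\<close> to the first row of the inverse matrix of
  \<open>circulant a b\<close>.\<close>

lemma circulant_field_inverse:
  fixes \<phi> :: "'k::field \<Rightarrow> 'k"
  assumes \<phi>: "\<phi> \<in> carrier field_automorphism_group" and ab: "a * a \<noteq> b * b"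
  obtains \<psi> c d where "\<psi> \<in> carrier field_automorphism_group" "\<phi> \<circ> \<psi> = id" "\<psi> \<circ> \<phi> = id"
    "a * \<phi> c + b * \<phi> d = 1" "a * \<phi> d + b * \<phi> c = 0" "c * \<psi> a + d * \<psi> b = 1" "c * \<psi> b + d * \<psi> a = 0"
proof -
  interpret field_aut: group "field_automorphism_group :: ('k \<Rightarrow> 'k) monoid"
    by (rule group_field_automorphism_group)
  let ?\<psi> = "inv\<^bsub>field_automorphism_group\<^esub> \<phi>" and ?D = "a * a - b * b"
  have \<psi>: "?\<psi> \<in> carrier field_automorphism_group" by (rule field_aut.inv_closed[OF \<phi>])
  have inv: "\<phi> \<circ> ?\<psi> = id" "?\<psi> \<circ> \<phi> = id"
    using field_aut.r_inv[OF \<phi>] field_aut.l_inv[OF \<phi>] by (simp_all add: field_automorphism_group_def)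
  have \<phi>\<psi>: "\<phi> (?\<psi> x) = x" for x using fun_cong[OF inv(1), of x] by simp
  have D: "?D \<noteq> 0" using ab by simp
  have 1: "a * (a / ?D) + b * (- b / ?D) = 1" "a * (- b / ?D) + b * (a / ?D) = 0"
    using D by (simp_all add: divide_simps)
  let ?c = "?\<psi> (a / ?D)" and ?d = "?\<psi> (- b / ?D)"
  show thesis
  proof (rule that[OF \<psi> inv, of ?c ?d])
    show "a * \<phi> ?c + b * \<phi> ?d = 1" "a * \<phi> ?d + b * \<phi> ?c = 0"
      by (simp_all only: \<phi>\<psi> 1)
    have "?c * ?\<psi> a + ?d * ?\<psi> b = ?\<psi> (a * (a / ?D) + b * (- b / ?D))"
      by (simp only: field_automorphismD(3,4)[OF \<psi>] mult.commute)
    then show "?c * ?\<psi> a + ?d * ?\<psi> b = 1"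
      by (simp only: 1 field_automorphismD(2)[OF \<psi>])
    have "?c * ?\<psi> b + ?d * ?\<psi> a = ?\<psi> (a * (- b / ?D) + b * (a / ?D))"
      by (simp only: field_automorphismD(3,4)[OF \<psi>] mult.commute add.commute)
    then show "?c * ?\<psi> b + ?d * ?\<psi> a = 0"
      by (simp only: 1 field_automorphismD(5)[OF \<psi>])
  qed
qed

text \<open>The maps \<open>\<sigma>\<close> and \<open>\<tau>\<close> are in general not arrows of
  the category, so this conjugation need not be inner. Exchanging them gives the inverse
  functor.\<close>

definition conj_functor :: "(('k::field, nat) free_element \<Rightarrow> ('k, nat) free_element) \<Rightarrow>
    (('k, nat) free_element \<Rightarrow> ('k, nat) free_element) \<Rightarrow> 'k free_functor" where
  "conj_functor \<sigma> \<tau> =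
     (\<lambda>A \<in> Ob free_algebra_category. A,
      \<lambda>(A, h, B) \<in> Mor free_algebra_category. (A, \<lambda>p \<in> carrier A. \<sigma> (h (\<tau> p)), B))"

lemma conj_functor_apply:
  "finite X \<Longrightarrow> fst (conj_functor \<sigma> \<tau>) (free_linear_algebra X) = free_linear_algebra X"
  "finite X \<Longrightarrow> finite Y \<Longrightarrow> h \<in> free_hom X Y \<Longrightarrow>
    snd (conj_functor \<sigma> \<tau>) (free_linear_algebra X, h, free_linear_algebra Y) =
      (free_linear_algebra X, \<lambda>p \<in> free_carrier X. \<sigma> (h (\<tau> p)), free_linear_algebra Y)"
  by (auto simp: conj_functor_def free_ObI free_Mor)

lemma conj_functor_endofunctor:
  assumes hom: "\<And>X Y h. h \<in> free_hom X Y \<Longrightarrow> (\<lambda>p \<in> free_carrier X. \<sigma> (h (\<tau> p))) \<in> free_hom X Y"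
    and \<tau>: "\<And>X p. p \<in> free_carrier X \<Longrightarrow> \<tau> p \<in> free_carrier X"
    and \<tau>\<sigma>: "\<And>p. \<tau> (\<sigma> p) = p" and \<sigma>\<tau>: "\<And>p. \<sigma> (\<tau> p) = p"
  shows "conj_functor \<sigma> \<tau> \<in> endofunctors free_algebra_category"
proof -
  let ?F = "conj_functor \<sigma> \<tau>"
  have "(fst ?F, snd ?F) \<in> endofunctors free_algebra_category"
  proof (rule free_cat.endofunctorI)
    show "fst ?F \<in> extensional (Ob free_algebra_category)" "snd ?F \<in> extensional (Mor free_algebra_category)"
      by (simp_all add: conj_functor_def)
  next
    fix A assume "A \<in> Ob (free_algebra_category :: (('a, nat nonassoc_word \<Rightarrow>\<^sub>0 'a) module, _) category)"
    then obtain X where X: "finite X" "A = free_linear_algebra X" by (auto simp: free_Ob)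
    then show "fst ?F A \<in> Ob free_algebra_category"
      by (simp add: conj_functor_apply free_ObI)
    show "snd ?F (Ident free_algebra_category A) = Ident free_algebra_category (fst ?F A)"
      using \<tau> X unfolding X free_Ident
      by (auto simp: conj_functor_apply free_hom_id \<sigma>\<tau> fun_eq_iff)
  next
    fix A B f assume f: "f \<in> Hom (free_algebra_category :: (('a, nat nonassoc_word \<Rightarrow>\<^sub>0 'a) module, _) category) A B"
    then obtain X Y where X: "finite X" and A: "A = free_linear_algebra X"
      and Y: "finite Y" and B: "B = free_linear_algebra Y"
      using free_cat.Hom_Ob(1,2)[OF f] by (auto simp: free_Ob)
    obtain h where h: "h \<in> free_hom X Y" and f_eq: "f = (free_linear_algebra X, h, free_linear_algebra Y)"
      using f unfolding A B free_Hom[OF X Y] by blast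
    show "snd ?F f \<in> Hom free_algebra_category (fst ?F A) (fst ?F B)"
      unfolding A B f_eq using hom[OF h] by (simp add: conj_functor_apply X Y h free_Hom)
    fix D g assume g: "g \<in> Hom free_algebra_category B D"
    then obtain Z where Z: "finite Z" and D: "D = free_linear_algebra Z"
      using free_cat.Hom_Ob(2)[OF g] by (auto simp: free_Ob)
    obtain h' where h': "h' \<in> free_hom Y Z" and g_eq: "g = (free_linear_algebra Y, h', free_linear_algebra Z)"
      using g unfolding B D free_Hom[OF Y Z] by blast
    have "(\<lambda>p \<in> free_carrier X. \<sigma> (compose (free_carrier X) h' h (\<tau> p))) =
        compose (free_carrier X) (\<lambda>p \<in> free_carrier Y. \<sigma> (h' (\<tau> p))) (\<lambda>p \<in> free_carrier X. \<sigma> (h (\<tau> p)))"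
    proof
      fix p
      show "(\<lambda>p \<in> free_carrier X. \<sigma> (compose (free_carrier X) h' h (\<tau> p))) p =
        compose (free_carrier X) (\<lambda>p \<in> free_carrier Y. \<sigma> (h' (\<tau> p))) (\<lambda>p \<in> free_carrier X. \<sigma> (h (\<tau> p))) p"
        using free_homD(1)[OF hom[OF h], of p] \<tau>[of p X]
        by (cases "p \<in> free_carrier X") (simp_all add: compose_def \<tau>\<sigma>)
    qed
    then show "snd ?F (Comp free_algebra_category g f) = Comp free_algebra_category (snd ?F g) (snd ?F f)"
      unfolding f_eq g_eq
      by (simp add: free_Comp conj_functor_apply X Y Z h h' free_hom_compose[OF h h'])
  qed
  then show ?thesis by simp
qed

lemma conj_functor_inverse:
  assumes hom: "\<And>X Y h. h \<in> free_hom X Y \<Longrightarrow> (\<lambda>p \<in> free_carrier X. \<tau> (h (\<sigma> p))) \<in> free_hom X Y"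
    and \<tau>: "\<And>X p. p \<in> free_carrier X \<Longrightarrow> \<tau> p \<in> free_carrier X"
    and \<sigma>\<tau>: "\<And>p. \<sigma> (\<tau> p) = p"
  shows "conj_functor \<sigma> \<tau> \<otimes>\<^bsub>End_monoid free_algebra_category\<^esub> conj_functor \<tau> \<sigma> =
    \<one>\<^bsub>End_monoid free_algebra_category\<^esub>"
proof -
  have "compose (Ob free_algebra_category) (fst (conj_functor \<sigma> \<tau>)) (fst (conj_functor \<tau> \<sigma>)) =
      (\<lambda>A \<in> Ob free_algebra_category. A)"
    by (auto simp: compose_def conj_functor_def fun_eq_iff)
  moreover have "compose (Mor free_algebra_category) (snd (conj_functor \<sigma> \<tau>)) (snd (conj_functor \<tau> \<sigma>)) f =
      (\<lambda>f \<in> Mor free_algebra_category. f) f" for f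
  proof (cases "f \<in> Mor free_algebra_category")
    case True
    then obtain X Y h where X: "finite X" and Y: "finite Y" and h: "h \<in> free_hom X Y"
      and f: "f = (free_linear_algebra X, h, free_linear_algebra Y)"
      by (auto simp: free_Mor)
    have "(\<lambda>p \<in> free_carrier X. \<sigma> ((\<lambda>p \<in> free_carrier X. \<tau> (h (\<sigma> p))) (\<tau> p))) = h"
    proof
      fix p
      show "(\<lambda>p \<in> free_carrier X. \<sigma> ((\<lambda>p \<in> free_carrier X. \<tau> (h (\<sigma> p))) (\<tau> p))) p = h p"
        using \<tau>[of p X] linear_algebra_homD(1)[OF h, of p] by (simp add: \<sigma>\<tau>)
    qed
    then have "snd (conj_functor \<sigma> \<tau>) (snd (conj_functor \<tau> \<sigma>) f) = f"
      by (simp add: f conj_functor_apply X Y h hom[OF h])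
    with True show ?thesis by (simp add: compose_eq)
  qed (simp add: compose_def)
  ultimately show ?thesis by (simp add: End_monoid_def fun_eq_iff)
qed

text \<open>A homomorphism has trivial twist, so between mutually inverse twists the two twists
  cancel and the conjugate is again a homomorphism. The map \<open>?\<sigma>\<close> itself, used on
  every algebra, is then the natural family.\<close>

lemma twist_realised:
  fixes \<phi> :: "'k::field \<Rightarrow> 'k"
  assumes \<phi>: "\<phi> \<in> carrier field_automorphism_group" and ab: "a * a \<noteq> b * b"
  shows "\<exists>F. twist F \<phi> a b"
proof -
  obtain \<psi> c d where \<psi>: "\<psi> \<in> carrier field_automorphism_group"
    and inv: "\<phi> \<circ> \<psi> = id" "\<psi> \<circ> \<phi> = id"
    and eq: "a * \<phi> c + b * \<phi> d = 1" "a * \<phi> d + b * \<phi> c = 0"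
      "c * \<psi> a + d * \<psi> b = 1" "c * \<psi> b + d * \<psi> a = 0"
    by (rule circulant_field_inverse[OF \<phi> ab]) (rule that)
  let ?\<sigma> = "twist_map \<phi> a b :: ('k, nat) free_element \<Rightarrow> _"
  let ?\<tau> = "twist_map \<psi> c d :: ('k, nat) free_element \<Rightarrow> _"
  have \<sigma>\<tau>: "?\<sigma> (?\<tau> p) = p" for p by (rule twist_map_inverse[OF \<phi> \<psi> inv(1) eq(1,2)])
  have \<tau>\<sigma>: "?\<tau> (?\<sigma> p) = p" for p by (rule twist_map_inverse[OF \<psi> \<phi> inv(2) eq(3,4)])
  note \<sigma>_closed = twist_map_closed[OF \<phi>, of _ _ a b] and \<tau>_closed = twist_map_closed[OF \<psi>, of _ _ c d]
  \<comment> \<open>The parameters are generalised here because the same fact is needed for the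
    inverse functor, with the roles of the two twists exchanged.\<close>
  have hom: "(\<lambda>p \<in> free_carrier X. twist_map \<phi> a b (h (twist_map \<psi> c d p))) \<in> free_hom X Y"
    if h: "h \<in> free_hom X Y" and \<phi>: "\<phi> \<in> carrier field_automorphism_group"
      and \<psi>: "\<psi> \<in> carrier field_automorphism_group"
      and inv: "\<phi> \<circ> \<psi> = id" and eq: "a * \<phi> c + b * \<phi> d = 1" "a * \<phi> d + b * \<phi> c = 0"
    for X Y and h :: "('k, nat) free_element \<Rightarrow> ('k, nat) free_element" and \<phi> \<psi> :: "'k \<Rightarrow> 'k" and a b c d
  proof (rule hom_if_twisted_on)
    have "twisted_on \<psi> c d X (\<lambda>p. h (twist_map \<psi> c d p))"
      using twisted_on_compose[OF twisted_on_hom[OF h] twist_map_twisted[OF \<psi>, of c d X] twist_map_closed[OF \<psi>]]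
      by simp
    from twisted_on_compose[OF twist_map_twisted[OF \<phi>, of a b Y] this]
    show "twisted_on id 1 0 X (\<lambda>p. twist_map \<phi> a b (h (twist_map \<psi> c d p)))"
      unfolding inv eq using free_homD(1)[OF h] twist_map_closed[OF \<psi>] by blast
    show "twist_map \<phi> a b (h (twist_map \<psi> c d p)) \<in> free_carrier Y" if "p \<in> free_carrier X" for p
      using that free_homD(1)[OF h] twist_map_closed[OF \<phi>] twist_map_closed[OF \<psi>] by blast
  qed
  note hom1 = hom[OF _ \<phi> \<psi> inv(1) eq(1,2)] and hom2 = hom[OF _ \<psi> \<phi> inv(2) eq(3,4)]
  let ?F = "conj_functor ?\<sigma> ?\<tau>" and ?G = "conj_functor ?\<tau> ?\<sigma>"
  have F: "?F \<in> endofunctors free_algebra_category"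
    by (rule conj_functor_endofunctor[OF hom1 \<tau>_closed \<tau>\<sigma> \<sigma>\<tau>])
  have G: "?G \<in> endofunctors free_algebra_category"
    by (rule conj_functor_endofunctor[OF hom2 \<sigma>_closed \<sigma>\<tau> \<tau>\<sigma>])
  have FA: "?F \<in> carrier (Aut_group free_algebra_category)"
    using F G conj_functor_inverse[OF hom2 \<tau>_closed \<sigma>\<tau>] conj_functor_inverse[OF hom1 \<sigma>_closed \<tau>\<sigma>]
    by (auto simp: Aut_group_def units_of_def Units_def End_monoid_def)
  have gens: "gens_of ?F X = X" if "finite X" for X
    using that by (simp add: gens_of_def conj_functor_apply the_inv_f_f[OF inj_free_linear_algebra])
  have "natural_family ?F (\<lambda>_. ?\<sigma>)"
    unfolding natural_family_def
  proof (intro conjI allI impI ballI)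
    fix X :: "nat set" assume X: "finite X"
    show "bij_betw ?\<sigma> (free_carrier X) (free_carrier (gens_of ?F X))"
      unfolding gens[OF X] using \<sigma>\<tau> \<tau>\<sigma> \<sigma>_closed \<tau>_closed
      by (intro bij_betw_byWitness[where f' = ?\<tau>]) auto
    fix Y and h :: "('k, nat) free_element \<Rightarrow> ('k, nat) free_element" and p :: "('k, nat) free_element"
    assume Y: "finite Y" and h: "h \<in> free_hom X Y" and p: "p \<in> free_carrier X"
    show "arr_of ?F X Y h (?\<sigma> p) = ?\<sigma> (h p)"
      using \<sigma>_closed[OF p] by (simp add: arr_of_def conj_functor_apply X Y h \<tau>\<sigma>)
  qed
  then show ?thesis
    using FA \<phi> ab twist_map_twisted[OF \<phi>] unfolding twist_def
    by (intro exI[of _ ?F] conjI exI[of _ "\<lambda>_. ?\<sigma>"]) simp_all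
qed

section \<open>The outer automorphism group\<close>

text \<open>Collecting all matrices that occur avoids choosing a twist. By
  \<open>twist_scale\<close> and \<open>twist_unique\<close> they form exactly one coset of the
  scalar matrices.\<close>

definition outer_class :: "'k::field free_functor \<Rightarrow> ('k ^ 2 ^ 2) set \<times> ('k \<Rightarrow> 'k)" where
  "outer_class F = ({circulant a b | a b. \<exists>\<phi>. twist F \<phi> a b}, THE \<phi>. \<exists>a b. twist F \<phi> a b)"

lemma scalar_coset:
  "scalar_matrices #>\<^bsub>circulant_group\<^esub> circulant a b = {circulant (\<delta> * a) (\<delta> * b) | \<delta>. \<delta> \<noteq> 0}"
  by (auto simp: r_coset_def scalar_matrices_def circulant_group_def mat_circulant circulant_mult)

lemma outer_class_eq:
  assumes "twist F \<phi> a b"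
  shows "outer_class F = (scalar_matrices #>\<^bsub>circulant_group\<^esub> circulant a b, \<phi>)"
proof -
  have "{circulant c d | c d. \<exists>\<psi>. twist F \<psi> c d} = {circulant (\<delta> * a) (\<delta> * b) | \<delta>. \<delta> \<noteq> 0}"
    using twist_scale[OF assms] twist_unique(2)[OF assms] by blast
  moreover have "(THE \<psi>. \<exists>c d. twist F \<psi> c d) = \<phi>"
    using assms twist_unique(1)[OF assms] by (intro the_equality) blast+
  ultimately show ?thesis by (simp add: outer_class_def scalar_coset)
qed

lemma circulant_carrier: "a * a \<noteq> b * b \<Longrightarrow> circulant a b \<in> carrier circulant_group"
  by (auto simp: circulant_group_def invertible_circulant)

lemma outer_class_closed:
  assumes "twist F \<phi> a b"
  shows "outer_class F \<in> carrier (semidirect_product circulant_quotient field_automorphism_group entrywise_action)"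
  using assms circulant_carrier[of a b]
  by (auto simp: outer_class_eq[OF assms] semidirect_product_def circulant_quotient_def carrier_FactGroup twist_def)

text \<open>The composition rule for twists is the multiplication of the semidirect product, read on
  representatives of cosets.\<close>

lemma outer_class_mult:
  assumes F: "twist F \<phi> a b" and G: "twist G \<psi> c d"
  shows "outer_class (F \<otimes>\<^bsub>Aut_group free_algebra_category\<^esub> G) =
    outer_class F \<otimes>\<^bsub>semidirect_product circulant_quotient field_automorphism_group entrywise_action\<^esub> outer_class G"
proof -
  interpret N: normal scalar_matrices circulant_group by (rule normal_scalar_matrices)
  have \<phi>: "\<phi> \<in> carrier field_automorphism_group" using F by (simp add: twist_def)
  have A: "circulant a b \<in> carrier circulant_group" "circulant c d \<in> carrier circulant_group"
    using F G by (simp_all add: twist_def circulant_carrier)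
  then have "entrywise_action \<phi> (scalar_matrices #>\<^bsub>circulant_group\<^esub> circulant c d) =
      scalar_matrices #>\<^bsub>circulant_group\<^esub> circulant (\<phi> c) (\<phi> d)"
    using map_matrix_coset[OF \<phi> A(2)]
    by (auto simp: entrywise_action_def circulant_quotient_def carrier_FactGroup map_circulant)
  moreover have "circulant (\<phi> c) (\<phi> d) \<in> carrier circulant_group"
    using map_matrix_carrier[OF \<phi> A(2)] by (simp add: map_circulant)
  then have "(scalar_matrices #>\<^bsub>circulant_group\<^esub> circulant a b)
      \<otimes>\<^bsub>circulant_quotient\<^esub> (scalar_matrices #>\<^bsub>circulant_group\<^esub> circulant (\<phi> c) (\<phi> d)) =
      scalar_matrices #>\<^bsub>circulant_group\<^esub> circulant (a * \<phi> c + b * \<phi> d) (a * \<phi> d + b * \<phi> c)"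
    using N.rcos_sum[OF A(1)]
    by (simp add: circulant_quotient_def) (simp add: circulant_group_def circulant_mult)
  ultimately show ?thesis
    unfolding outer_class_eq[OF twist_mult[OF F G]] outer_class_eq[OF F] outer_class_eq[OF G]
    by (simp add: semidirect_product_def field_automorphism_group_def)
qed

lemma outer_class_one:
  assumes "twist F \<phi> a b"
  shows "outer_class F = \<one>\<^bsub>semidirect_product circulant_quotient field_automorphism_group entrywise_action\<^esub>
    \<longleftrightarrow> F \<in> inner_automorphisms free_algebra_category"
proof
  have one: "\<one>\<^bsub>semidirect_product circulant_quotient field_automorphism_group entrywise_action\<^esub> =
      (scalar_matrices #>\<^bsub>circulant_group\<^esub> circulant 1 0, id)"
    unfolding scalar_coset
    by (auto simp: semidirect_product_def circulant_quotient_def FactGroup_def field_automorphism_group_def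
        scalar_matrices_def mat_circulant)
  show "outer_class F = \<one>\<^bsub>semidirect_product circulant_quotient field_automorphism_group entrywise_action\<^esub>"
    if "F \<in> inner_automorphisms free_algebra_category"
    unfolding one by (rule outer_class_eq[OF twist_if_inner[OF that]])
  assume "outer_class F = \<one>\<^bsub>semidirect_product circulant_quotient field_automorphism_group entrywise_action\<^esub>"
  then have "\<phi> = id" and coset: "{circulant (\<delta> * a) (\<delta> * b) | \<delta>. \<delta> \<noteq> 0} = {circulant (\<delta> * 1) (\<delta> * 0) | \<delta>. \<delta> \<noteq> 0}"
    unfolding one outer_class_eq[OF assms] scalar_coset by simp_all
  \<comment> \<open>Membership of the identity matrix yields the factor by which the given twist is
    rescaled to the trivial one.\<close>
  have "circulant (1 * 1) (1 * 0) \<in> {circulant (\<delta> * a) (\<delta> * b) | \<delta>. \<delta> \<noteq> 0}"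
    unfolding coset by (intro CollectI exI[of _ 1]) simp
  then obtain \<delta> where "\<delta> \<noteq> 0" "\<delta> * a = 1" "\<delta> * b = 0"
    by (auto simp: circulant_inj)
  then have "twist F id 1 0" using twist_scale[OF assms, of \<delta>] \<open>\<phi> = id\<close> by simp
  then show "F \<in> inner_automorphisms free_algebra_category" by (rule inner_if_twist)
qed

text \<open>The first isomorphism theorem for \<open>outer_class\<close>. Infinitude of the field
  enters through the existence of a twist for each automorphism; realising a given twist is a
  construction over any field.\<close>

theorem corollary2:
  assumes "infinite (UNIV :: 'k::field set)"
  shows "Aut_group (free_algebra_category ::
      (('k, nat nonassoc_word \<Rightarrow>\<^sub>0 'k) module,
       ('k, nat nonassoc_word \<Rightarrow>\<^sub>0 'k) module \<times>
       ((nat nonassoc_word \<Rightarrow>\<^sub>0 'k) \<Rightarrow> (nat nonassoc_word \<Rightarrow>\<^sub>0 'k)) \<times>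
       ('k, nat nonassoc_word \<Rightarrow>\<^sub>0 'k) module) category)
      Mod inner_automorphisms free_algebra_category
    \<cong> semidirect_product (circulant_quotient :: ('k ^ 2 ^ 2) set monoid)
        field_automorphism_group entrywise_action"
proof -
  let ?A = "Aut_group free_algebra_category :: 'k free_functor monoid"
  let ?S = "semidirect_product (circulant_quotient :: ('k ^ 2 ^ 2) set monoid)
    field_automorphism_group entrywise_action"
  interpret S: group ?S
    by (rule group_semidirect_product[OF group_circulant_quotient group_field_automorphism_group
          entrywise_action_action])
  have tw: "\<exists>\<phi> a b. twist F \<phi> a b" if "F \<in> carrier ?A" for F
    by (rule twist_exists[OF assms that])
  have "outer_class \<in> hom ?A ?S"
  proof (rule homI)
    fix F assume "F \<in> carrier ?A"
    then obtain \<phi> a b where F: "twist F \<phi> a b" using tw by blast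
    then show "outer_class F \<in> carrier ?S" by (rule outer_class_closed)
    fix G assume "G \<in> carrier ?A"
    then obtain \<psi> c d where "twist G \<psi> c d" using tw by blast
    with F show "outer_class (F \<otimes>\<^bsub>?A\<^esub> G) = outer_class F \<otimes>\<^bsub>?S\<^esub> outer_class G"
      by (rule outer_class_mult)
  qed
  then interpret group_hom ?A ?S outer_class
    by unfold_locales
  have "kernel ?A ?S outer_class = inner_automorphisms free_algebra_category"
    unfolding kernel_def
  proof (intro equalityI subsetI CollectI conjI)
    fix F assume "F \<in> {F \<in> carrier ?A. outer_class F = \<one>\<^bsub>?S\<^esub>}"
    then have F: "F \<in> carrier ?A" "outer_class F = \<one>\<^bsub>?S\<^esub>" by simp_all
    obtain \<phi> a b where "twist F \<phi> a b" using tw[OF F(1)] by blast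
    from iffD1[OF outer_class_one[OF this] F(2)] show "F \<in> inner_automorphisms free_algebra_category" .
  next
    fix F :: "'k free_functor" assume F: "F \<in> inner_automorphisms free_algebra_category"
    note t = twist_if_inner[OF F]
    then show "F \<in> carrier ?A" by (simp add: twist_def)
    show "outer_class F = \<one>\<^bsub>?S\<^esub>" by (rule iffD2[OF outer_class_one[OF t] F])
  qed
  moreover have "outer_class ` carrier ?A = carrier ?S"
  proof
    show "outer_class ` carrier ?A \<subseteq> carrier ?S" by auto
    show "carrier ?S \<subseteq> outer_class ` carrier ?A"
    proof
      fix x assume "x \<in> carrier ?S"
      then obtain M \<phi> where x: "x = (scalar_matrices #>\<^bsub>circulant_group\<^esub> M, \<phi>)"
        "M \<in> carrier circulant_group" "\<phi> \<in> carrier field_automorphism_group"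
        by (auto simp: semidirect_product_def circulant_quotient_def carrier_FactGroup)
      then obtain a b where ab: "M = circulant a b" "a * a \<noteq> b * b"
        by (auto simp: circulant_group_def invertible_circulant)
      obtain F where F: "twist F \<phi> a b" using twist_realised[OF x(3) ab(2)] by blast
      then have "outer_class F = x" "F \<in> carrier ?A"
        using outer_class_eq[OF F] by (simp_all add: x ab twist_def)
      then show "x \<in> outer_class ` carrier ?A" by blast
    qed
  qed
  ultimately show ?thesis using FactGroup_iso by simp
qed

end
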